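(* Let $n\ge 1$, $1\le k\le n$, let $r>0$ be a constant and let $$D=\big\{(x,t)\in\mathbb{R}^n\times(-\infty,0]:\ |x|^2-r^2<t\big\}.$$ Let $\psi=\psi(x,t,z)\ge 0$ be a function on $\overline{D}\times\mathbb{R}$ that is Lipschitz continuous with respect to $x$ and with respect to $z$. Assume that $u\in C^{4,2}(D)\cap C^{2,1}(\overline{D})$ is a $k$-convex-monotone solution to $$-u_t\,\sigma_k(\lambda(D^2u))=\psi(x,t,u)\quad\text{in } D$$ satisfying $-u_t\ge m_1>0$ in $D$ for some constant $m_1$. Then $$|Du(0,0)|\le C_1+C_2\,\frac{\sup_D|u|}{r},$$ where $C_1$ is a positive constant depending only on $n$, $k$, $r$, $m_1$, $\sup_D|u|$ and $\sup_{D\times\mathbb{R}}(|\psi_x|+|\psi_z|)$, and $C_2>0$ is a constant depending only on $n$, $k$, $m_1$ and $\sup_{D\times\mathbb{R}}\psi$. In particular, if $\psi$ is a constant, then the estimate holds with $C_1=0$.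
   Context: Points of $\overline D\times\mathbb R$ are written $(x,t,z)$ with $(x,t)\in\overline D$, $z\in\mathbb R$. For $u=u(x,t)$, $Du$ and $D^2u$ denote the gradient and the Hessian matrix with respect to $x$ only, and $u_t$ the derivative with respect to $t$. $\lambda(D^2u)=(\lambda_1,\dots,\lambda_n)$ is the vector of eigenvalues of $D^2u$, and $\sigma_k(\lambda)=\sum_{1\le i_1<\cdots<i_k\le n}\lambda_{i_1}\cdots\lambda_{i_k}$. Let $\Gamma_k=\{\lambda\in\mathbb{R}^n:\sigma_j(\lambda)>0,\ j=1,\dots,k\}$. A $C^2$ function of $x$ on an open set is $k$-convex if $\lambda(D^2u(x))\in\overline{\Gamma}_k$ at every point $x$; a function $u(x,t)$ is $k$-convex-monotone if it is $k$-convex in $x$ and decreasing in $t$. $C^{2m,m}$ means that the derivatives $D_t^iD_x^ju$ with $2i+j\le 2m$ exist and are continuous. $\psi_x$ and $\psi_z$ denote the first derivatives of $\psi$ in $x$ and $z$ (existing almost everywhere by Lipschitz continuity). The suprema on which the constants depend are understood to be finite. *)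

theory Defs
  imports "HOL-Analysis.Analysis"
begin

definition parabolic_dom :: "real \<Rightarrow> ((real ^ 'n) \<times> real) set" where
  "parabolic_dom r = {(x, t). t \<le> 0 \<and> (norm x)\<^sup>2 - r\<^sup>2 < t}"

section \<open>Partial derivatives and parabolic smoothness\<close>

datatype 'n var = VarX 'n | VarT

text \<open>All functions below are considered on sets of points \<open>(x, t)\<close> with \<open>t \<le> 0\<close> that are
  relatively open in that half space. Hence the \<open>t\<close>-derivative is taken within \<open>{..0}\<close>: it is the
  usual derivative for \<open>t < 0\<close> and the left derivative at \<open>t = 0\<close>.\<close>

fun pdiff :: "'n var \<Rightarrow> ((real ^ 'n) \<times> real \<Rightarrow> real) \<Rightarrow> (real ^ 'n) \<times> real \<Rightarrow> bool" where
  "pdiff (VarX i) f (x, t) \<longleftrightarrow> (\<lambda>h. f (x + h *\<^sub>R axis i 1, t)) differentiable (at 0)"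
| "pdiff VarT f (x, t) \<longleftrightarrow> (\<lambda>s. f (x, s)) differentiable (at t within {..0})"

fun pd :: "'n var \<Rightarrow> ((real ^ 'n) \<times> real \<Rightarrow> real) \<Rightarrow> (real ^ 'n) \<times> real \<Rightarrow> real" where
  "pd (VarX i) f (x, t) = vector_derivative (\<lambda>h. f (x + h *\<^sub>R axis i 1, t)) (at 0)"
| "pd VarT f (x, t) = vector_derivative (\<lambda>s. f (x, s)) (at t within {..0})"

definition grad_x :: "((real ^ 'n) \<times> real \<Rightarrow> real) \<Rightarrow> (real ^ 'n) \<times> real \<Rightarrow> real ^ 'n" where
  "grad_x f p = (\<chi> i. pd (VarX i) f p)"

definition hess_x :: "((real ^ 'n) \<times> real \<Rightarrow> real) \<Rightarrow> (real ^ 'n) \<times> real \<Rightarrow> real ^ 'n ^ 'n" where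
  "hess_x f p = (\<chi> i j. pd (VarX i) (pd (VarX j) f) p)"

text \<open>A mixed derivative is given by the list of variables of differentiation, the last entry
  being applied first. A derivative in \<open>t\<close> counts twice.\<close>

fun par_weight :: "'n var list \<Rightarrow> nat" where
  "par_weight [] = 0"
| "par_weight (VarX i # w) = 1 + par_weight w"
| "par_weight (VarT # w) = 2 + par_weight w"

definition C_par :: "nat \<Rightarrow> ((real ^ 'n) \<times> real) set \<Rightarrow> ((real ^ 'n) \<times> real \<Rightarrow> real) \<Rightarrow> bool" where
  "C_par m S f \<longleftrightarrow>
     (\<forall>w. par_weight w \<le> 2 * m \<longrightarrow> continuous_on S (foldr pd w f)) \<and>
     (\<forall>v w. par_weight (v # w) \<le> 2 * m \<longrightarrow> (\<forall>p\<in>S. pdiff v (foldr pd w f) p))"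

text \<open>Regularity up to the boundary: the derivatives, which exist in \<open>S\<close>, extend continuously to
  the closure of \<open>S\<close>. (At points of the lateral boundary of the domain, derivatives need not make
  sense directly: sections of its closure may be single points.)\<close>

definition C_par_closure ::
  "nat \<Rightarrow> ((real ^ 'n) \<times> real) set \<Rightarrow> ((real ^ 'n) \<times> real \<Rightarrow> real) \<Rightarrow> bool" where
  "C_par_closure m S f \<longleftrightarrow>
     continuous_on (closure S) f \<and> C_par m S f \<and>
     (\<forall>w. par_weight w \<le> 2 * m \<longrightarrow>
        (\<exists>g. continuous_on (closure S) g \<and> (\<forall>p\<in>S. g p = foldr pd w f p)))"

section \<open>Hessian operators\<close>

text \<open>The eigenvalues, repeated according to multiplicity, are the roots of the characteristic
  polynomial. A real symmetric matrix has such a vector, unique up to the order of its entries;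
  the order chosen is irrelevant below, since \<open>sigma_k\<close> and \<open>Gam\<close> are symmetric.\<close>

definition eigenvalue_vec :: "real ^ 'n ^ 'n \<Rightarrow> real ^ 'n" where
  "eigenvalue_vec A = (SOME l. \<forall>s. det (mat s - A) = (\<Prod>i\<in>UNIV. s - l $ i))"

definition sigma_k :: "nat \<Rightarrow> real ^ 'n \<Rightarrow> real" where
  "sigma_k k l = (\<Sum>I | I \<subseteq> UNIV \<and> card I = k. \<Prod>i\<in>I. l $ i)"

definition Gam :: "nat \<Rightarrow> (real ^ 'n) set" where
  "Gam k = {l. \<forall>j\<in>{1..k}. sigma_k j l > 0}"

definition k_convex_monotone ::
  "nat \<Rightarrow> ((real ^ 'n) \<times> real) set \<Rightarrow> ((real ^ 'n) \<times> real \<Rightarrow> real) \<Rightarrow> bool" where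
  "k_convex_monotone k S u \<longleftrightarrow>
     (\<forall>p\<in>S. eigenvalue_vec (hess_x u p) \<in> closure (Gam k)) \<and>
     (\<forall>x s t. (x, s) \<in> S \<longrightarrow> (x, t) \<in> S \<longrightarrow> s \<le> t \<longrightarrow> u (x, t) \<le> u (x, s))"

section \<open>The right-hand side\<close>

definition lipschitz_x :: "((real ^ 'n) \<times> real) set \<Rightarrow> ((real ^ 'n) \<times> real \<Rightarrow> real \<Rightarrow> real) \<Rightarrow> bool"
  where "lipschitz_x S \<psi> \<longleftrightarrow> (\<exists>L. \<forall>t z. L-lipschitz_on {x. (x, t) \<in> S} (\<lambda>x. \<psi> (x, t) z))"

definition lipschitz_z :: "((real ^ 'n) \<times> real) set \<Rightarrow> ((real ^ 'n) \<times> real \<Rightarrow> real \<Rightarrow> real) \<Rightarrow> bool"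
  where "lipschitz_z S \<psi> \<longleftrightarrow> (\<exists>L. \<forall>p\<in>S. L-lipschitz_on UNIV (\<psi> p))"

text \<open>The values of \<open>|\<psi>\<^sub>x| + |\<psi>\<^sub>z|\<close> at the points where these first derivatives exist, which for
  Lipschitz \<open>\<psi>\<close> is the case almost everywhere.\<close>

definition deriv_values ::
  "((real ^ 'n) \<times> real) set \<Rightarrow> ((real ^ 'n) \<times> real \<Rightarrow> real \<Rightarrow> real) \<Rightarrow> real set" where
  "deriv_values S \<psi> =
     {norm (grad_x (\<lambda>q. \<psi> q z) p) + \<bar>deriv (\<psi> p) z\<bar> | p z.
        p \<in> S \<and> (\<forall>i. pdiff (VarX i) (\<lambda>q. \<psi> q z) p) \<and> (\<psi> p) differentiable (at z)}"

end

theory Submission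
  imports Defs "HOL-Computational_Algebra.Fundamental_Theorem_Algebra" "HOL-Combinatorics.Permutations"
begin

text \<open>The estimate comes from the maximum principle. With \<open>M = sup |u|\<close>,
  \<open>\<rho>(x, t) = r\<^sup>2 - |x|\<^sup>2 + t\<close> and \<open>y = 2 M - u\<close>, which lies between \<open>M\<close> and \<open>3 M\<close>, the function
  \<open>\<rho> |Du| / sqrt y\<close> vanishes on the parabolic boundary and therefore attains its maximum at a point of the
  domain (\<open>weighted_gradient_attains_max\<close>). Write \<open>p = |Du|\<close> at this point and \<open>e = Du / p\<close> for the fixed
  direction of the gradient there. The function \<open>ln \<rho> - ln y / 2 + ln (D\<^sub>e u)\<close> has a maximum at the same point, so its
  first space derivatives vanish, its pure second derivatives along an orthonormal eigenbasis \<open>v\<^sub>i\<close> of \<open>D\<^sup>2u\<close>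
  are \<open>\<le> 0\<close>, and its left time derivative is \<open>\<ge> 0\<close>.

  Let \<open>\<lambda>\<^sub>i\<close> be the eigenvalues of \<open>D\<^sup>2u\<close>, \<open>e\<^sub>i = v\<^sub>i \<bullet> e\<close>, and \<open>f\<^sub>i = \<sigma>\<^bsub>k-1\<^esub>(\<lambda> without \<lambda>\<^sub>i)\<close>. The derivative of
  \<open>\<sigma>\<^sub>k(D\<^sup>2u)\<close> in direction \<open>e\<close> is the sum of the second derivatives of \<open>D\<^sub>e u\<close> in the directions \<open>v\<^sub>i\<close> with weights \<open>f\<^sub>i\<close>, so
  adding up the second-order conditions with these weights produces the differentiated equation. The exponent \<open>-1/2\<close> of \<open>y\<close>
  leaves a good term \<open>\<Sum>\<^sub>i f\<^sub>i e\<^sub>i\<^sup>2 p\<^sup>2/(8y\<^sup>2)\<close>. If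
  \<open>p \<rho>\<close> is large compared with \<open>r M\<close>, the first-order condition makes \<open>\<Sum>\<^sub>i \<lambda>\<^sub>i e\<^sub>i\<^sup>2 \<le> - p\<^sup>2/(4y)\<close>: the
  solution is very concave in the direction of its gradient. On the closure of \<open>\<Gamma>\<^sub>k\<close> this has two consequences:
  \<open>\<Sum>\<^sub>i f\<^sub>i e\<^sub>i\<^sup>2\<close> dominates the trace \<open>\<Sum>\<^sub>i f\<^sub>i\<close> up to the factor \<open>n\<close> (\<open>weighted_esym_remove_ge\<close>), so that the good term
  absorbs the derivatives of \<open>\<rho>\<close>; and \<open>\<Sum>\<^sub>i f\<^sub>i e\<^sub>i\<^sup>2\<close> is at least a constant times \<open>(p\<^sup>2/y)\<^bsup>k-1\<^esup>\<close>
  (\<open>closure_Gam_esym_lower_bound\<close>). What remains is \<open>maximum_point_inequality\<close>: a power \<open>p\<^bsup>2k\<^esup>\<close> bounded by \<open>\<psi>/\<rho>\<close> and by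
  the derivative of \<open>\<psi>\<close> along the graph of \<open>u\<close>. Since \<open>- u\<^sub>t \<ge> m\<^sub>1\<close> forces \<open>2 M \<ge> m\<^sub>1 r\<^sup>2\<close> (\<open>oscillation_lower_bound\<close>), the
  first of these bounds \<open>\<rho> p\<close> by a multiple of \<open>M r\<close>, which gives the term \<open>C\<^sub>2 M / r\<close>; the second gives \<open>C\<^sub>1\<close> and is absent
  for constant \<open>\<psi>\<close>.

  Two ingredients are of independent interest. The algebra of \<open>\<Gamma>\<^sub>k\<close> rests on the fact that deleting a component maps
  \<open>\<Gamma>\<^sub>k\<close> to \<open>\<Gamma>\<^bsub>k-1\<^esub>\<close>; this follows from Newton's inequality, hence from the real-rootedness of the derivatives of a
  real-rooted polynomial. And the supremum of \<open>|\<psi>\<^sub>x| + |\<psi>\<^sub>z|\<close> over the points where all partial derivatives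
  exist bounds the increments of \<open>\<psi>\<close>; this needs the differentiability almost everywhere of Lipschitz functions on
  lines, which is proved here by Vitali coverings and transferred to higher dimension by Fubini's theorem.\<close>

section \<open>Real-rooted polynomials and Newton's inequality\<close>

text \<open>Splitting into real linear factors. The zero polynomial counts as real-rooted, so that the class is closed under
differentiation.\<close>

definition real_rooted :: "real poly \<Rightarrow> bool" where
  "real_rooted p \<longleftrightarrow> (\<exists>c R. p = smult c (\<Prod>r\<in>#R. [:- r, 1:]))"

lemma real_rooted_mult:
  assumes "real_rooted p" "real_rooted q" shows "real_rooted (p * q)"
proof -
  obtain c R d S where "p = smult c (\<Prod>r\<in>#R. [:- r, 1:])" "q = smult d (\<Prod>r\<in>#S. [:- r, 1:])"
    using assms by (auto simp: real_rooted_def)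
  then have "p * q = smult (c * d) (\<Prod>r\<in>#(R + S). [:- r, 1:])"
    by (simp add: mult_ac)
  then show ?thesis unfolding real_rooted_def by blast
qed

lemma real_rooted_const: "real_rooted [:c:]"
  unfolding real_rooted_def by (intro exI[of _ c] exI[of _ "{#}"]) simp

lemma real_rooted_linear: "real_rooted [:1, a:]"
proof (cases "a = 0")
  case True
  then show ?thesis using real_rooted_const[of 1] by simp
next
  case False
  then show ?thesis
    unfolding real_rooted_def by (intro exI[of _ a] exI[of _ "{#- (1 / a)#}"]) simp
qed

lemma real_rooted_prod_linear:
  "real_rooted (\<Prod>i\<in>I. [:1, f i:])"
proof (induction I rule: infinite_finite_induct)
  case (insert x F)
  then show ?case by (simp add: real_rooted_mult real_rooted_linear del: mult_pCons_left)
qed (use real_rooted_const[of 1] in \<open>simp_all add: pCons_one\<close>)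

text \<open>Laguerre's inequality: away from the roots, \<open>(p' / p)' = - \<Sum> 1 / (x - r)\<^sup>2\<close>.\<close>

lemma real_rooted_laguerre:
  assumes "real_rooted p"
  shows "poly p x * poly (pderiv (pderiv p)) x \<le> (poly (pderiv p) x)\<^sup>2"
proof -
  obtain c R where p: "p = smult c (\<Prod>r\<in>#R. [:- r, 1:])"
    using assms by (auto simp: real_rooted_def)
  define g where "g R = (\<Prod>r\<in>#R. [:- r, 1::real:])" for R
  have g: "poly (g R) x * poly (pderiv (pderiv (g R))) x \<le> (poly (pderiv (g R)) x)\<^sup>2"
  proof (induction R)
    case empty
    then show ?case by (simp add: g_def)
  next
    case (add r R)
    have eq: "g (add_mset r R) = [:-r, 1:] * g R"
      by (simp add: g_def)
    have d1: "poly (pderiv (g (add_mset r R))) x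
        = poly (g R) x + (x - r) * poly (pderiv (g R)) x"
      unfolding eq pderiv_mult by (simp add: pderiv_pCons algebra_simps)
    have d2: "poly (pderiv (pderiv (g (add_mset r R)))) x
        = 2 * poly (pderiv (g R)) x + (x - r) * poly (pderiv (pderiv (g R))) x"
      unfolding eq pderiv_mult pderiv_add by (simp add: pderiv_pCons pderiv_mult algebra_simps)
    have "(poly (pderiv (g (add_mset r R))) x)\<^sup>2
        - poly (g (add_mset r R)) x * poly (pderiv (pderiv (g (add_mset r R)))) x
      = (poly (g R) x)\<^sup>2 + (x - r)\<^sup>2 *
        ((poly (pderiv (g R)) x)\<^sup>2 - poly (g R) x * poly (pderiv (pderiv (g R))) x)"
      unfolding d1 d2 by (simp add: eq algebra_simps power2_eq_square)
    also have "\<dots> \<ge> 0"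
      using add.IH by (intro add_nonneg_nonneg mult_nonneg_nonneg) auto
    finally show ?case by simp
  qed
  have "c\<^sup>2 * (poly (g R) x * poly (pderiv (pderiv (g R))) x) \<le> c\<^sup>2 * (poly (pderiv (g R)) x)\<^sup>2"
    by (intro mult_left_mono g) auto
  then show ?thesis
    unfolding p g_def[symmetric] by (simp add: pderiv_smult power2_eq_square mult_ac)
qed

lemma map_poly_of_real_mult:
  "map_poly complex_of_real (p * q) = map_poly of_real p * map_poly of_real q"
  by (simp add: poly_eq_iff coeff_map_poly coeff_mult)

lemma map_poly_of_real_smult:
  "map_poly complex_of_real (smult c p) = smult (of_real c) (map_poly of_real p)"
  by (simp add: poly_eq_iff coeff_map_poly)

lemma map_poly_of_real_pderiv:
  "map_poly complex_of_real (pderiv p) = pderiv (map_poly of_real p)"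
  by (simp add: poly_eq_iff coeff_map_poly coeff_pderiv)

lemma complex_roots_real_imp_real_rooted:
  fixes p :: "real poly"
  assumes "\<And>z. poly (map_poly complex_of_real p) z = 0 \<Longrightarrow> z \<in> \<real>"
  shows "real_rooted p"
proof (cases "p = 0")
  case True
  then show ?thesis using real_rooted_const[of 0] by simp
next
  case False
  define q where "q = map_poly complex_of_real p"
  have q0: "q \<noteq> 0" using False by (simp add: q_def map_poly_eq_0_iff)
  have real: "z \<in> \<real>" if "z \<in># proots q" for z
    using that assms q0 by (simp add: q_def)
  have "q = smult (lead_coeff q) (\<Prod>z\<in>#proots q. [:-z, 1:])"
    by (rule complex_poly_decompose_multiset[symmetric])
  also have "(\<Prod>z\<in>#proots q. [:-z, 1:])
      = (\<Prod>r\<in>#image_mset Re (proots q). [:- complex_of_real r, 1:])"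
  proof -
    have "image_mset (\<lambda>z. [:-z, 1:]) (proots q) =
        image_mset (\<lambda>z. [:- complex_of_real (Re z), 1:]) (proots q)"
      by (intro image_mset_cong) (use real in \<open>auto simp: Reals_def\<close>)
    then show ?thesis by (simp add: image_mset.compositionality o_def)
  qed
  also have "\<dots> = map_poly of_real (\<Prod>r\<in>#image_mset Re (proots q). [:- r, 1:])"
  proof -
    have "(\<Prod>r\<in>#R. [:- complex_of_real r, 1:]) = map_poly of_real (\<Prod>r\<in>#R. [:- r, 1:])" for R
    proof (induction R)
      case (add r R)
      then show ?case
        by (simp add: map_poly_of_real_mult map_poly_pCons del: mult_pCons_left)
    qed simp
    then show ?thesis .
  qed
  also have "smult (lead_coeff q) \<dots>
      = map_poly of_real (smult (lead_coeff p) (\<Prod>r\<in>#image_mset Re (proots q). [:- r, 1:]))"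
    by (simp add: q_def degree_map_poly coeff_map_poly map_poly_of_real_smult)
  finally have eq: "map_poly complex_of_real p
      = map_poly of_real (smult (lead_coeff p) (\<Prod>r\<in>#image_mset Re (proots q). [:- r, 1:]))"
    (is "_ = map_poly _ ?P") unfolding q_def .
  have "p = ?P"
  proof (rule poly_eqI)
    fix n
    have "complex_of_real (coeff p n) = of_real (coeff ?P n)"
      using arg_cong[OF eq, of "\<lambda>p. coeff p n"] by (simp only: coeff_map_poly of_real_0)
    then show "coeff p n = coeff ?P n" by (simp only: of_real_eq_iff)
  qed
  then show ?thesis unfolding real_rooted_def by blast
qed

text \<open>The argument of Gauss and Lucas: at a non-real \<open>z\<close> all the terms of \<open>p'(z) / p(z) = \<Sum> 1 / (z - r)\<close> have imaginary parts of
the same sign, so \<open>p'\<close> has no non-real root.\<close>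

lemma real_rooted_pderiv:
  assumes "real_rooted p" shows "real_rooted (pderiv p)"
proof -
  obtain c R where p: "p = smult c (\<Prod>r\<in>#R. [:- r, 1:])"
    using assms by (auto simp: real_rooted_def)
  define g where "g R = (\<Prod>r\<in>#R. [:- complex_of_real r, 1:])" for R
  have map: "map_poly of_real (\<Prod>r\<in>#R. [:- r, 1:]) = g R" for R
  proof (induction R)
    case (add r R)
    then show ?case
      by (simp add: g_def map_poly_of_real_mult map_poly_pCons del: mult_pCons_left)
  qed (simp add: g_def)
  show ?thesis
  proof (cases "c = 0 \<or> R = {#}")
    case True
    then have "pderiv p = [:0:]" by (auto simp: p pderiv_smult)
    then show ?thesis using real_rooted_const[of 0] by simp
  next
    case False
    show ?thesis
    proof (rule complex_roots_real_imp_real_rooted)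
      fix z
      assume "poly (map_poly complex_of_real (pderiv p)) z = 0"
      also have "map_poly complex_of_real (pderiv p) = smult (of_real c) (pderiv (g R))"
        unfolding p map[symmetric] by (simp add: map_poly_of_real_pderiv map_poly_of_real_smult pderiv_smult)
      finally have z: "poly (pderiv (g R)) z = 0" using False by simp
      show "z \<in> \<real>"
      proof (rule ccontr)
        assume "z \<notin> \<real>"
        then have im: "Im z \<noteq> 0" by (simp add: complex_is_Real_iff)
        have ne: "poly (g R) z \<noteq> 0" for R
          using im by (induction R) (auto simp: g_def)
        have "Im z * Im (poly (pderiv (g S)) z / poly (g S) z) \<le> 0 \<and>
          (S \<noteq> {#} \<longrightarrow> Im z * Im (poly (pderiv (g S)) z / poly (g S) z) < 0)" for S
        proof (induction S)
          case empty
          then show ?case by (simp add: g_def)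
        next
          case (add r S)
          have eq: "g (add_mset r S) = [:- of_real r, 1:] * g S" by (simp add: g_def)
          have zr: "z - of_real r \<noteq> 0" using im by auto
          have "poly (pderiv (g (add_mset r S))) z
              = poly (g S) z + (z - of_real r) * poly (pderiv (g S)) z"
            unfolding eq pderiv_mult by (simp add: pderiv_pCons algebra_simps)
          moreover have "poly (g (add_mset r S)) z = (z - of_real r) * poly (g S) z"
            unfolding eq by (simp add: algebra_simps)
          ultimately have "poly (pderiv (g (add_mset r S))) z / poly (g (add_mset r S)) z
              = 1 / (z - of_real r) + poly (pderiv (g S)) z / poly (g S) z"
            using zr ne[of S] by (simp add: add_divide_distrib)
          moreover have "Im z * Im (1 / (z - of_real r)) < 0"
          proof -
            have "(Re z - r)\<^sup>2 + (Im z)\<^sup>2 > 0" using im by (simp add: sum_power2_gt_zero_iff)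
            moreover have "Im z * Im (1 / (z - of_real r)) = - (Im z)\<^sup>2 / ((Re z - r)\<^sup>2 + (Im z)\<^sup>2)"
              by (simp add: Im_divide power2_eq_square)
            ultimately show ?thesis using im by (simp add: divide_neg_pos)
          qed
          ultimately show ?case using add.IH by (auto simp: distrib_left)
        qed
        from this[of R] False z show False by simp
      qed
    qed
  qed
qed

lemma real_rooted_higher_pderiv: "real_rooted p \<Longrightarrow> real_rooted ((pderiv ^^ j) p)"
  by (induction j) (auto intro: real_rooted_pderiv)

text \<open>Laguerre's inequality at \<open>0\<close> for the \<open>j\<close>-th derivative.\<close>

lemma real_rooted_newton:
  assumes "real_rooted p"
  shows "coeff p j * coeff p (j + 2) \<le> (coeff p (j + 1))\<^sup>2"
proof (cases "coeff p j * coeff p (j + 2) \<le> 0")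
  case True
  then show ?thesis by (meson order_trans zero_le_power2)
next
  case False
  have c: "poly ((pderiv ^^ m) p) 0 = fact m * coeff p m" for m
    by (simp add: poly_0_coeff_0 coeff_higher_pderiv pochhammer_fact)
  have "poly ((pderiv ^^ j) p) 0 * poly ((pderiv ^^ (j + 2)) p) 0 \<le> (poly ((pderiv ^^ (j + 1)) p) 0)\<^sup>2"
    using real_rooted_laguerre[OF real_rooted_higher_pderiv[OF assms, of j], of 0] by simp
  then have "(fact j * fact (j + 2)) * (coeff p j * coeff p (j + 2)) \<le> (fact (j + 1))\<^sup>2 * (coeff p (j + 1))\<^sup>2"
    unfolding c by (simp add: power_mult_distrib mult_ac)
  moreover have "(fact (j + 1) :: real)\<^sup>2 * (coeff p j * coeff p (j + 2))
      \<le> (fact j * fact (j + 2)) * (coeff p j * coeff p (j + 2))"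
    using False by (intro mult_right_mono) (auto simp: power2_eq_square algebra_simps)
  ultimately have "(fact (j + 1) :: real)\<^sup>2 * (coeff p j * coeff p (j + 2)) \<le> (fact (j + 1))\<^sup>2 * (coeff p (j + 1))\<^sup>2"
    by linarith
  then show ?thesis by (subst (asm) mult_le_cancel_left_pos) auto
qed

section \<open>Elementary symmetric polynomials on the cone\<close>

text \<open>Elementary symmetric polynomials in the variables indexed by a set, so that a variable can be deleted: \<open>esym (UNIV - {i}) j l\<close>
is the derivative of \<open>\<sigma>\<^bsub>j+1\<^esub>\<close> in the \<open>i\<close>-th variable.\<close>

definition esym :: "'a set \<Rightarrow> nat \<Rightarrow> ('a \<Rightarrow> real) \<Rightarrow> real" where
  "esym I j l = (\<Sum>J | J \<subseteq> I \<and> card J = j. \<Prod>i\<in>J. l i)"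

lemma sigma_k_eq_esym: "sigma_k k l = esym UNIV k (\<lambda>i. l $ i)"
  by (simp add: sigma_k_def esym_def)

lemma esym_0: "finite I \<Longrightarrow> esym I 0 l = 1"
proof -
  assume "finite I"
  then have "J \<subseteq> I \<and> card J = 0 \<longleftrightarrow> J = {}" for J
    using finite_subset[of J I] by (cases "J = {}") auto
  then show ?thesis by (simp add: esym_def)
qed

lemma esym_empty_Suc: "esym {} (Suc j) l = 0"
proof -
  have none: "{J. J \<subseteq> {} \<and> card J = Suc j} = {}" by auto
  show ?thesis unfolding esym_def none by simp
qed

lemma esym_Suc_insert:
  assumes "finite I" "i \<notin> I"
  shows "esym (insert i I) (Suc j) l = esym I (Suc j) l + l i * esym I j l"
proof -
  have eq: "{J. J \<subseteq> insert i I \<and> card J = Suc j}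
      = {J. J \<subseteq> I \<and> card J = Suc j} \<union> insert i ` {J. J \<subseteq> I \<and> card J = j}" (is "?L = ?A \<union> ?B")
  proof (intro equalityI subsetI)
    fix J assume J: "J \<in> ?L"
    show "J \<in> ?A \<union> ?B"
    proof (cases "i \<in> J")
      case True
      then have "J = insert i (J - {i})" "J - {i} \<subseteq> I" "card (J - {i}) = j"
        using J assms finite_subset[of J "insert i I"] by (auto simp: card_Diff_singleton)
      then show ?thesis by blast
    next
      case False
      then show ?thesis using J by auto
    qed
  next
    fix J assume "J \<in> ?A \<union> ?B"
    then consider "J \<in> ?A" | x where "J = insert i x" "x \<subseteq> I" "card x = j" by auto
    then show "J \<in> ?L"
    proof cases
      case (2 x)
      then have "finite x" "i \<notin> x" using assms finite_subset by auto
      then show ?thesis using 2 by auto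
    qed auto
  qed
  have fin: "finite {J. J \<subseteq> I \<and> card J = m}" for m
    using assms by (auto intro: finite_subset[of _ "Pow I"])
  have inj: "inj_on (insert i) {J. J \<subseteq> I \<and> card J = j}"
  proof (rule inj_onI)
    fix A B assume AB: "A \<in> {J. J \<subseteq> I \<and> card J = j}" "B \<in> {J. J \<subseteq> I \<and> card J = j}" "insert i A = insert i B"
    then have "i \<notin> A" "i \<notin> B" using assms by auto
    then show "A = B" using AB(3) by (simp add: insert_ident)
  qed
  have "esym (insert i I) (Suc j) l = esym I (Suc j) l + (\<Sum>J\<in>?B. \<Prod>i\<in>J. l i)"
    unfolding esym_def eq using assms fin by (intro sum.union_disjoint) auto
  also have "(\<Sum>J\<in>?B. \<Prod>i\<in>J. l i) = (\<Sum>J | J \<subseteq> I \<and> card J = j. \<Prod>i\<in>insert i J. l i)"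
    using inj by (simp add: sum.reindex)
  also have "\<dots> = (\<Sum>J | J \<subseteq> I \<and> card J = j. l i * (\<Prod>i\<in>J. l i))"
    using assms by (intro sum.cong refl prod.insert) (auto intro: finite_subset[OF _ assms(1)])
  finally show ?thesis by (simp add: esym_def sum_distrib_left)
qed

lemma esym_Suc_remove:
  assumes "finite I" "i \<in> I"
  shows "esym I (Suc j) l = esym (I - {i}) (Suc j) l + l i * esym (I - {i}) j l"
  using esym_Suc_insert[of "I - {i}" i j l] assms by (simp add: insert_absorb)

lemma coeff_prod_linear_eq_esym:
  assumes "finite I"
  shows "coeff (\<Prod>i\<in>I. [:1, l i:]) j = esym I j l"
  using assms
proof (induction I arbitrary: j rule: finite_induct)
  case empty
  show ?case by (cases j) (simp_all add: esym_0 esym_empty_Suc)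
next
  case (insert i I)
  show ?case
  proof (cases j)
    case 0
    then show ?thesis using insert by (simp add: esym_0 coeff_mult_0)
  next
    case (Suc m)
    then show ?thesis
      using insert.hyps by (simp add: esym_Suc_insert insert.IH)
  qed
qed

lemma esym_newton:
  assumes "finite I"
  shows "esym I j l * esym I (j + 2) l \<le> (esym I (j + 1) l)\<^sup>2"
  using real_rooted_newton[OF real_rooted_prod_linear[of l I], of j]
  by (simp add: coeff_prod_linear_eq_esym[OF assms])

text \<open>Deleting a component maps \<open>\<Gamma>\<^sub>k\<close> to \<open>\<Gamma>\<^bsub>k-1\<^esub>\<close>. If the first failure occurred at index \<open>j + 1\<close>, positivity of
\<open>\<sigma>\<^bsub>j+1\<^esub>\<close> and \<open>\<sigma>\<^bsub>j+2\<^esub>\<close> of the full vector would make the reduced vector violate Newton's inequality.\<close>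

lemma esym_remove_pos:
  assumes "finite I" "i \<in> I" and pos: "\<And>j. j \<in> {1..k} \<Longrightarrow> esym I j l > 0"
  shows "j < k \<Longrightarrow> esym (I - {i}) j l > 0"
proof (induction j)
  case 0
  then show ?case using assms by (simp add: esym_0)
next
  case (Suc j)
  let ?e = "\<lambda>j. esym (I - {i}) j l"
  have e0: "?e j > 0" using Suc by simp
  have 1: "?e (Suc j) + l i * ?e j > 0"
    using pos[of "Suc j"] Suc.prems esym_Suc_remove[OF assms(1,2), of j l] by simp
  have 2: "?e (Suc (Suc j)) + l i * ?e (Suc j) > 0"
    using pos[of "Suc (Suc j)"] Suc.prems esym_Suc_remove[OF assms(1,2), of "Suc j" l] by simp
  show ?case
  proof (rule ccontr)
    assume "\<not> ?e (Suc j) > 0"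
    then have le: "?e (Suc j) \<le> 0" by simp
    have "(?e (Suc j))\<^sup>2 \<le> (l i * ?e j) * (- ?e (Suc j))"
    proof -
      have "(- ?e (Suc j)) * (- ?e (Suc j)) \<le> (l i * ?e j) * (- ?e (Suc j))"
        using le 1 by (intro mult_right_mono) auto
      then show ?thesis by (simp add: power2_eq_square)
    qed
    also have "\<dots> = ?e j * (- (l i * ?e (Suc j)))" by simp
    also have "\<dots> < ?e j * ?e (Suc (Suc j))"
      using e0 2 by (intro mult_strict_left_mono) auto
    also have "\<dots> \<le> (?e (Suc j))\<^sup>2"
      using esym_newton[of "I - {i}" j l] assms by simp
    finally show False by simp
  qed
qed

lemma esym_1: "finite I \<Longrightarrow> esym I (Suc 0) l = (\<Sum>i\<in>I. l i)"
proof (induction I rule: finite_induct)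
  case empty
  show ?case by (simp add: esym_empty_Suc)
next
  case (insert x F)
  then show ?case by (simp add: esym_Suc_insert esym_0)
qed

text \<open>A vector of the cone with a very negative component has a large \<open>\<sigma>\<^bsub>k-1\<^esub>\<close>: its sum is positive, so its greatest component is at
least \<open>a / N\<close>; splitting this component off leaves a vector of \<open>\<Gamma>\<^bsub>k-1\<^esub>\<close> that still contains the negative one.\<close>

lemma esym_lower_bound:
  assumes "finite I" "card I \<le> N" "N > 0" "q \<in> I" "a \<ge> 0" "l q \<le> - a" "k \<ge> 1"
    and pos: "\<And>j. j \<in> {1..k} \<Longrightarrow> esym I j l > 0"
  shows "(a / N) ^ (k - 1) \<le> esym I (k - 1) l"
  using assms
proof (induction k arbitrary: I)
  case 0
  then show ?case by simp
next
  case (Suc k)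
  show ?case
  proof (cases "k = 0")
    case True
    then show ?thesis using Suc.prems by (simp add: esym_0)
  next
    case False
    have sum: "(\<Sum>i\<in>I. l i) > 0"
      using Suc.prems(8)[of 1] Suc.prems(1) False by (simp add: esym_1)
    have "\<exists>m\<in>I - {q}. l m \<ge> a / N"
    proof (rule ccontr)
      assume "\<not> ?thesis"
      then have less: "l m \<le> a / N" if "m \<in> I - {q}" for m using that by force
      have "(\<Sum>i\<in>I. l i) = l q + (\<Sum>i\<in>I - {q}. l i)"
        using Suc.prems by (simp add: sum.remove)
      also have "\<dots> \<le> - a + (\<Sum>i\<in>I - {q}. a / N)"
        using Suc.prems less by (intro add_mono sum_mono) auto
      also have "\<dots> = - a + (card I - 1) * (a / N)"
        using Suc.prems by simp
      also have "\<dots> \<le> - a + real N * (a / N)"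
        using Suc.prems by (intro add_left_mono mult_right_mono) auto
      also have "\<dots> = 0" using Suc.prems by simp
      finally show False using sum by simp
    qed
    then obtain m where m: "m \<in> I" "m \<noteq> q" "l m \<ge> a / N" by auto
    obtain k' where k': "k = Suc k'" using False by (cases k) auto
    have rem: "\<And>j. j < Suc k \<Longrightarrow> esym (I - {m}) j l > 0"
      by (rule esym_remove_pos[OF Suc.prems(1) m(1) Suc.prems(8)])
    have IH: "(a / N) ^ (k - 1) \<le> esym (I - {m}) (k - 1) l"
      using Suc.prems m rem False card_Diff1_le[of I m]
      by (intro Suc.IH) auto
    have lm0: "0 \<le> l m"
      using m(3) Suc.prems(5) by (meson divide_nonneg_nonneg of_nat_0_le_iff order_trans)
    have "(a / N) ^ k = a / N * (a / N) ^ (k - 1)" by (simp add: k')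
    also have "\<dots> \<le> l m * esym (I - {m}) (k - 1) l"
      using m(3) IH lm0 Suc.prems(5) by (intro mult_mono) auto
    also have "\<dots> \<le> esym I k l"
      using esym_Suc_remove[OF Suc.prems(1) m(1), of "k - 1" l] rem[of k] by (simp add: k')
    finally show ?thesis by simp
  qed
qed

lemma sum_esym_remove:
  fixes l :: "'n::finite \<Rightarrow> real"
  shows "(\<Sum>i\<in>UNIV. esym (UNIV - {i}) j l) = (real CARD('n) - real j) * esym UNIV j l"
proof -
  have "(\<Sum>i\<in>UNIV. esym (UNIV - {i}) j l)
      = (\<Sum>i\<in>UNIV. \<Sum>J | card J = j. if i \<notin> J then \<Prod>i\<in>J. l i else 0)"
    unfolding esym_def
    by (intro sum.cong refl sum.mono_neutral_cong_left) (auto intro!: finite_subset[of _ "UNIV"])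
  also have "\<dots> = (\<Sum>J | card J = j. \<Sum>i\<in>UNIV. if i \<notin> J then \<Prod>i\<in>J. l i else 0)"
    by (rule sum.swap)
  also have "\<dots> = (\<Sum>J | card J = j. (real CARD('n) - real j) * (\<Prod>i\<in>J. l i))"
  proof (intro sum.cong refl)
    fix J :: "'n set" assume J: "J \<in> {J. card J = j}"
    have "(\<Sum>i\<in>UNIV. if i \<notin> J then \<Prod>i\<in>J. l i else 0) = (\<Sum>i\<in>- J. \<Prod>i\<in>J. l i)"
      by (simp add: sum.If_cases Compl_eq)
    also have "\<dots> = (real CARD('n) - real j) * (\<Prod>i\<in>J. l i)"
      using J card_mono[of UNIV J] by (simp add: Compl_eq_Diff_UNIV card_Diff_subset of_nat_diff)
    finally show "(\<Sum>i\<in>UNIV. if i \<notin> J then \<Prod>i\<in>J. l i else 0) = \<dots>" .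
  qed
  finally show ?thesis by (simp add: esym_def sum_distrib_left)
qed

text \<open>Euler's identity for the homogeneous polynomial \<open>\<sigma>\<^bsub>j+1\<^esub>\<close>.\<close>

lemma sum_times_esym_remove:
  fixes l :: "'n::finite \<Rightarrow> real"
  shows "(\<Sum>i\<in>UNIV. l i * esym (UNIV - {i}) j l) = real (Suc j) * esym UNIV (Suc j) l"
proof -
  have "(\<Sum>i\<in>UNIV. l i * esym (UNIV - {i}) j l)
      = (\<Sum>i\<in>UNIV. esym UNIV (Suc j) l - esym (UNIV - {i}) (Suc j) l)"
    proof (intro sum.cong refl)
    fix i :: 'n
    show "l i * esym (UNIV - {i}) j l = esym UNIV (Suc j) l - esym (UNIV - {i}) (Suc j) l"
      using esym_Suc_remove[of UNIV i j l] by simp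
  qed
  also have "\<dots> = real (Suc j) * esym UNIV (Suc j) l"
    by (simp only: sum_subtractf sum_esym_remove) (simp add: algebra_simps)
  finally show ?thesis .
qed

text \<open>The weights are the squared coordinates of a unit vector in an eigenbasis, and the last hypothesis says that the quadratic form of
the matrix is nonpositive on this vector. Then the second-order coefficient of the linearised operator in this direction controls
\<open>\<sigma>\<^sub>k\<close>, hence the trace of the coefficients. The reason is
\<open>\<sigma>\<^sub>k(\<lambda>) = \<sigma>\<^sub>k(\<lambda> without i) + \<lambda>\<^sub>i \<sigma>\<^bsub>k-1\<^esub>(\<lambda> without i)\<close> together with
\<open>\<lambda>\<^sub>i \<sigma>\<^bsub>k-1\<^esub>(\<lambda> without i) \<le> \<lambda>\<^sub>i \<sigma>\<^bsub>k-1\<^esub>(\<lambda>)\<close> for either sign of \<open>\<lambda>\<^sub>i\<close>.\<close>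

lemma weighted_esym_remove_ge:
  fixes l w :: "'n::finite \<Rightarrow> real"
  assumes nn: "\<And>i j. j \<le> k \<Longrightarrow> esym (UNIV - {i}) j l \<ge> 0"
    and nn': "\<And>j. j \<le> k \<Longrightarrow> esym UNIV j l \<ge> 0"
    and w: "\<And>i. w i \<ge> 0" "sum w UNIV = 1" and neg: "(\<Sum>i\<in>UNIV. w i * l i) \<le> 0"
  shows "esym UNIV k l \<le> (\<Sum>i\<in>UNIV. w i * esym (UNIV - {i}) k l)"
proof (cases k)
  case 0
  then show ?thesis using w by (simp add: esym_0)
next
  case (Suc m)
  have le: "l i * esym (UNIV - {i}) m l \<le> l i * esym UNIV m l" for i
  proof (cases m)
    case 0
    then show ?thesis by (simp add: esym_0)
  next
    case (Suc q)
    have "l i * esym UNIV m l = l i * esym (UNIV - {i}) m l + (l i)\<^sup>2 * esym (UNIV - {i}) q l"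
      by (simp add: Suc esym_Suc_remove[of UNIV i] algebra_simps power2_eq_square)
    moreover have "esym (UNIV - {i}) q l \<ge> 0"
      by (rule nn) (simp add: Suc \<open>k = Suc m\<close>)
    ultimately show ?thesis by simp
  qed
  have "esym UNIV k l = (\<Sum>i\<in>UNIV. w i * esym UNIV k l)"
    using w by (simp flip: sum_distrib_right)
  also have "\<dots> = (\<Sum>i\<in>UNIV. w i * esym (UNIV - {i}) k l) + (\<Sum>i\<in>UNIV. w i * (l i * esym (UNIV - {i}) m l))"
    unfolding sum.distrib[symmetric]
  proof (intro sum.cong refl)
    fix i :: 'n
    show "w i * esym UNIV k l = w i * esym (UNIV - {i}) k l + w i * (l i * esym (UNIV - {i}) m l)"
      using esym_Suc_remove[of UNIV i m l] by (simp add: Suc distrib_left)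
  qed
  also have "(\<Sum>i\<in>UNIV. w i * (l i * esym (UNIV - {i}) m l)) \<le> (\<Sum>i\<in>UNIV. w i * (l i * esym UNIV m l))"
    by (intro sum_mono mult_left_mono le w)
  also have "\<dots> = (\<Sum>i\<in>UNIV. w i * l i) * esym UNIV m l"
    by (simp only: sum_distrib_right mult.assoc)
  also have "\<dots> \<le> 0"
    using neg nn'[of m] Suc by (intro mult_nonpos_nonneg) auto
  finally show ?thesis by simp
qed

lemma continuous_esym: "continuous_on S (\<lambda>l :: real ^ 'n. esym I j (\<lambda>i. l $ i))"
  unfolding esym_def by (intro continuous_intros)

lemma Gam_esym_pos: "g \<in> Gam k \<Longrightarrow> j \<le> k \<Longrightarrow> esym UNIV j (\<lambda>i. g $ i) > 0"
  by (cases "j = 0") (auto simp: Gam_def sigma_k_eq_esym esym_0)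

text \<open>The boundary of the cone contains the points where \<open>\<psi> = 0\<close>; inequalities between continuous functions extend to it from the
open cone.\<close>

lemma closure_Gam_le:
  fixes f h :: "real ^ 'n \<Rightarrow> real"
  assumes "l \<in> closure (Gam k)" "continuous_on UNIV f" "continuous_on UNIV h"
    and "\<And>g. g \<in> Gam k \<Longrightarrow> f g \<le> h g"
  shows "f l \<le> h l"
proof -
  have "closure (Gam k) \<subseteq> {g. f g \<le> h g}"
    using assms by (intro closure_minimal closed_Collect_le) auto
  then show ?thesis using assms(1) by blast
qed

lemma closure_Gam_esym_nonneg:
  assumes "l \<in> closure (Gam k)" "j \<le> k"
  shows "esym UNIV j (\<lambda>i. l $ i) \<ge> 0"
  by (rule closure_Gam_le[OF assms(1)]) (use assms in \<open>auto intro: continuous_esym less_imp_le Gam_esym_pos\<close>)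

lemma closure_Gam_esym_remove_nonneg:
  assumes "l \<in> closure (Gam k)" "j < k"
  shows "esym (UNIV - {i}) j (\<lambda>i. l $ i) \<ge> 0"
proof (rule closure_Gam_le[OF assms(1)])
  fix g :: "real ^ 'a" assume "g \<in> Gam k"
  then show "0 \<le> esym (UNIV - {i}) j (\<lambda>i. g $ i)"
    using assms(2) Gam_esym_pos[of g k]
    by (intro less_imp_le esym_remove_pos[of UNIV i k]) simp_all
qed (auto intro: continuous_esym)

lemma closure_Gam_esym_lower_bound:
  fixes l :: "real ^ 'n"
  assumes "l \<in> closure (Gam k)" "k \<ge> 1" "a \<ge> 0" "l $ i \<le> - a"
  shows "(a / CARD('n)) ^ (k - 1) \<le> esym UNIV (k - 1) (\<lambda>i. l $ i)"
proof -
  have "(max 0 (- (l $ i)) / CARD('n)) ^ (k - 1) \<le> esym UNIV (k - 1) (\<lambda>i. l $ i)"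
  proof (rule closure_Gam_le[OF assms(1)])
    fix g :: "real ^ 'n" assume g: "g \<in> Gam k"
    show "(max 0 (- (g $ i)) / CARD('n)) ^ (k - 1) \<le> esym UNIV (k - 1) (\<lambda>i. g $ i)"
    proof (cases "g $ i \<le> 0")
      case True
      then show ?thesis
        using assms(2) g by (intro esym_lower_bound[where q = i] Gam_esym_pos) auto
    next
      case False
      have "esym UNIV (k - 1) (\<lambda>i. g $ i) > 0"
        using g by (rule Gam_esym_pos) simp
      then show ?thesis
        using False by (cases "k = 1") (simp_all add: esym_0 power_0_left)
    qed
  qed (intro continuous_intros continuous_esym; simp)+
  moreover have "(a / CARD('n)) ^ (k - 1) \<le> (max 0 (- (l $ i)) / CARD('n)) ^ (k - 1)"
    using assms by (intro power_mono divide_right_mono) auto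
  ultimately show ?thesis by simp
qed

section \<open>Symmetric matrices and the derivative of the Hessian operator\<close>

lemma symmetric_matrix_inner:
  fixes A :: "real ^ 'n ^ 'n"
  assumes "transpose A = A"
  shows "(A *v x) \<bullet> y = x \<bullet> (A *v y)"
  by (metis assms dot_lmul_matrix vector_transpose_matrix inner_commute)

text \<open>A maximum point of the quadratic form on the unit sphere of an invariant subspace is an eigenvector.\<close>

lemma symmetric_matrix_eigenvector_exists:
  fixes A :: "real ^ 'n ^ 'n"
  assumes sym: "transpose A = A" and S: "subspace S" "S \<noteq> {0}"
    and inv: "\<And>x. x \<in> S \<Longrightarrow> A *v x \<in> S"
  obtains v c where "v \<in> S" "norm v = 1" "A *v v = c *\<^sub>R v"
proof -
  let ?K = "S \<inter> sphere 0 1"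
  have "compact ?K"
    using closed_subspace[OF S(1)] by (intro closed_Int_compact) auto
  moreover have "?K \<noteq> {}"
  proof -
    obtain x where x: "x \<in> S" "x \<noteq> 0" using S subspace_0 by blast
    then have "(1 / norm x) *\<^sub>R x \<in> ?K" using S by (simp add: subspace_scale)
    then show ?thesis by blast
  qed
  moreover have "continuous_on ?K (\<lambda>x. x \<bullet> (A *v x))"
    by (intro continuous_intros matrix_vector_mult_linear_continuous_on)
  ultimately have "\<exists>v\<in>?K. \<forall>x\<in>?K. x \<bullet> (A *v x) \<le> v \<bullet> (A *v v)"
    by (rule continuous_attains_sup)
  then obtain v where v: "v \<in> ?K" and max: "\<And>x. x \<in> ?K \<Longrightarrow> x \<bullet> (A *v x) \<le> v \<bullet> (A *v v)"
    by blast
  define c where "c = v \<bullet> (A *v v)"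
  have vS: "v \<in> S" and vn: "v \<bullet> v = 1" using v by (auto simp: norm_eq_1)
  have le: "x \<bullet> (A *v x) \<le> c * (x \<bullet> x)" if x: "x \<in> S" for x
  proof (cases "x = 0")
    case False
    have "(1 / norm x) *\<^sub>R x \<in> ?K" using S x False by (simp add: subspace_scale)
    from max[OF this] have "(x \<bullet> (A *v x)) / (norm x * norm x) \<le> c"
      by (simp add: matrix_vector_mult_scaleR c_def)
    moreover have "norm x * norm x > 0" using False by simp
    ultimately have "x \<bullet> (A *v x) \<le> c * (norm x * norm x)" by (simp only: pos_divide_le_eq)
    then show ?thesis by (simp add: dot_square_norm power2_eq_square)
  qed simp
  define w where "w = A *v v - c *\<^sub>R v"
  have wS: "w \<in> S" unfolding w_def using S vS inv by (intro subspace_diff subspace_scale) auto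
  have "w \<bullet> w = 0"
  proof (rule ccontr)
    assume "w \<bullet> w \<noteq> 0"
    then have pos: "w \<bullet> w > 0" using inner_ge_zero[of w] by linarith
    define d where "d = c * (w \<bullet> w) - w \<bullet> (A *v w)"
    have d: "d \<ge> 0" using le[OF wS] by (simp add: d_def)
    have q: "0 \<le> t * (t * d - 2 * (w \<bullet> w))" for t
    proof -
      have "v + t *\<^sub>R w \<in> S" using S vS wS by (intro subspace_add subspace_scale)
      from le[OF this] have "0 \<le> c * ((v + t *\<^sub>R w) \<bullet> (v + t *\<^sub>R w)) - (v + t *\<^sub>R w) \<bullet> (A *v (v + t *\<^sub>R w))"
        by simp
      also have "(v + t *\<^sub>R w) \<bullet> (v + t *\<^sub>R w) = 1 + 2 * t * (v \<bullet> w) + t * t * (w \<bullet> w)"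
        using vn by (simp add: inner_add_left inner_add_right inner_commute[of w v] distrib_left)
      also have "(v + t *\<^sub>R w) \<bullet> (A *v (v + t *\<^sub>R w)) = c + 2 * t * (w \<bullet> (A *v v)) + t * t * (w \<bullet> (A *v w))"
      proof -
        have "v \<bullet> (A *v w) = w \<bullet> (A *v v)"
          using symmetric_matrix_inner[OF sym, of v w] by (simp only: inner_commute[of w])
        then show ?thesis
          by (simp add: matrix_vector_right_distrib matrix_vector_mult_scaleR inner_add_left inner_add_right
              c_def distrib_left)
      qed
      also have "w \<bullet> (A *v v) = w \<bullet> w + c * (v \<bullet> w)"
      proof -
        have "A *v v = w + c *\<^sub>R v" by (simp add: w_def)
        then have "w \<bullet> (A *v v) = w \<bullet> (w + c *\<^sub>R v)" by simp
        then show ?thesis by (simp add: inner_add_right inner_commute[of w v])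
      qed
      finally show ?thesis by (simp add: d_def algebra_simps)
    qed
    have "(w \<bullet> w) / (d + 1) * d \<le> w \<bullet> w"
      using d pos by (simp add: divide_simps distrib_left)
    then have "(w \<bullet> w) / (d + 1) * d - 2 * (w \<bullet> w) < 0" using pos by linarith
    moreover have "(w \<bullet> w) / (d + 1) > 0" using d pos by simp
    ultimately have "(w \<bullet> w) / (d + 1) * ((w \<bullet> w) / (d + 1) * d - 2 * (w \<bullet> w)) < 0"
      by (rule mult_pos_neg[rotated])
    then show False using q[of "(w \<bullet> w) / (d + 1)"] by linarith
  qed
  then have "A *v v = c *\<^sub>R v" by (simp add: w_def)
  then show ?thesis using that vS v by auto
qed

text \<open>An orthonormal set of eigenvectors of maximal size spans the space, since the orthogonal complement of its span is invariant.\<close>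

lemma symmetric_matrix_eigenbasis:
  fixes A :: "real ^ 'n ^ 'n"
  assumes sym: "transpose A = A"
  obtains v :: "'n \<Rightarrow> real ^ 'n" and l where
    "\<And>i j. v i \<bullet> v j = (if i = j then 1 else 0)" "\<And>i. A *v v i = l i *\<^sub>R v i"
proof -
  define P where "P B \<longleftrightarrow> finite B \<and> pairwise orthogonal B \<and> (\<forall>b\<in>B. norm b = 1 \<and> (\<exists>c. A *v b = c *\<^sub>R b))"
    for B :: "(real ^ 'n) set"
  have indep: "independent B" if "P B" for B
    using that by (intro pairwise_orthogonal_independent) (auto simp: P_def)
  have card: "card B \<le> CARD('n)" if "P B" for B
    using independent_bound[OF indep[OF that]] by simp
  have "P {}" by (simp add: P_def)
  then obtain B where B: "P B" and max: "\<And>B'. P B' \<Longrightarrow> card B' \<le> card B"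
    using ex_has_greatest_nat[of P "{}" card "Suc CARD('n)"] card by (auto simp: less_Suc_eq_le)
  have "card B = CARD('n)"
  proof (rule ccontr)
    assume "card B \<noteq> CARD('n)"
    then have "dim B < DIM(real ^ 'n)"
      using card[OF B] dim_eq_card_independent[OF indep[OF B]] by simp
    then obtain x where x: "x \<noteq> 0" "\<And>y. y \<in> span B \<Longrightarrow> orthogonal x y"
      using orthogonal_to_subspace_exists by blast
    define S where "S = {x. \<forall>b\<in>B. b \<bullet> x = 0}"
    have "subspace S" by (auto simp: S_def subspace_def inner_add_right)
    moreover have "x \<in> S"
      using x(2) span_base by (fastforce simp: S_def orthogonal_def inner_commute)
    moreover have "A *v y \<in> S" if y: "y \<in> S" for y
    proof -
      have "b \<bullet> (A *v y) = 0" if b: "b \<in> B" for b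
      proof -
        obtain c where "A *v b = c *\<^sub>R b" using B b by (auto simp: P_def)
        then show ?thesis
          using y b symmetric_matrix_inner[OF sym, of b y] by (simp add: S_def)
      qed
      then show ?thesis by (simp add: S_def)
    qed
    ultimately obtain w c where w: "w \<in> S" "norm w = 1" "A *v w = c *\<^sub>R w"
      using symmetric_matrix_eigenvector_exists[OF sym, of S] x(1) by blast
    have "w \<notin> B"
    proof
      assume "w \<in> B"
      then have "w \<bullet> w = 0" using w(1) by (simp add: S_def)
      then show False using w(2) by simp
    qed
    moreover have "P (insert w B)"
      using B w by (auto simp: P_def S_def pairwise_insert orthogonal_def inner_commute)
    ultimately show False using max[of "insert w B"] B by (simp add: P_def)
  qed
  then obtain v :: "'n \<Rightarrow> real ^ 'n" where v: "bij_betw v UNIV B"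
    using B finite_same_card_bij[of "UNIV :: 'n set" B] by (auto simp: P_def)
  then have vB: "v i \<in> B" for i by (auto simp: bij_betw_def)
  have "v i \<bullet> v j = (if i = j then 1 else 0)" for i j
  proof (cases "i = j")
    case True
    then show ?thesis using B vB[of j] by (simp add: P_def norm_eq_1)
  next
    case False
    then have "v i \<noteq> v j" using v by (auto simp: bij_betw_def inj_on_def)
    then show ?thesis using B vB False by (auto simp: P_def pairwise_def orthogonal_def)
  qed
  moreover have "\<forall>i. \<exists>c. A *v v i = c *\<^sub>R v i"
    using B vB by (auto simp: P_def)
  then obtain l where "\<forall>i. A *v v i = l i *\<^sub>R v i"
    by (rule choice[THEN exE])
  ultimately show ?thesis using that by blast
qed

lemma det_orthonormal_basis:
  fixes M :: "real ^ 'n ^ 'n" and v :: "'n \<Rightarrow> real ^ 'n"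
  assumes orth: "\<And>i j. v i \<bullet> v j = (if i = j then 1 else 0)"
  shows "det (\<chi> i j. v i \<bullet> (M *v v j)) = det M"
proof -
  define V where "V = (\<chi> i. v i)"
  have VV: "V ** transpose V = mat 1"
    by (simp add: vec_eq_iff matrix_matrix_mult_def transpose_def V_def mat_def inner_vec_def flip: orth)
  have eq: "(\<chi> i j. v i \<bullet> (M *v v j)) = V ** (M ** transpose V)"
    by (simp add: vec_eq_iff matrix_matrix_mult_def matrix_vector_mult_def transpose_def V_def inner_vec_def)
  have "det (V ** (M ** transpose V)) = det M * det (V ** transpose V)"
    by (simp add: det_mul)
  then show ?thesis by (simp add: eq VV)
qed

lemma det_shifted_eigenbasis:
  fixes A :: "real ^ 'n ^ 'n" and v :: "'n \<Rightarrow> real ^ 'n"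
  assumes orth: "\<And>i j. v i \<bullet> v j = (if i = j then 1 else 0)" and eig: "\<And>i. A *v v i = l i *\<^sub>R v i"
  shows "det (mat s + t *\<^sub>R A) = (\<Prod>i\<in>UNIV. s + t * l i)"
proof -
  have ms: "mat s *v x = s *\<^sub>R x" for x :: "real ^ 'n"
    by (simp add: vec_eq_iff matrix_vector_mult_def mat_def if_distrib[of "\<lambda>a. a * _"] cong: if_cong)
  have "v i \<bullet> ((mat s + t *\<^sub>R A) *v v j) = (if i = j then s + t * l i else 0)" for i j
    by (simp add: matrix_vector_mult_add_rdistrib ms scaleR_matrix_vector_assoc[symmetric] eig
        inner_add_right orth)
  then have "det (mat s + t *\<^sub>R A) = det (\<chi> i j. if i = j then s + t * l i else 0)"
    using det_orthonormal_basis[OF orth, of "mat s + t *\<^sub>R A"] by simp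
  also have "\<dots> = (\<Prod>i\<in>UNIV. s + t * l i)"
    by (subst det_diagonal) auto
  finally show ?thesis .
qed

lemma eq_permuted_if_prod_linear_eq:
  fixes l m :: "'n::finite \<Rightarrow> real"
  assumes "\<And>s. (\<Prod>i\<in>UNIV. s - l i) = (\<Prod>i\<in>UNIV. s - m i)"
  obtains p where "p permutes UNIV" "\<And>i. l i = m (p i)"
proof -
  have roots: "proots (\<Prod>i\<in>UNIV. [:- f i, 1:]) = image_mset f (mset_set UNIV)" for f :: "'n \<Rightarrow> real"
  proof -
    have "(\<Prod>i\<in>UNIV. [:- f i, 1:]) = (\<Prod>q\<in>#image_mset (\<lambda>i. [:- f i, 1:]) (mset_set UNIV). q)"
      by (simp add: prod_unfold_prod_mset)
    also have "proots \<dots> = (\<Sum>q\<in>#image_mset (\<lambda>i. [:- f i, 1:]) (mset_set UNIV). proots q)"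
      by (rule proots_prod_mset) auto
    also have "\<dots> = (\<Sum>i\<in>#mset_set UNIV. {#f i#})"
      by (simp add: image_mset.compositionality o_def)
    also have "\<dots> = image_mset f (mset_set UNIV)"
      by simp
    finally show ?thesis .
  qed
  have "(\<Prod>i\<in>UNIV. [:- l i, 1:]) = (\<Prod>i\<in>UNIV. [:- m i, 1:])"
    by (intro poly_eq_poly_eq_iff[THEN iffD1] ext)
       (use assms in \<open>simp add: poly_prod\<close>)
  then have "image_mset l (mset_set UNIV) = image_mset m (mset_set UNIV)"
    using roots by metis
  then obtain p where "p permutes UNIV" "\<forall>i\<in>UNIV. l i = m (p i)"
    by (rule image_mset_eq_implies_permutes[rotated]) auto
  then show ?thesis using that by auto
qed

text \<open>The eigenvalues chosen by \<open>eigenvalue_vec\<close> have the characteristic polynomial of any other list of eigenvalues, so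
they are a permutation of it. The eigenbasis can therefore be indexed to match them exactly.\<close>

lemma eigenvalue_vec_eigenbasis:
  fixes A :: "real ^ 'n ^ 'n"
  assumes sym: "transpose A = A"
  obtains v :: "'n \<Rightarrow> real ^ 'n" where
    "\<And>i j. v i \<bullet> v j = (if i = j then 1 else 0)" "\<And>i. A *v v i = (eigenvalue_vec A $ i) *\<^sub>R v i"
proof -
  obtain v :: "'n \<Rightarrow> real ^ 'n" and l where
    orth: "\<And>i j. v i \<bullet> v j = (if i = j then 1 else 0)" and eig: "\<And>i. A *v v i = l i *\<^sub>R v i"
    using symmetric_matrix_eigenbasis[OF sym] by blast
  have det: "det (mat s - A) = (\<Prod>i\<in>UNIV. s - l i)" for s
    using det_shifted_eigenbasis[OF orth eig, of s "-1"] by simp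
  then have "\<forall>s. det (mat s - A) = (\<Prod>i\<in>UNIV. s - (\<chi> i. l i) $ i)" by simp
  then have "\<forall>s. det (mat s - A) = (\<Prod>i\<in>UNIV. s - eigenvalue_vec A $ i)"
    unfolding eigenvalue_vec_def by (rule someI)
  then have "(\<Prod>i\<in>UNIV. s - eigenvalue_vec A $ i) = (\<Prod>i\<in>UNIV. s - l i)" for s
    using det by simp
  then obtain p where p: "p permutes UNIV" "\<And>i. eigenvalue_vec A $ i = l (p i)"
    using eq_permuted_if_prod_linear_eq[of "\<lambda>i. eigenvalue_vec A $ i" l] by blast
  have "v (p i) \<bullet> v (p j) = (if i = j then 1 else 0)" for i j
    using permutes_inj[OF p(1)] by (simp add: orth inj_eq)
  then show ?thesis using that[of "v \<circ> p"] eig p(2) by simp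
qed

text \<open>Lagrange interpolation at \<open>0, \<dots>, n\<close>. It expresses \<open>\<sigma>\<^sub>k\<close> of the eigenvalues by the determinants of
\<open>1 + i A\<close> with \<open>i \<le> n\<close>, hence as a smooth function of the entries of \<open>A\<close>.\<close>

lemma coeff_as_sum_of_values:
  obtains c :: "nat \<Rightarrow> real" where
    "\<And>p. degree p \<le> n \<Longrightarrow> coeff p k = (\<Sum>i\<le>n. c i * poly p (real i))"
proof -
  define b where "b i = smult (1 / (\<Prod>j\<in>{..n} - {i}. real i - real j)) (\<Prod>j\<in>{..n} - {i}. [:- real j, 1:])" for i
  have b: "poly (b i) (real m) = (if m = i then 1 else 0)" if "i \<le> n" "m \<le> n" for i m
    using that by (auto simp: b_def poly_prod)
  have deg: "degree (b i) \<le> n" if "i \<le> n" for i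
  proof -
    have "degree (\<Prod>j\<in>{..n} - {i}. [:- real j, 1:]) \<le> (\<Sum>j\<in>{..n} - {i}. 1)"
      by (rule order_trans[OF degree_prod_sum_le]) auto
    then show ?thesis using that degree_smult_le by (fastforce simp: b_def)
  qed
  have "coeff p k = (\<Sum>i\<le>n. coeff (b i) k * poly p (real i))" if p: "degree p \<le> n" for p
  proof -
    define q where "q = p - (\<Sum>i\<le>n. smult (poly p (real i)) (b i))"
    have degq: "degree q \<le> n"
      unfolding q_def using p deg
      by (intro degree_diff_le degree_sum_le order_trans[OF degree_smult_le]) auto
    have zero: "poly q (real m) = 0" if "m \<le> n" for m
    proof -
      have "(\<Sum>i\<le>n. poly p (real i) * poly (b i) (real m)) = (\<Sum>i\<le>n. if m = i then poly p (real m) else 0)"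
        using that by (intro sum.cong) (auto simp: b)
      then show ?thesis using that by (simp add: q_def poly_sum)
    qed
    have "q = 0"
    proof (rule ccontr)
      assume q: "q \<noteq> 0"
      have "card (real ` {..n}) \<le> card {x. poly q x = 0}"
        using zero poly_roots_finite[OF q] by (intro card_mono) auto
      also have "\<dots> \<le> degree q" using q by (rule card_poly_roots_bound)
      finally show False using degq by (simp add: card_image)
    qed
    then have "p = (\<Sum>i\<le>n. smult (poly p (real i)) (b i))" by (simp add: q_def)
    then have "coeff p k = coeff (\<Sum>i\<le>n. smult (poly p (real i)) (b i)) k" by simp
    then show ?thesis by (simp add: coeff_sum mult.commute)
  qed
  then show ?thesis by (rule that)
qed

lemma degree_prod_linear_le: "finite I \<Longrightarrow> degree (\<Prod>i\<in>I. [:1, f i:]) \<le> card I"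
  by (rule order_trans[OF degree_prod_sum_le])
     (auto intro!: order_trans[OF sum_bounded_above[of I _ 1]])

text \<open>A permutation other than the identity moves at least two indices, so that each term of the product rule keeps an off-diagonal factor.\<close>

lemma DERIV_det_at_diagonal:
  fixes M :: "real \<Rightarrow> real ^ 'n ^ 'n"
  assumes d: "\<And>i j. ((\<lambda>s. M s $ i $ j) has_real_derivative B $ i $ j) (at x)"
    and diag: "\<And>i j. i \<noteq> j \<Longrightarrow> M x $ i $ j = 0"
  shows "((\<lambda>s. det (M s)) has_real_derivative (\<Sum>i\<in>UNIV. B $ i $ i * (\<Prod>j\<in>UNIV - {i}. M x $ j $ j))) (at x)"
proof -
  have "((\<lambda>s. det (M s)) has_real_derivative
      (\<Sum>p | p permutes (UNIV :: 'n set). of_int (sign p) *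
        (\<Sum>i\<in>UNIV. B $ i $ p i * (\<Prod>j\<in>UNIV - {i}. M x $ j $ p j)))) (at x)"
    unfolding det_def
    by (intro DERIV_sum DERIV_cmult has_field_derivative_prod d)
  also have "(\<Sum>p | p permutes (UNIV :: 'n set). of_int (sign p) *
        (\<Sum>i\<in>UNIV. B $ i $ p i * (\<Prod>j\<in>UNIV - {i}. M x $ j $ p j)))
     = (\<Sum>p\<in>{id :: 'n \<Rightarrow> 'n}. of_int (sign p) *
        (\<Sum>i\<in>UNIV. B $ i $ p i * (\<Prod>j\<in>UNIV - {i}. M x $ j $ p j)))"
  proof (rule sum.mono_neutral_right)
    show "\<forall>p\<in>{p. p permutes (UNIV :: 'n set)} - {id}.
       of_int (sign p) * (\<Sum>i\<in>UNIV. B $ i $ p i * (\<Prod>j\<in>UNIV - {i}. M x $ j $ p j)) = 0"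
    proof
      fix p :: "'n \<Rightarrow> 'n" assume "p \<in> {p. p permutes (UNIV :: 'n set)} - {id}"
      then have p: "inj p" "p \<noteq> id" using permutes_inj by auto
      have z: "(\<Prod>j\<in>UNIV - {i}. M x $ j $ p j) = 0" for i
      proof -
        obtain a where a: "p a \<noteq> a" using p(2) by (auto simp: fun_eq_iff)
        then have "p (p a) \<noteq> p a" using p(1) by (simp add: inj_eq)
        then have "\<exists>b. b \<noteq> i \<and> p b \<noteq> b"
          using a by (cases "a = i") (intro exI[of _ "p a"], simp, intro exI[of _ a], simp)
        then obtain b where "b \<noteq> i" "p b \<noteq> b" by blast
        then show ?thesis using diag[of b "p b"] by (intro prod_zero) auto
      qed
      show "of_int (sign p) * (\<Sum>i\<in>UNIV. B $ i $ p i * (\<Prod>j\<in>UNIV - {i}. M x $ j $ p j)) = 0"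
        unfolding z by simp
    qed
  qed (auto simp: permutes_id finite_permutations)
  finally show ?thesis by simp
qed

text \<open>In the eigenbasis at \<open>0\<close>, the determinant of \<open>1 + \<tau> A(s)\<close> has derivative
\<open>\<Sum>\<^sub>i \<tau> B\<^sub>i\<^sub>i \<Prod>\<^bsub>j\<noteq>i\<^esub> (1 + \<tau> \<lambda>\<^sub>j)\<close>, whose coefficient of \<open>\<tau>\<^sup>k\<close> is the claim.\<close>

lemma DERIV_sigma_k_eigenvalue_vec:
  fixes A :: "real \<Rightarrow> real ^ 'n ^ 'n" and v :: "'n \<Rightarrow> real ^ 'n"
  assumes sym: "\<And>s. \<bar>s\<bar> < \<delta> \<Longrightarrow> transpose (A s) = A s" and \<delta>: "\<delta> > 0" and k: "k \<ge> 1"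
    and d: "\<And>i j. ((\<lambda>s. A s $ i $ j) has_real_derivative B $ i $ j) (at 0)"
    and orth: "\<And>i j. v i \<bullet> v j = (if i = j then 1 else 0)"
    and eig: "\<And>i. A 0 *v v i = (eigenvalue_vec (A 0) $ i) *\<^sub>R v i"
  shows "((\<lambda>s. sigma_k k (eigenvalue_vec (A s))) has_real_derivative
      (\<Sum>i\<in>UNIV. esym (UNIV - {i}) (k - 1) (\<lambda>i. eigenvalue_vec (A 0) $ i) * (v i \<bullet> (B *v v i)))) (at 0)"
proof -
  let ?n = "CARD('n)"
  obtain c where c: "\<And>p. degree p \<le> ?n \<Longrightarrow> coeff p k = (\<Sum>i\<le>?n. c i * poly p (real i))"
    using coeff_as_sum_of_values[of ?n k] by blast
  have sigma: "sigma_k k (eigenvalue_vec (A s)) = (\<Sum>i\<le>?n. c i * det (mat 1 + real i *\<^sub>R A s))"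
    if s: "\<bar>s\<bar> < \<delta>" for s
  proof -
    obtain w :: "'n \<Rightarrow> real ^ 'n" where w: "\<And>i j. w i \<bullet> w j = (if i = j then 1 else 0)"
        "\<And>i. A s *v w i = (eigenvalue_vec (A s) $ i) *\<^sub>R w i"
      using eigenvalue_vec_eigenbasis[OF sym[OF s]] by blast
    let ?p = "\<Prod>i\<in>UNIV. [:1, eigenvalue_vec (A s) $ i:]"
    have "sigma_k k (eigenvalue_vec (A s)) = coeff ?p k"
      by (simp add: sigma_k_eq_esym coeff_prod_linear_eq_esym)
    also have "\<dots> = (\<Sum>i\<le>?n. c i * poly ?p (real i))"
      by (rule c) (rule degree_prod_linear_le, simp)
    also have "\<dots> = (\<Sum>i\<le>?n. c i * det (mat 1 + real i *\<^sub>R A s))"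
      by (simp add: poly_prod det_shifted_eigenbasis[OF w])
    finally show ?thesis .
  qed
  let ?l = "\<lambda>i. eigenvalue_vec (A 0) $ i"
  have det_d: "((\<lambda>s. det (mat 1 + t *\<^sub>R A s)) has_real_derivative
      (\<Sum>i\<in>UNIV. (v i \<bullet> (B *v v i)) * (t * (\<Prod>j\<in>UNIV - {i}. 1 + t * ?l j)))) (at 0)" for t
  proof -
    let ?M = "\<lambda>s. \<chi> i j. v i \<bullet> ((mat 1 + t *\<^sub>R A s) *v v j)"
    have Mij: "v i \<bullet> ((mat 1 + t *\<^sub>R X) *v v j) = (if i = j then 1 else 0) + t * (v i \<bullet> (X *v v j))" for i j X
      by (simp add: matrix_vector_mult_add_rdistrib scaleR_matrix_vector_assoc[symmetric]
          inner_add_right orth)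
    have ip: "v i \<bullet> (X *v v j) = (\<Sum>a\<in>UNIV. v i $ a * (\<Sum>b\<in>UNIV. X $ a $ b * v j $ b))" for i j X
      by (simp add: inner_vec_def matrix_vector_mult_def)
    have "((\<lambda>s. det (?M s)) has_real_derivative
       (\<Sum>i\<in>UNIV. (\<chi> i j. t * (v i \<bullet> (B *v v j))) $ i $ i * (\<Prod>j\<in>UNIV - {i}. ?M 0 $ j $ j))) (at 0)"
    proof (rule DERIV_det_at_diagonal)
      fix i j
      have "((\<lambda>s. (if i = j then 1 else 0) + t * (\<Sum>a\<in>UNIV. v i $ a * (\<Sum>b\<in>UNIV. A s $ a $ b * v j $ b)))
          has_real_derivative 0 + t * (\<Sum>a\<in>UNIV. v i $ a * (\<Sum>b\<in>UNIV. B $ a $ b * v j $ b))) (at 0)"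
        by (intro DERIV_add DERIV_const DERIV_cmult DERIV_sum DERIV_cmult_right d)
      then show "((\<lambda>s. ?M s $ i $ j) has_real_derivative (\<chi> i j. t * (v i \<bullet> (B *v v j))) $ i $ j) (at 0)"
        by (simp only: vec_lambda_beta Mij) (simp only: ip add_0)
      show "?M 0 $ i $ j = 0" if "i \<noteq> j"
        using that by (simp add: Mij eig orth)
    qed
    moreover have "det (?M s) = det (mat 1 + t *\<^sub>R A s)" for s
      by (rule det_orthonormal_basis[OF orth])
    moreover have "?M 0 $ j $ j = 1 + t * ?l j" for j
      by (simp add: Mij eig orth)
    ultimately show ?thesis by (simp add: mult_ac)
  qed
  have "((\<lambda>s. \<Sum>i\<le>?n. c i * det (mat 1 + real i *\<^sub>R A s)) has_real_derivative
     (\<Sum>m\<le>?n. c m * (\<Sum>i\<in>UNIV. (v i \<bullet> (B *v v i)) * (real m * (\<Prod>j\<in>UNIV - {i}. 1 + real m * ?l j))))) (at 0)"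
    by (intro DERIV_sum DERIV_cmult det_d)
  also have "(\<Sum>m\<le>?n. c m * (\<Sum>i\<in>UNIV. (v i \<bullet> (B *v v i)) * (real m * (\<Prod>j\<in>UNIV - {i}. 1 + real m * ?l j))))
     = (\<Sum>i\<in>UNIV. (v i \<bullet> (B *v v i)) * (\<Sum>m\<le>?n. c m * (real m * (\<Prod>j\<in>UNIV - {i}. 1 + real m * ?l j))))"
    unfolding sum_distrib_left by (subst sum.swap) (intro sum.cong refl, simp)
  also have "\<dots> = (\<Sum>i\<in>UNIV. esym (UNIV - {i}) (k - 1) ?l * (v i \<bullet> (B *v v i)))"
  proof (intro sum.cong refl)
    fix i
    let ?p = "pCons 0 (\<Prod>j\<in>UNIV - {i}. [:1, ?l j:])"
    have "degree ?p \<le> ?n"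
      using degree_prod_linear_le[of "UNIV - {i}" ?l] order_trans[OF degree_pCons_le]
      by (fastforce simp: card_Diff_singleton)
    from c[OF this] have "coeff ?p k = (\<Sum>m\<le>?n. c m * (real m * (\<Prod>j\<in>UNIV - {i}. 1 + real m * ?l j)))"
      by (simp add: poly_prod)
    moreover have "coeff ?p k = esym (UNIV - {i}) (k - 1) ?l"
      using k by (cases k) (simp_all add: coeff_prod_linear_eq_esym)
    ultimately show "(v i \<bullet> (B *v v i)) * (\<Sum>m\<le>?n. c m * (real m * (\<Prod>j\<in>UNIV - {i}. 1 + real m * ?l j)))
      = esym (UNIV - {i}) (k - 1) ?l * (v i \<bullet> (B *v v i))" by simp
  qed
  finally have "((\<lambda>s. \<Sum>i\<le>?n. c i * det (mat 1 + real i *\<^sub>R A s)) has_real_derivative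
     (\<Sum>i\<in>UNIV. esym (UNIV - {i}) (k - 1) ?l * (v i \<bullet> (B *v v i)))) (at 0)" .
  then show ?thesis
    by (rule DERIV_cong_ev[THEN iffD2, rotated -1])
       (auto intro!: eventually_nhds_metric[THEN iffD2] exI[of _ \<delta>] simp: \<delta> sigma dist_real_def)
qed

section \<open>Differentiability almost everywhere of Lipschitz functions\<close>

text \<open>Vitali's theorem only requires the points to lie somewhere in the covering balls, so each interval can have the point as an end
point.\<close>

lemma Vitali_covering_intervals:
  fixes S :: "real set" and Q :: "real \<Rightarrow> real \<Rightarrow> bool"
  assumes "\<And>x d. x \<in> S \<Longrightarrow> 0 < d \<Longrightarrow> \<exists>c e. c < e \<and> x \<in> {c..e} \<and> e - c < d \<and> Q c e"
  obtains C where "countable C" "\<And>c e. (c, e) \<in> C \<Longrightarrow> c < e \<and> Q c e"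
    "disjoint_family_on (\<lambda>(c, e). {c..e}) C" "negligible (S - (\<Union>(c, e)\<in>C. {c..e}))"
proof -
  define a where "a i = (fst i + snd i) / 2" for i :: "real \<times> real"
  define r where "r i = (snd i - fst i) / 2" for i :: "real \<times> real"
  have ball: "cball (a i) (r i) = (case i of (c, e) \<Rightarrow> {c..e})" for i
    by (auto simp: a_def r_def cball_eq_atLeastAtMost field_simps split: prod.split)
  let ?K = "{(c, e). c < e \<and> Q c e}"
  have r: "0 < r i" if "i \<in> ?K" for i
    using that by (auto simp: r_def)
  have cov: "\<exists>i. i \<in> ?K \<and> x \<in> cball (a i) (r i) \<and> r i < d" if "x \<in> S" "0 < d" for x d
  proof -
    obtain c e where "c < e" "x \<in> {c..e}" "e - c < d" "Q c e" using assms \<open>x \<in> S\<close> \<open>0 < d\<close> by blast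
    then show ?thesis
      unfolding ball by (intro exI[of _ "(c, e)"]) (auto simp: r_def)
  qed
  obtain C where C: "countable C" "C \<subseteq> ?K"
     "pairwise (\<lambda>i j. disjnt (cball (a i) (r i)) (cball (a j) (r j))) C"
     "negligible(S - (\<Union>i \<in> C. cball (a i) (r i)))"
    by (rule Vitali_covering_theorem_cballs[of ?K r S a]) (use r cov in auto)
  show ?thesis
  proof (rule that)
    show "countable C" by (rule C)
    show "c < e \<and> Q c e" if "(c, e) \<in> C" for c e using C(2) that by auto
    show "disjoint_family_on (\<lambda>(c, e). {c..e}) C"
      using C(3) unfolding ball by (auto simp: disjoint_family_on_def pairwise_def disjnt_def)
    show "negligible (S - (\<Union>(c, e)\<in>C. {c..e}))"
      using C(4) unfolding ball by simp
  qed
qed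

text \<open>Disjoint intervals covering almost all of \<open>E\<close> have total length at least that of \<open>E\<close>, and the Stieltjes measure of \<open>g\<close>
adds up the increments of \<open>g\<close>.\<close>

lemma Vitali_increment_lower:
  fixes g :: "real \<Rightarrow> real"
  assumes mono: "\<And>x y. x \<le> y \<Longrightarrow> g x \<le> g y" and cont: "continuous_on UNIV g"
    and E: "E \<in> sets borel" and V: "open V" and q: "q \<ge> 0"
    and cov: "\<And>x d. x \<in> E \<Longrightarrow> 0 < d \<Longrightarrow>
      \<exists>c e. c < e \<and> x \<in> {c..e} \<and> e - c < d \<and> {c..e} \<subseteq> V \<and> q * (e - c) \<le> g e - g c"
  shows "ennreal q * emeasure lborel E \<le> emeasure (interval_measure g) V"
proof -
  obtain C where C: "countable C"
      "\<And>c e. (c, e) \<in> C \<Longrightarrow> c < e \<and> {c..e} \<subseteq> V \<and> q * (e - c) \<le> g e - g c"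
      "disjoint_family_on (\<lambda>(c, e). {c..e}) C" "negligible (E - (\<Union>(c, e)\<in>C. {c..e}))"
    using Vitali_covering_intervals[of E "\<lambda>c e. {c..e} \<subseteq> V \<and> q * (e - c) \<le> g e - g c"] cov
    by blast
  let ?W = "\<Union>(c, e)\<in>C. {c..e}"
  have W: "?W \<in> sets borel" using C(1) by (intro sets.countable_UN') auto
  have "E - ?W \<in> null_sets lborel"
    using C(4) E W by (simp add: negligible_iff_null_sets null_sets_completion_iff)
  then have "emeasure lborel E \<le> emeasure lborel ?W"
    using E W by (metis (no_types, lifting) Diff_subset_conv Un_Diff_cancel emeasure_Un_null_set emeasure_mono sets_lborel subset_refl sets.Un)
  also have "emeasure lborel ?W = (\<integral>\<^sup>+i. emeasure lborel (case i of (c, e) \<Rightarrow> {c..e}) \<partial>count_space C)"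
    using C(1,3) by (intro emeasure_UN_countable) auto
  finally have "ennreal q * emeasure lborel E
      \<le> ennreal q * (\<integral>\<^sup>+i. emeasure lborel (case i of (c, e) \<Rightarrow> {c..e}) \<partial>count_space C)"
    by (rule mult_left_mono) simp
  also have "\<dots> = (\<integral>\<^sup>+i. ennreal q * emeasure lborel (case i of (c, e) \<Rightarrow> {c..e}) \<partial>count_space C)"
    by (rule nn_integral_cmult[symmetric]) simp
  also have "\<dots> \<le> (\<integral>\<^sup>+i. emeasure (interval_measure g) (case i of (c, e) \<Rightarrow> {c..e}) \<partial>count_space C)"
  proof (rule nn_integral_mono)
    fix i assume i: "i \<in> space (count_space C)"
    obtain c e where ce: "i = (c, e)" by (cases i)
    then have "c < e" "q * (e - c) \<le> g e - g c" using C(2) i by auto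
    then show "ennreal q * emeasure lborel (case i of (c, e) \<Rightarrow> {c..e}) \<le>
        emeasure (interval_measure g) (case i of (c, e) \<Rightarrow> {c..e})"
      using q by (simp add: ce emeasure_interval_measure_Icc mono cont ennreal_mult[symmetric] ennreal_leI)
  qed
  also have "\<dots> = emeasure (interval_measure g) ?W"
    using C(1,3) by (intro emeasure_UN_countable[symmetric]) auto
  also have "\<dots> \<le> emeasure (interval_measure g) V"
    using C(2) V by (intro emeasure_mono) auto
  finally show ?thesis .
qed

text \<open>The conclusion is about an open set, the union of the interiors of the covering intervals, so that a second covering can be chosen
inside it.\<close>

lemma Vitali_increment_upper:
  fixes g :: "real \<Rightarrow> real"
  assumes mono: "\<And>x y. x \<le> y \<Longrightarrow> g x \<le> g y" and cont: "continuous_on UNIV g"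
    and E: "E \<in> sets borel" and U: "open U" and p: "p \<ge> 0"
    and cov: "\<And>x d. x \<in> E \<Longrightarrow> 0 < d \<Longrightarrow>
      \<exists>c e. c < e \<and> x \<in> {c..e} \<and> e - c < d \<and> {c..e} \<subseteq> U \<and> g e - g c \<le> p * (e - c)"
  obtains V where "open V" "V \<subseteq> U" "E - V \<in> null_sets lborel"
    "emeasure (interval_measure g) V \<le> ennreal p * emeasure lborel U"
proof -
  obtain C where C: "countable C"
      "\<And>c e. (c, e) \<in> C \<Longrightarrow> c < e \<and> {c..e} \<subseteq> U \<and> g e - g c \<le> p * (e - c)"
      "disjoint_family_on (\<lambda>(c, e). {c..e}) C" "negligible (E - (\<Union>(c, e)\<in>C. {c..e}))"
    using Vitali_covering_intervals[of E "\<lambda>c e. {c..e} \<subseteq> U \<and> g e - g c \<le> p * (e - c)"] cov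
    by blast
  let ?W = "\<Union>(c, e)\<in>C. {c..e}" and ?V = "\<Union>(c, e)\<in>C. {c<..<e}"
  have W: "?W \<in> sets borel" using C(1) by (intro sets.countable_UN') auto
  have V: "open ?V" by auto
  have "E - ?V \<subseteq> (E - ?W) \<union> (fst ` C \<union> snd ` C)" by force
  moreover have "negligible ((E - ?W) \<union> (fst ` C \<union> snd ` C))"
    using C(1,4) by (intro negligible_Un)
      (auto simp: negligible_iff_null_sets intro!: null_sets_completionI countable_imp_null_set_lborel)
  ultimately have "negligible (E - ?V)" by (rule negligible_subset[rotated])
  then have "E - ?V \<in> null_sets lborel"
    using E V by (simp add: negligible_iff_null_sets null_sets_completion_iff borel_open)
  moreover have "emeasure (interval_measure g) ?V \<le> ennreal p * emeasure lborel U"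
  proof -
    have "emeasure (interval_measure g) ?V \<le> emeasure (interval_measure g) ?W"
      using W by (intro emeasure_mono) (auto intro: less_imp_le)
    also have "\<dots> = (\<integral>\<^sup>+i. emeasure (interval_measure g) (case i of (c, e) \<Rightarrow> {c..e}) \<partial>count_space C)"
      using C(1,3) by (intro emeasure_UN_countable) auto
    also have "\<dots> \<le> (\<integral>\<^sup>+i. ennreal p * emeasure lborel (case i of (c, e) \<Rightarrow> {c..e}) \<partial>count_space C)"
    proof (rule nn_integral_mono)
      fix i assume i: "i \<in> space (count_space C)"
      obtain c e where ce: "i = (c, e)" by (cases i)
      then have "c < e" "g e - g c \<le> p * (e - c)" using C(2) i by auto
      then show "emeasure (interval_measure g) (case i of (c, e) \<Rightarrow> {c..e}) \<le>
          ennreal p * emeasure lborel (case i of (c, e) \<Rightarrow> {c..e})"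
        using p by (simp add: ce emeasure_interval_measure_Icc mono cont ennreal_mult[symmetric] ennreal_leI)
    qed
    also have "\<dots> = ennreal p * (\<integral>\<^sup>+i. emeasure lborel (case i of (c, e) \<Rightarrow> {c..e}) \<partial>count_space C)"
      by (rule nn_integral_cmult) simp
    also have "(\<integral>\<^sup>+i. emeasure lborel (case i of (c, e) \<Rightarrow> {c..e}) \<partial>count_space C) = emeasure lborel ?W"
      using C(1,3) by (intro emeasure_UN_countable[symmetric]) auto
    also have "ennreal p * \<dots> \<le> ennreal p * emeasure lborel U"
      using C(2) U by (intro mult_left_mono emeasure_mono) auto
    finally show ?thesis .
  qed
  moreover have "?V \<subseteq> U" using C(2) by fastforce
  ultimately show ?thesis using that V by blast
qed

text \<open>The points at which the difference quotients in direction \<open>b\<close> fall below \<open>p\<close> and exceed \<open>q\<close> at arbitrarily small scales, of either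
sign of \<open>h\<close>. Strict inequalities make this a countable intersection of open sets when \<open>F\<close> is continuous.\<close>

definition oscillation_set :: "('a::real_normed_vector \<Rightarrow> real) \<Rightarrow> 'a \<Rightarrow> real \<Rightarrow> real \<Rightarrow> 'a set" where
  "oscillation_set F b p q = {x. \<forall>n.
     (\<exists>h. 0 < \<bar>h\<bar> \<and> \<bar>h\<bar> < inverse (real (Suc n)) \<and> (F (x + h *\<^sub>R b) - F x) / h < p) \<and>
     (\<exists>h. 0 < \<bar>h\<bar> \<and> \<bar>h\<bar> < inverse (real (Suc n)) \<and> (F (x + h *\<^sub>R b) - F x) / h > q)}"

lemma oscillation_set_borel:
  assumes "continuous_on UNIV F"
  shows "oscillation_set F b p q \<in> sets borel"
proof -
  let ?A = "\<lambda>n. \<Union>h\<in>{h. 0 < \<bar>h\<bar> \<and> \<bar>h\<bar> < inverse (real (Suc n))}. {x. (F (x + h *\<^sub>R b) - F x) / h < p}"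
  let ?B = "\<lambda>n. \<Union>h\<in>{h. 0 < \<bar>h\<bar> \<and> \<bar>h\<bar> < inverse (real (Suc n))}. {x. q < (F (x + h *\<^sub>R b) - F x) / h}"
  have cont: "continuous_on UNIV (\<lambda>x. (F (x + h *\<^sub>R b) - F x) / h)" if "0 < \<bar>h\<bar>" for h
    using that by (intro continuous_intros continuous_on_compose2[OF assms] assms) auto
  have "open (?A n)" "open (?B n)" for n
    using cont by (auto intro!: open_UN open_Collect_less continuous_on_const)
  then have "(\<Inter>n. ?A n \<inter> ?B n) \<in> sets borel"
    by (intro sets.countable_INT) auto
  also have "(\<Inter>n. ?A n \<inter> ?B n) = oscillation_set F b p q"
    by (auto simp: oscillation_set_def)
  finally show ?thesis .
qed

lemma oscillation_interval:
  fixes g :: "real \<Rightarrow> real"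
  assumes "h \<noteq> 0"
  shows "\<exists>c e. c < e \<and> x \<in> {c..e} \<and> e - c = \<bar>h\<bar> \<and> {c..e} \<subseteq> cball x \<bar>h\<bar> \<and> (g (x + h) - g x) / h * (e - c) = g e - g c"
proof (cases "h > 0")
  case True
  then show ?thesis
    by (intro exI[of _ x] exI[of _ "x + h"]) (auto simp: dist_real_def)
next
  case False
  then show ?thesis
    using assms by (intro exI[of _ "x + h"] exI[of _ x]) (auto simp: dist_real_def)
qed

text \<open>Lebesgue's argument: the set \<open>E\<close> is covered, up to a null set, by intervals in a neighbourhood \<open>U\<close> of \<open>E\<close> on which the increment is at
most \<open>p\<close> times the length, and then inside these by intervals on which it is at least \<open>q\<close> times the length. Hence
\<open>q |E| \<le> p |U|\<close>, with \<open>|U|\<close> as close to \<open>|E|\<close> as desired.\<close>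

lemma oscillation_set_mono_null:
  fixes g :: "real \<Rightarrow> real"
  assumes mono: "\<And>x y. x \<le> y \<Longrightarrow> g x \<le> g y" and cont: "continuous_on UNIV g" and pq: "p < q"
  shows "oscillation_set g 1 p q \<in> null_sets lborel"
proof (cases "p > 0")
  case False
  have "(g (x + h) - g x) / h \<ge> 0" for x h
    using mono[of x "x + h"] mono[of "x + h" x] by (cases "h \<ge> 0") (auto simp: divide_nonneg_nonneg divide_nonpos_neg)
  then have "\<not> (g (x + h) - g x) / h < p" for x h
    using False by (metis linorder_not_less order_trans)
  then have "oscillation_set g 1 p q = {}" unfolding oscillation_set_def by simp
  then show ?thesis by simp
next
  case p: True
  have null: "oscillation_set g 1 p q \<inter> ball 0 (real m) \<in> null_sets lborel" for m
  proof -
    let ?E = "oscillation_set g 1 p q \<inter> ball 0 (real m)"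
    have E: "?E \<in> sets borel" using oscillation_set_borel[OF cont] by auto
    have small: "\<exists>h h'. h \<noteq> 0 \<and> \<bar>h\<bar> < d \<and> (g (x + h) - g x) / h < p \<and> h' \<noteq> 0 \<and> \<bar>h'\<bar> < d \<and> (g (x + h') - g x) / h' > q"
      if x: "x \<in> ?E" and d: "0 < d" for x d
    proof -
      obtain n where n: "inverse (real (Suc n)) < d" using reals_Archimedean[OF d] by blast
      have "(\<exists>h. 0 < \<bar>h\<bar> \<and> \<bar>h\<bar> < inverse (real (Suc n)) \<and> (g (x + h *\<^sub>R 1) - g x) / h < p) \<and>
          (\<exists>h. 0 < \<bar>h\<bar> \<and> \<bar>h\<bar> < inverse (real (Suc n)) \<and> (g (x + h *\<^sub>R 1) - g x) / h > q)"
        using x unfolding oscillation_set_def by blast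
      then obtain h h' where "0 < \<bar>h\<bar>" "\<bar>h\<bar> < inverse (real (Suc n))" "(g (x + h) - g x) / h < p"
          "0 < \<bar>h'\<bar>" "\<bar>h'\<bar> < inverse (real (Suc n))" "(g (x + h') - g x) / h' > q"
        unfolding real_scaleR_def mult_1_right by blast
      then show ?thesis using n by (intro exI[of _ h] exI[of _ h']) auto
    qed
    have fin: "emeasure lborel ?E < \<infinity>"
      by (rule le_less_trans[OF emeasure_mono emeasure_lborel_ball_finite[of 0 "real m"]]) auto
    have main: "q * measure lborel ?E \<le> p * (measure lborel ?E + \<epsilon>)" if \<epsilon>: "\<epsilon> > 0" for \<epsilon>
    proof -
      obtain U where U: "open U" "?E \<subseteq> U" "emeasure lborel (U - ?E) < ennreal \<epsilon>"
        using outer_regular_lborel[OF E \<epsilon>] by blast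
      have cov1: "\<exists>c e. c < e \<and> x \<in> {c..e} \<and> e - c < d \<and> {c..e} \<subseteq> U \<and> g e - g c \<le> p * (e - c)"
        if x: "x \<in> ?E" and d: "0 < d" for x d
      proof -
        obtain \<delta> where \<delta>: "\<delta> > 0" "cball x \<delta> \<subseteq> U" using U x open_contains_cball by blast
        obtain h where h: "h \<noteq> 0" "\<bar>h\<bar> < min d \<delta>" "(g (x + h) - g x) / h < p"
          using small[OF x, of "min d \<delta>"] d \<delta> by auto
        obtain c e where ce: "c < e" "x \<in> {c..e}" "e - c = \<bar>h\<bar>" "{c..e} \<subseteq> cball x \<bar>h\<bar>"
            "(g (x + h) - g x) / h * (e - c) = g e - g c"
          using oscillation_interval[OF h(1), of x g] by blast
        have "g e - g c \<le> p * (e - c)"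
          unfolding ce(5)[symmetric] using h ce(1) by (intro mult_right_mono) auto
        moreover have "{c..e} \<subseteq> U" using ce(4) \<delta>(2) h(2) by fastforce
        ultimately show ?thesis using ce h(2) by (intro exI[of _ c] exI[of _ e]) auto
      qed
      obtain V where V: "open V" "V \<subseteq> U" "?E - V \<in> null_sets lborel"
        "emeasure (interval_measure g) V \<le> ennreal p * emeasure lborel U"
        using Vitali_increment_upper[OF mono cont E U(1) less_imp_le[OF p] cov1] by blast
      have cov2: "\<exists>c e. c < e \<and> x \<in> {c..e} \<and> e - c < d \<and> {c..e} \<subseteq> V \<and> q * (e - c) \<le> g e - g c"
        if x: "x \<in> ?E \<inter> V" and d: "0 < d" for x d
      proof -
        obtain \<delta> where \<delta>: "\<delta> > 0" "cball x \<delta> \<subseteq> V" using V x open_contains_cball by blast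
        obtain h where h: "h \<noteq> 0" "\<bar>h\<bar> < min d \<delta>" "(g (x + h) - g x) / h > q"
          using small[of x "min d \<delta>"] x d \<delta> by auto
        obtain c e where ce: "c < e" "x \<in> {c..e}" "e - c = \<bar>h\<bar>" "{c..e} \<subseteq> cball x \<bar>h\<bar>"
            "(g (x + h) - g x) / h * (e - c) = g e - g c"
          using oscillation_interval[OF h(1), of x g] by blast
        have "q * (e - c) \<le> g e - g c"
          unfolding ce(5)[symmetric] using h ce(1) by (intro mult_right_mono) auto
        moreover have "{c..e} \<subseteq> V" using ce(4) \<delta>(2) h(2) by fastforce
        ultimately show ?thesis using ce h(2) by (intro exI[of _ c] exI[of _ e]) auto
      qed
      have "emeasure lborel ?E \<le> emeasure lborel (?E \<inter> V) + emeasure lborel (?E - V)"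
        using emeasure_subadditive[of "?E \<inter> V" lborel "?E - V"] E V(1)
        by (simp add: Int_Diff_Un borel_open)
      then have "emeasure lborel ?E \<le> emeasure lborel (?E \<inter> V)" using V(3) by (simp add: null_setsD1)
      then have "ennreal q * emeasure lborel ?E \<le> ennreal q * emeasure lborel (?E \<inter> V)"
        by (rule mult_left_mono) simp
      also have "\<dots> \<le> emeasure (interval_measure g) V"
        using E V(1) p pq by (intro Vitali_increment_lower[OF mono cont _ V(1) _ cov2]) auto
      also have "\<dots> \<le> ennreal p * emeasure lborel U" by (rule V)
      also have "emeasure lborel U \<le> emeasure lborel ?E + emeasure lborel (U - ?E)"
        using emeasure_subadditive[of ?E lborel "U - ?E"] E U by (simp add: Un_absorb1 borel_open)
      also have "\<dots> \<le> emeasure lborel ?E + ennreal \<epsilon>"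
        using U(3) by (intro add_left_mono) auto
      finally have "ennreal q * emeasure lborel ?E \<le> ennreal p * (emeasure lborel ?E + ennreal \<epsilon>)"
        by (simp add: mult_left_mono)
      moreover have "emeasure lborel ?E = ennreal (measure lborel ?E)"
        using fin by (intro emeasure_eq_ennreal_measure) auto
      ultimately have "ennreal (q * measure lborel ?E) \<le> ennreal (p * (measure lborel ?E + \<epsilon>))"
        using p pq \<epsilon> by (simp add: ennreal_mult ennreal_plus)
      then show ?thesis
        using p \<epsilon> by (subst (asm) ennreal_le_iff) (auto intro!: mult_nonneg_nonneg add_nonneg_nonneg)
    qed
    have "measure lborel ?E = 0"
    proof (rule ccontr)
      assume "measure lborel ?E \<noteq> 0"
      then have a: "measure lborel ?E > 0" by (simp add: zero_less_measure_iff)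
      define \<epsilon> where "\<epsilon> = (q - p) * measure lborel ?E / (2 * p)"
      have "\<epsilon> > 0" using a p pq by (simp add: \<epsilon>_def)
      from main[OF this] have "q * measure lborel ?E \<le> p * measure lborel ?E + (q - p) * measure lborel ?E / 2"
        using p by (simp add: \<epsilon>_def distrib_left)
      moreover have "(q - p) * measure lborel ?E = q * measure lborel ?E - p * measure lborel ?E"
        by (rule left_diff_distrib)
      ultimately have "(q - p) * measure lborel ?E \<le> 0" by linarith
      then show False using a pq by (simp add: mult_le_0_iff)
    qed
    then have "emeasure lborel ?E = 0"
      using fin by (simp add: emeasure_eq_ennreal_measure)
    then show ?thesis using E by auto
  qed
  have "oscillation_set g 1 p q = (\<Union>m. oscillation_set g 1 p q \<inter> ball 0 (real m))"
    by (auto simp: reals_Archimedean2)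
  then show ?thesis using null by (metis null_sets_UN)
qed

lemma oscillation_set_lipschitz_null:
  fixes f :: "real \<Rightarrow> real"
  assumes lip: "K-lipschitz_on UNIV f" and pq: "p < q"
  shows "oscillation_set f 1 p q \<in> null_sets lborel"
proof -
  define g where "g x = f x + K * x" for x
  have "\<bar>f y - f x\<bar> \<le> K * \<bar>y - x\<bar>" for x y
    using lipschitz_onD[OF lip, of y x] by (simp add: dist_real_def)
  then have mono: "g x \<le> g y" if "x \<le> y" for x y
  proof -
    have "f x - f y \<le> K * (y - x)"
      using \<open>\<And>x y. \<bar>f y - f x\<bar> \<le> K * \<bar>y - x\<bar>\<close>[of y x] that by auto
    then show ?thesis by (simp add: g_def algebra_simps)
  qed
  have "continuous_on UNIV g"
    unfolding g_def using lipschitz_on_continuous_on[OF lip] by (intro continuous_intros)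
  then have "oscillation_set g 1 (p + K) (q + K) \<in> null_sets lborel"
    using pq mono by (intro oscillation_set_mono_null) auto
  moreover have "(g (x + h) - g x) / h = (f (x + h) - f x) / h + K" if "0 < \<bar>h\<bar>" for x h
    using that by (simp add: g_def field_simps)
  then have "oscillation_set g 1 (p + K) (q + K) = oscillation_set f 1 p q"
    unfolding oscillation_set_def by (simp cong: conj_cong)
  ultimately show ?thesis by simp
qed

lemma nn_integral_lborel_translate:
  fixes f :: "'a::euclidean_space \<Rightarrow> ennreal"
  assumes [measurable]: "f \<in> borel_measurable borel"
  shows "(\<integral>\<^sup>+x. f (x + c) \<partial>lborel) = (\<integral>\<^sup>+x. f x \<partial>lborel)"
proof -
  have "(\<integral>\<^sup>+x. f x \<partial>lborel) = (\<integral>\<^sup>+x. f x \<partial>distr lborel borel ((+) c))"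
    by (simp only: lborel_distr_plus)
  also have "\<dots> = (\<integral>\<^sup>+x. f (c + x) \<partial>lborel)"
    by (intro nn_integral_distr) auto
  finally show ?thesis by (simp add: add.commute)
qed

text \<open>Tonelli's theorem, and translation invariance in \<open>x\<close> for each fixed \<open>s\<close>.\<close>

lemma nn_integral_lines:
  fixes N :: "'a::euclidean_space set"
  assumes N: "N \<in> sets borel"
  shows "(\<integral>\<^sup>+x. \<integral>\<^sup>+s. indicator {a..b} s * indicator N (x + s *\<^sub>R v) \<partial>lborel \<partial>lborel)
     = emeasure lborel {a..b::real} * emeasure lborel N"
proof -
  have P: "pair_sigma_finite (lborel :: 'a measure) (lborel :: real measure)" ..
  note [measurable] = N
  have meas: "(\<lambda>(x, s). indicator {a..b} s * indicator N (x + s *\<^sub>R v) :: ennreal)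
      \<in> borel_measurable ((lborel :: 'a measure) \<Otimes>\<^sub>M (lborel :: real measure))"
    by measurable
  have "(\<integral>\<^sup>+x. \<integral>\<^sup>+s. indicator {a..b} s * indicator N (x + s *\<^sub>R v) \<partial>lborel \<partial>lborel)
     = (\<integral>\<^sup>+s. \<integral>\<^sup>+x. indicator {a..b} s * indicator N (x + s *\<^sub>R v) \<partial>lborel \<partial>lborel)"
    by (rule pair_sigma_finite.Fubini'[OF P meas, symmetric])
  also have "\<dots> = (\<integral>\<^sup>+s. indicator {a..b} s * emeasure lborel N \<partial>lborel)"
  proof (intro nn_integral_cong)
    fix s :: real
    have "(\<integral>\<^sup>+x. indicator {a..b} s * indicator N (x + s *\<^sub>R v) \<partial>lborel)
        = indicator {a..b} s * (\<integral>\<^sup>+x. indicator N (x + s *\<^sub>R v) \<partial>lborel)"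
      by (intro nn_integral_cmult) measurable
    also have "(\<integral>\<^sup>+x. indicator N (x + s *\<^sub>R v) \<partial>lborel) = emeasure lborel N"
      using N by (subst nn_integral_lborel_translate) auto
    finally show "(\<integral>\<^sup>+x. indicator {a..b} s * indicator N (x + s *\<^sub>R v) \<partial>lborel)
        = indicator {a..b} s * emeasure lborel N" .
  qed
  also have "\<dots> = emeasure lborel {a..b} * emeasure lborel N"
    by (subst nn_integral_multc) auto
  finally show ?thesis .
qed

lemma null_if_null_on_lines:
  fixes N :: "'a::euclidean_space set"
  assumes N: "N \<in> sets borel" and null: "\<And>x. {s. x + s *\<^sub>R v \<in> N} \<in> null_sets lborel"
  shows "N \<in> null_sets lborel"
proof -
  have "(\<integral>\<^sup>+s. indicator {0..1::real} s * indicator N (x + s *\<^sub>R v) \<partial>lborel) = 0" for x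
  proof -
    have "(\<integral>\<^sup>+s. indicator {0..1::real} s * indicator N (x + s *\<^sub>R v) \<partial>lborel) = (\<integral>\<^sup>+(s::real). 0 \<partial>lborel)"
      by (rule nn_integral_cong_AE, rule AE_I'[OF null[of x]]) (auto simp: indicator_def)
    then show ?thesis by simp
  qed
  then have "emeasure lborel {0..1::real} * emeasure lborel N = 0"
    using nn_integral_lines[OF N, of 0 1 v] by simp
  then show ?thesis using N by auto
qed

lemma AE_null_on_lines:
  fixes N :: "'a::euclidean_space set"
  assumes null: "N \<in> null_sets lborel"
  shows "AE x in lborel. AE s in lborel. s \<in> {a..b::real} \<longrightarrow> x + s *\<^sub>R v \<notin> N"
proof -
  have N[measurable]: "N \<in> sets borel" using null by auto
  have "(\<integral>\<^sup>+x. \<integral>\<^sup>+s. indicator {a..b::real} s * indicator N (x + s *\<^sub>R v) \<partial>lborel \<partial>lborel) = 0"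
    using nn_integral_lines[OF N, of a b v] null by (simp add: null_setsD1)
  then have "AE x in lborel. (\<integral>\<^sup>+s. indicator {a..b::real} s * indicator N (x + s *\<^sub>R v) \<partial>lborel) = 0"
    by (rule nn_integral_0_iff_AE[THEN iffD1, rotated]) measurable
  then show ?thesis
  proof (rule eventually_mono)
    fix x :: 'a
    assume "(\<integral>\<^sup>+s. indicator {a..b::real} s * indicator N (x + s *\<^sub>R v) \<partial>lborel) = 0"
    then have "AE s in lborel. indicator {a..b::real} s * indicator N (x + s *\<^sub>R v) = (0 :: ennreal)"
      by (rule nn_integral_0_iff_AE[THEN iffD1, rotated]) measurable
    then show "AE s in lborel. s \<in> {a..b::real} \<longrightarrow> x + s *\<^sub>R v \<notin> N"
      by (rule eventually_mono) (auto simp: indicator_def)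
  qed
qed

text \<open>Rational gaps suffice, and they make the union countable.\<close>

definition oscillation_points :: "('a::real_normed_vector \<Rightarrow> real) \<Rightarrow> 'a \<Rightarrow> 'a set" where
  "oscillation_points F b = (\<Union>(p, q)\<in>{(p, q). p \<in> \<rat> \<and> q \<in> \<rat> \<and> p < q}. oscillation_set F b p q)"

lemma oscillation_points_null:
  fixes F :: "'a::euclidean_space \<Rightarrow> real"
  assumes lip: "K-lipschitz_on UNIV F"
  shows "oscillation_points F b \<in> null_sets lborel"
proof -
  have "oscillation_set F b p q \<in> null_sets lborel" if pq: "p < q" for p q
  proof (rule null_if_null_on_lines[where v = b])
    show "oscillation_set F b p q \<in> sets borel"
      by (intro oscillation_set_borel lipschitz_on_continuous_on[OF lip])
    fix x
    define f where "f s = F (x + s *\<^sub>R b)" for s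
    have "(K * norm b)-lipschitz_on UNIV f"
    proof (rule lipschitz_onI)
      fix s t :: real
      have "dist (f s) (f t) \<le> K * dist (x + s *\<^sub>R b) (x + t *\<^sub>R b)"
        unfolding f_def by (rule lipschitz_onD[OF lip]) auto
      also have "dist (x + s *\<^sub>R b) (x + t *\<^sub>R b) = dist s t * norm b"
        by (simp add: dist_norm flip: scaleR_diff_left)
      finally show "dist (f s) (f t) \<le> K * norm b * dist s t" by (simp add: mult_ac)
    qed (use lipschitz_on_nonneg[OF lip] in auto)
    then have "oscillation_set f 1 p q \<in> null_sets lborel"
      by (rule oscillation_set_lipschitz_null[OF _ pq])
    moreover have "oscillation_set f 1 p q = {s. x + s *\<^sub>R b \<in> oscillation_set F b p q}"
      by (simp add: oscillation_set_def f_def scaleR_left_distrib add.assoc)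
    ultimately show "{s. x + s *\<^sub>R b \<in> oscillation_set F b p q} \<in> null_sets lborel" by simp
  qed
  moreover have "countable {(p, q). p \<in> \<rat> \<and> q \<in> \<rat> \<and> p < (q :: real)}"
    by (rule countable_subset[of _ "\<rat> \<times> \<rat>"]) (auto intro: countable_rat)
  ultimately show ?thesis
    unfolding oscillation_points_def by (intro null_sets_UN') auto
qed

text \<open>The difference quotients are bounded by the Lipschitz constant, so the only obstruction to convergence is a gap between lower and upper
limit, and rational numbers fit into such a gap.\<close>

lemma differentiable_off_oscillation_points:
  fixes F :: "'a::real_normed_vector \<Rightarrow> real"
  assumes lip: "K-lipschitz_on UNIV F" and x: "x \<notin> oscillation_points F b"
  shows "(\<lambda>h. F (x + h *\<^sub>R b)) differentiable (at 0)"
proof -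
  define Q where "Q h = (F (x + h *\<^sub>R b) - F x) / h" for h
  have Qb: "\<bar>Q h\<bar> \<le> K * norm b" if "h \<noteq> 0" for h
  proof -
    have "\<bar>F (x + h *\<^sub>R b) - F x\<bar> \<le> K * (\<bar>h\<bar> * norm b)"
      using lipschitz_onD[OF lip, of "x + h *\<^sub>R b" x] by (simp add: dist_norm)
    then show ?thesis using that by (simp add: Q_def abs_divide divide_le_eq mult_ac)
  qed
  let ?F = "at (0::real)" and ?Q = "\<lambda>h. ereal (Q h)"
  have nontriv: "?F \<noteq> bot" by simp
  have le: "Limsup ?F ?Q \<le> Liminf ?F ?Q"
  proof (rule ccontr)
    assume "\<not> ?thesis"
    then obtain p' where p': "Liminf ?F ?Q < ereal p'" "ereal p' < Limsup ?F ?Q"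
      using ereal_dense2[of "Liminf ?F ?Q" "Limsup ?F ?Q"] by (auto simp: not_le)
    then obtain q' where q': "ereal p' < ereal q'" "ereal q' < Limsup ?F ?Q"
      using ereal_dense2[of "ereal p'" "Limsup ?F ?Q"] by auto
    then have pq': "p' < q'" by simp
    obtain p where p: "p \<in> \<rat>" "p' < p" "p < q'" using Rats_dense_in_real[OF pq'] by blast
    obtain q where q: "q \<in> \<rat>" "p < q" "q < q'" using Rats_dense_in_real[OF p(3)] by blast
    have "\<exists>h. 0 < \<bar>h\<bar> \<and> \<bar>h\<bar> < inverse (real (Suc n)) \<and> Q h < p" for n
    proof (rule ccontr)
      assume "\<not> ?thesis"
      then have "\<forall>\<^sub>F h in ?F. ereal p' \<le> ?Q h"
        using p(2) by (auto simp: eventually_at intro!: exI[of _ "inverse (real (Suc n))"])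
      then have "ereal p' \<le> Liminf ?F ?Q" by (rule Liminf_bounded)
      then show False using p'(1) by simp
    qed
    moreover have "\<exists>h. 0 < \<bar>h\<bar> \<and> \<bar>h\<bar> < inverse (real (Suc n)) \<and> Q h > q" for n
    proof (rule ccontr)
      assume "\<not> ?thesis"
      then have "\<forall>\<^sub>F h in ?F. ?Q h \<le> ereal q'"
        using q(3) by (auto simp: eventually_at intro!: exI[of _ "inverse (real (Suc n))"])
      then have "Limsup ?F ?Q \<le> ereal q'" by (rule Limsup_bounded)
      then show False using q'(2) by simp
    qed
    ultimately have "x \<in> oscillation_set F b p q"
      unfolding oscillation_set_def Q_def by blast
    then have "x \<in> oscillation_points F b" using p q unfolding oscillation_points_def by blast
    then show False using x by simp
  qed
  then have eq: "Limsup ?F ?Q = Liminf ?F ?Q"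
    using Liminf_le_Limsup[OF nontriv, of ?Q] by (rule antisym)
  have "(?Q \<longlongrightarrow> Liminf ?F ?Q) ?F" by (rule tendsto_Liminf[OF nontriv eq])
  moreover have "ereal (- (K * norm b)) \<le> Liminf ?F ?Q"
    using Qb by (intro Liminf_bounded) (auto simp: eventually_at abs_le_iff intro!: exI[of _ 1], force)
  moreover have "Liminf ?F ?Q \<le> ereal (K * norm b)"
    unfolding eq[symmetric]
    using Qb by (intro Limsup_bounded) (auto simp: eventually_at abs_le_iff intro!: exI[of _ 1])
  ultimately obtain D where "(?Q \<longlongrightarrow> ereal D) ?F"
    by (cases "Liminf ?F ?Q") auto
  then have "((\<lambda>h. (F (x + h *\<^sub>R b) - F x) / h) \<longlongrightarrow> D) ?F" by (simp add: Q_def)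
  then have "DERIV (\<lambda>h. F (x + h *\<^sub>R b)) 0 :> D"
    by (simp add: DERIV_def)
  then show ?thesis using real_differentiable_def by blast
qed

lemma increasing_if_locally_increasing:
  fixes \<phi> :: "real \<Rightarrow> real"
  assumes cd: "c \<le> d" and cont: "continuous_on {c..d} \<phi>"
    and loc: "\<And>x. c \<le> x \<Longrightarrow> x < d \<Longrightarrow> \<exists>y. x < y \<and> y \<le> d \<and> \<phi> x \<le> \<phi> y"
  shows "\<phi> c \<le> \<phi> d"
proof -
  let ?S = "{c..d} \<inter> \<phi> -` {\<phi> c..}"
  have "closed ?S" by (intro continuous_closed_preimage cont) auto
  then have "compact ?S" by (metis compact_Icc compact_Int_closed inf.idem inf_assoc inf_commute)
  moreover have "?S \<noteq> {}" using cd by auto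
  ultimately obtain x where x: "x \<in> ?S" "\<And>y. y \<in> ?S \<Longrightarrow> y \<le> x" using compact_attains_sup by metis
  have "x = d"
  proof (rule ccontr)
    assume "x \<noteq> d"
    then obtain y where "x < y" "y \<le> d" "\<phi> x \<le> \<phi> y" using loc[of x] x(1) by auto
    then have "y \<in> ?S" using x(1) by auto
    then show False using x(2) \<open>x < y\<close> by force
  qed
  then show ?thesis using x(1) by auto
qed

text \<open>The exceptional null set is covered by an open set \<open>U\<close> of measure at most \<open>e\<close>. Adding a multiple of
\<open>x \<mapsto> |U \<inter> {c..x}|\<close> to \<open>(L + e) x - f x\<close> costs only \<open>O(e)\<close> and makes the function locally
increasing to the right at the exceptional points too.\<close>

lemma lipschitz_increment_le_AE:
  fixes f :: "real \<Rightarrow> real"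
  assumes lip: "K-lipschitz_on UNIV f" and cd: "c \<le> d" and null: "N \<in> null_sets lborel"
    and der: "\<And>s. s \<in> {c..d} \<Longrightarrow> s \<notin> N \<Longrightarrow> \<exists>D. (f has_real_derivative D) (at s) \<and> D \<le> L"
  shows "f d - f c \<le> L * (d - c)"
proof -
  have K: "K \<ge> 0" by (rule lipschitz_on_nonneg[OF lip])
  have fK: "\<bar>f y - f x\<bar> \<le> K * \<bar>y - x\<bar>" for x y
    using lipschitz_onD[OF lip, of y x] by (simp add: dist_real_def)
  have N: "N \<in> sets borel" using null by auto
  have main: "f d - f c \<le> (L + e) * (d - c) + (K + \<bar>L\<bar>) * e" if e: "e > 0" for e
  proof -
    obtain U where U: "open U" "N \<subseteq> U" "emeasure lborel (U - N) < ennreal e"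
      using outer_regular_lborel[OF N e] by blast
    have "emeasure lborel U \<le> emeasure lborel (N \<union> (U - N))"
      using U N by (intro emeasure_mono) (auto simp: borel_open)
    also have "\<dots> \<le> emeasure lborel N + emeasure lborel (U - N)"
      using U N by (intro emeasure_subadditive) (auto simp: borel_open)
    finally have Ue: "emeasure lborel U < ennreal e"
      using U(3) null by (simp add: null_setsD1)
    define \<psi> where "\<psi> x = measure lborel (U \<inter> {c..x})" for x
    have fin: "emeasure lborel (U \<inter> A) < \<infinity>" for A
      using Ue by (metis Int_lower1 U(1) borel_open emeasure_mono ennreal_less_top infinity_ennreal_def le_less_trans less_trans sets_lborel)
    have add: "\<psi> y = \<psi> x + measure lborel (U \<inter> {x<..y})" if "c \<le> x" "x \<le> y" for x y
    proof -
      have eq: "U \<inter> {c..y} = (U \<inter> {c..x}) \<union> (U \<inter> {x<..y})" using that by auto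
      have "emeasure lborel (U \<inter> A) \<noteq> \<infinity>" for A using fin[of A] by simp
      then show ?thesis
        unfolding \<psi>_def eq using U(1) by (intro measure_Union) auto
    qed
    have mono: "\<psi> x \<le> \<psi> y" if "c \<le> x" "x \<le> y" for x y
      using add[OF that] by simp
    have lipU: "\<psi> y - \<psi> x \<le> y - x" if "c \<le> x" "x \<le> y" for x y
    proof -
      have "measure lborel (U \<inter> {x<..y}) \<le> measure lborel {x<..y}"
        using U(1) by (intro measure_mono_fmeasurable) (use that in \<open>auto simp: borel_open fmeasurable_def\<close>)
      then show ?thesis using add[OF that] that by simp
    qed
    have inU: "\<psi> y - \<psi> x = y - x" if "c \<le> x" "x \<le> y" "{x..y} \<subseteq> U" for x y
    proof -
      have "U \<inter> {x<..y} = {x<..y}" using that by auto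
      then show ?thesis using add[OF that(1,2)] that by simp
    qed
    have "1-lipschitz_on {c..d} \<psi>"
    proof (rule lipschitz_onI)
      fix x y assume "x \<in> {c..d}" "y \<in> {c..d}"
      then show "dist (\<psi> x) (\<psi> y) \<le> 1 * dist x y"
        using mono[of x y] mono[of y x] lipU[of x y] lipU[of y x]
        by (cases "x \<le> y") (auto simp: dist_real_def)
    qed simp
    then have cont\<psi>: "continuous_on {c..d} \<psi>" by (rule lipschitz_on_continuous_on)
    have contf: "continuous_on {c..d} f"
      using lipschitz_on_continuous_on[OF lip] continuous_on_subset by blast
    define \<phi> where "\<phi> x = (L + e) * x + (K + \<bar>L\<bar>) * \<psi> x - f x" for x
    have "\<phi> c \<le> \<phi> d"
    proof (rule increasing_if_locally_increasing[OF cd])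
      show "continuous_on {c..d} \<phi>"
        unfolding \<phi>_def by (intro continuous_intros cont\<psi> contf)
      fix x assume x: "c \<le> x" "x < d"
      show "\<exists>y. x < y \<and> y \<le> d \<and> \<phi> x \<le> \<phi> y"
      proof (cases "x \<in> N")
        case True
        then obtain \<delta> where \<delta>: "\<delta> > 0" "cball x \<delta> \<subseteq> U"
          using U open_contains_cball by blast
        define y where "y = min d (x + \<delta>)"
        have y: "x < y" "y \<le> d" using x \<delta> by (auto simp: y_def)
        have "{x..y} \<subseteq> U" using \<delta>(2) by (force simp: y_def dist_real_def)
        then have \<psi>eq: "\<psi> y - \<psi> x = y - x" using x y by (intro inU) auto
        have "f y - f x \<le> K * (y - x)" using fK[of y x] y by auto
        moreover have "\<phi> y - \<phi> x = (L + e) * (y - x) + (K + \<bar>L\<bar>) * (\<psi> y - \<psi> x) - (f y - f x)"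
          by (simp add: \<phi>_def algebra_simps)
        then have "\<phi> y - \<phi> x = (L + e + \<bar>L\<bar>) * (y - x) + K * (y - x) - (f y - f x)"
          unfolding \<psi>eq by (simp only: distrib_right)
        moreover have "0 \<le> (L + e + \<bar>L\<bar>) * (y - x)" using e y by (intro mult_nonneg_nonneg) auto
        ultimately have "\<phi> x \<le> \<phi> y" by linarith
        then show ?thesis using y by blast
      next
        case False
        then obtain D where D: "(f has_real_derivative D) (at x)" "D \<le> L" using der[of x] x by auto
        then have "((\<lambda>y. (f y - f x) / (y - x)) \<longlongrightarrow> D) (at x)"
          by (simp add: has_field_derivative_iff)
        then have "\<forall>\<^sub>F y in at x. (f y - f x) / (y - x) < L + e"
          using D(2) e by (intro order_tendstoD(2)) auto
        then obtain \<delta> where \<delta>: "\<delta> > 0" "\<And>y. y \<noteq> x \<Longrightarrow> dist y x < \<delta> \<Longrightarrow> (f y - f x) / (y - x) < L + e"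
          unfolding eventually_at by auto
        define y where "y = min d (x + \<delta> / 2)"
        have y: "x < y" "y \<le> d" "dist y x < \<delta>" using x \<delta> by (auto simp: y_def dist_real_def)
        have "(f y - f x) / (y - x) < L + e" using \<delta>(2)[of y] y by auto
        then have "f y - f x \<le> (L + e) * (y - x)"
          using y by (simp add: divide_less_eq)
        moreover have "(K + \<bar>L\<bar>) * \<psi> x \<le> (K + \<bar>L\<bar>) * \<psi> y"
          using mono[of x y] x y K by (intro mult_left_mono) auto
        ultimately have "\<phi> x \<le> \<phi> y" by (simp add: \<phi>_def algebra_simps)
        then show ?thesis using y by blast
      qed
    qed
    moreover have "0 \<le> (K + \<bar>L\<bar>) * \<psi> c" using K by (simp add: \<psi>_def)
    moreover have \<psi>d: "\<psi> d \<le> e"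
    proof -
      have "emeasure lborel (U \<inter> {c..d}) \<le> ennreal e"
        using emeasure_mono[of "U \<inter> {c..d}" U lborel] U(1) Ue by (auto simp: borel_open)
      then show ?thesis
        unfolding \<psi>_def measure_def using e by (simp add: enn2real_leI)
    qed
    ultimately have "f d - f c \<le> (L + e) * (d - c) + (K + \<bar>L\<bar>) * \<psi> d"
      unfolding \<phi>_def right_diff_distrib[of "L + e"] by linarith
    also have "\<dots> \<le> (L + e) * (d - c) + (K + \<bar>L\<bar>) * e"
      using K \<psi>d by (intro add_left_mono mult_left_mono) auto
    finally show ?thesis .
  qed
  show ?thesis
  proof (rule field_le_epsilon)
    fix \<epsilon> :: real assume \<epsilon>: "\<epsilon> > 0"
    define B where "B = d - c + K + \<bar>L\<bar> + 1"
    have B: "B > 0" using cd K by (simp add: B_def)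
    have "f d - f c \<le> (L + \<epsilon> / B) * (d - c) + (K + \<bar>L\<bar>) * (\<epsilon> / B)"
      using \<epsilon> B by (intro main) auto
    also have "\<dots> = L * (d - c) + (\<epsilon> / B) * (d - c + K + \<bar>L\<bar>)"
    proof -
      have "(L + t) * (d - c) + (K + \<bar>L\<bar>) * t = L * (d - c) + t * (d - c + K + \<bar>L\<bar>)" for t
        by (simp add: algebra_simps)
      then show ?thesis .
    qed
    also have "\<dots> \<le> L * (d - c) + (\<epsilon> / B) * B"
      using \<epsilon> B by (intro add_left_mono mult_left_mono) (auto simp: B_def)
    finally show "f d - f c \<le> L * (d - c) + \<epsilon>" using B by simp
  qed
qed

text \<open>The bound on the derivative is available only where all partial derivatives exist. Almost every line parallel to \<open>b0\<close> meets the
complement of this set in a null set of the line, so the estimate holds on lines arbitrarily close to the given one.\<close>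

lemma lipschitz_increment_bound_by_partials:
  fixes F :: "'a::euclidean_space \<Rightarrow> real"
  assumes lip: "K-lipschitz_on UNIV F" and W: "open W" and b0: "b0 \<in> Basis"
    and der: "\<And>x. x \<in> W \<Longrightarrow> (\<And>b. b \<in> Basis \<Longrightarrow> (\<lambda>h. F (x + h *\<^sub>R b)) differentiable (at 0)) \<Longrightarrow>
       \<bar>vector_derivative (\<lambda>h. F (x + h *\<^sub>R b0)) (at 0)\<bar> \<le> L"
    and seg: "\<And>s. s \<in> {0..h} \<Longrightarrow> x + s *\<^sub>R b0 \<in> W" and h: "h \<ge> 0"
  shows "\<bar>F (x + h *\<^sub>R b0) - F x\<bar> \<le> L * h"
proof (rule field_le_epsilon)
  fix \<epsilon> :: real assume \<epsilon>: "\<epsilon> > 0"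
  have K: "K \<ge> 0" by (rule lipschitz_on_nonneg[OF lip])
  have "compact ((\<lambda>s. x + s *\<^sub>R b0) ` {0..h})"
    by (intro compact_continuous_image continuous_intros) auto
  moreover have "(\<lambda>s. x + s *\<^sub>R b0) ` {0..h} \<subseteq> W" using seg by auto
  ultimately obtain \<delta> where \<delta>: "\<delta> > 0" "(\<Union>y\<in>(\<lambda>s. x + s *\<^sub>R b0) ` {0..h}. ball y \<delta>) \<subseteq> W"
    using compact_subset_open_imp_ball_epsilon_subset[OF _ W] by blast
  define \<eta> where "\<eta> = min \<delta> (\<epsilon> / (2 * (K + 1)))"
  have \<eta>: "\<eta> > 0" using \<delta> \<epsilon> K by (simp add: \<eta>_def)
  define N where "N = (\<Union>b\<in>Basis. oscillation_points F b)"
  have "N \<in> null_sets lborel"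
    unfolding N_def by (intro null_sets_UN' oscillation_points_null[OF lip] countable_finite) auto
  then have "AE y in lborel. AE s in lborel. s \<in> {0..h} \<longrightarrow> y + s *\<^sub>R b0 \<notin> N"
    by (rule AE_null_on_lines)
  then obtain N0 where N0: "{y. \<not> (AE s in lborel. s \<in> {0..h} \<longrightarrow> y + s *\<^sub>R b0 \<notin> N)} \<subseteq> N0" "N0 \<in> null_sets lborel"
    unfolding eventually_ae_filter[of _ "lborel :: 'a measure"] by auto
  have "\<not> ball x \<eta> \<subseteq> N0"
  proof
    assume "ball x \<eta> \<subseteq> N0"
    moreover have "negligible N0"
      using N0(2) by (simp add: negligible_iff_null_sets null_sets_completionI)
    ultimately have "negligible (ball x \<eta>)" by (rule negligible_subset[rotated])
    then show False using open_not_negligible[of "ball x \<eta>"] \<eta> by auto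
  qed
  then obtain y where "y \<in> ball x \<eta>" and y2: "y \<notin> N0" by blast
  then have y: "dist x y < \<eta>" by simp
  have AEy: "AE s in lborel. s \<in> {0..h} \<longrightarrow> y + s *\<^sub>R b0 \<notin> N"
    using N0(1) y2 by blast
  obtain M where M: "{s. \<not> (s \<in> {0..h} \<longrightarrow> y + s *\<^sub>R b0 \<notin> N)} \<subseteq> M" "M \<in> null_sets lborel"
    using AEy unfolding eventually_ae_filter by auto
  define f where "f s = F (y + s *\<^sub>R b0)" for s
  have lipf: "K-lipschitz_on UNIV f"
  proof (rule lipschitz_onI[OF _ K])
    fix s t :: real
    have "dist (f s) (f t) \<le> K * dist (y + s *\<^sub>R b0) (y + t *\<^sub>R b0)"
      unfolding f_def by (rule lipschitz_onD[OF lip]) auto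
    also have "dist (y + s *\<^sub>R b0) (y + t *\<^sub>R b0) = dist s t"
      using b0 by (simp add: dist_norm flip: scaleR_diff_left)
    finally show "dist (f s) (f t) \<le> K * dist s t" .
  qed
  have derf: "\<exists>D. (f has_real_derivative D) (at s) \<and> \<bar>D\<bar> \<le> L" if s: "s \<in> {0..h}" "s \<notin> M" for s
  proof -
    let ?z = "y + s *\<^sub>R b0"
    have "?z \<notin> N" using M(1) s by auto
    then have diff: "(\<lambda>h. F (?z + h *\<^sub>R b)) differentiable (at 0)" if "b \<in> Basis" for b
      using that differentiable_off_oscillation_points[OF lip, of ?z b] by (auto simp: N_def)
    have "dist (x + s *\<^sub>R b0) ?z < \<delta>" using y by (simp add: \<eta>_def dist_norm)
    then have "?z \<in> ball (x + s *\<^sub>R b0) \<delta>" by simp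
    then have "?z \<in> W" using \<delta>(2) s(1) by blast
    then have le: "\<bar>vector_derivative (\<lambda>h. F (?z + h *\<^sub>R b0)) (at 0)\<bar> \<le> L"
      using diff by (rule der)
    have "((\<lambda>h. F (?z + h *\<^sub>R b0)) has_real_derivative vector_derivative (\<lambda>h. F (?z + h *\<^sub>R b0)) (at 0)) (at 0)"
      using diff[OF b0] by (simp add: has_real_derivative_iff_has_vector_derivative vector_derivative_works)
    moreover have "(\<lambda>h. F (?z + h *\<^sub>R b0)) = (\<lambda>h. f (h + s))"
      by (simp add: f_def scaleR_left_distrib add_ac)
    ultimately have "((\<lambda>h. f (h + s)) has_real_derivative vector_derivative (\<lambda>h. F (?z + h *\<^sub>R b0)) (at 0)) (at 0)"
      by simp
    then have "(f has_real_derivative vector_derivative (\<lambda>h. F (?z + h *\<^sub>R b0)) (at 0)) (at s)"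
      using DERIV_shift[of f _ 0 s] by simp
    then show ?thesis using le by blast
  qed
  have "f h - f 0 \<le> L * (h - 0)"
    using derf by (intro lipschitz_increment_le_AE[OF lipf h M(2)]) force
  moreover have "(\<lambda>s. - f s) h - (\<lambda>s. - f s) 0 \<le> L * (h - 0)"
  proof (rule lipschitz_increment_le_AE[OF _ h M(2)])
    show "K-lipschitz_on UNIV (\<lambda>s. - f s)" using lipf by (simp add: lipschitz_on_def dist_minus)
    show "\<exists>D. ((\<lambda>s. - f s) has_real_derivative D) (at s) \<and> D \<le> L" if s: "s \<in> {0..h}" "s \<notin> M" for s
    proof -
      obtain D where "(f has_real_derivative D) (at s)" "\<bar>D\<bar> \<le> L" using derf[OF s] by blast
      then show ?thesis by (intro exI[of _ "- D"]) (auto intro: DERIV_minus)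
    qed
  qed
  ultimately have "\<bar>f h - f 0\<bar> \<le> L * h" by auto
  moreover have "\<bar>F (x + h *\<^sub>R b0) - f h\<bar> \<le> K * \<eta>"
  proof -
    have "\<bar>F (x + h *\<^sub>R b0) - f h\<bar> \<le> K * dist (x + h *\<^sub>R b0) (y + h *\<^sub>R b0)"
      using lipschitz_onD[OF lip, of "x + h *\<^sub>R b0" "y + h *\<^sub>R b0"] by (simp add: f_def dist_real_def)
    also have "\<dots> \<le> K * \<eta>" using K y by (intro mult_left_mono) (auto simp: dist_norm)
    finally show ?thesis .
  qed
  moreover have "\<bar>F x - f 0\<bar> \<le> K * \<eta>"
  proof -
    have "\<bar>F x - f 0\<bar> \<le> K * dist x y"
      using lipschitz_onD[OF lip, of x y] by (simp add: f_def dist_real_def)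
    also have "\<dots> \<le> K * \<eta>" using K y by (intro mult_left_mono) auto
    finally show ?thesis .
  qed
  moreover have "K * \<eta> \<le> \<epsilon> / 2"
  proof -
    have "K * \<eta> \<le> (K + 1) * (\<epsilon> / (2 * (K + 1)))"
      using K \<eta> by (intro mult_mono) (auto simp: \<eta>_def)
    also have "\<dots> = \<epsilon> / 2" using K by (simp add: field_simps)
    finally show ?thesis .
  qed
  ultimately show "\<bar>F (x + h *\<^sub>R b0) - F x\<bar> \<le> L * h + \<epsilon>" by linarith
qed

section \<open>Continuous partial derivatives\<close>

text \<open>The increment is telescoped over the coordinates; the mean value theorem applies to each step.\<close>

lemma has_derivative_if_continuous_partials:
  fixes f :: "real ^ 'n \<Rightarrow> real"
  assumes S: "open S" and x: "x \<in> S"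
    and der: "\<And>i y. y \<in> S \<Longrightarrow> ((\<lambda>h. f (y + h *\<^sub>R axis i 1)) has_real_derivative g i y) (at 0)"
    and cont: "\<And>i. continuous_on S (g i)"
  shows "(f has_derivative (\<lambda>h. \<Sum>i\<in>UNIV. g i x * h $ i)) (at x)"
proof -
  have bl: "bounded_linear (\<lambda>h :: real ^ 'n. \<Sum>i\<in>UNIV. g i x * h $ i)"
    by (intro bounded_linear_sum bounded_linear_const_mult bounded_linear_vec_nth)
  have "\<exists>d>0. \<forall>y. norm (y - x) < d \<longrightarrow> norm (f y - f x - (\<Sum>i\<in>UNIV. g i x * (y - x) $ i)) \<le> e * norm (y - x)"
    if e: "e > 0" for e
  proof -
    define \<epsilon> where "\<epsilon> = e / CARD('n)"
    have \<epsilon>: "\<epsilon> > 0" using e by (simp add: \<epsilon>_def)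
    have "\<forall>i. \<exists>d>0. \<forall>y. dist y x < d \<longrightarrow> dist (g i y) (g i x) < \<epsilon>"
      using cont x S \<epsilon> by (simp add: continuous_on_eq_continuous_at continuous_at_eps_delta)
    then obtain \<delta>1 where \<delta>1: "\<And>i. \<delta>1 i > 0" "\<And>i y. dist y x < \<delta>1 i \<Longrightarrow> dist (g i y) (g i x) < \<epsilon>"
      by metis
    obtain \<delta>2 where \<delta>2: "\<delta>2 > 0" "ball x \<delta>2 \<subseteq> S" using S x open_contains_ball by blast
    define d where "d = min \<delta>2 (Min (range \<delta>1))"
    have d: "d > 0" using \<delta>1 \<delta>2 by (auto simp: d_def)
    have dS: "y \<in> S" if "dist y x < d" for y using \<delta>2(2) that by (auto simp: d_def dist_commute)
    have dg: "dist (g i y) (g i x) < \<epsilon>" if "dist y x < d" for i y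
    proof (rule \<delta>1(2))
      have "d \<le> \<delta>1 i" by (auto simp: d_def intro: min.coboundedI2)
      then show "dist y x < \<delta>1 i" using that by linarith
    qed
    have "norm (f y - f x - (\<Sum>i\<in>UNIV. g i x * (y - x) $ i)) \<le> e * norm (y - x)" if y: "norm (y - x) < d" for y
    proof -
      define h where "h = y - x"
      define hJ where "hJ J = (\<Sum>i\<in>J. h $ i *\<^sub>R axis i (1::real))" for J :: "'n set"
      have hJ_nth: "hJ J $ i = (if i \<in> J then h $ i else 0)" for J i
        by (simp add: hJ_def axis_def if_distrib[of "\<lambda>a. _ * a"] cong: if_cong)
      have "\<bar>f (x + hJ J) - f x - (\<Sum>i\<in>J. g i x * h $ i)\<bar> \<le> \<epsilon> * (\<Sum>i\<in>J. \<bar>h $ i\<bar>)" if "finite J" for J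
        using that
      proof (induction J rule: finite_induct)
        case empty
        then show ?case by (simp add: hJ_def)
      next
        case (insert i J)
        let ?z = "\<lambda>s. x + hJ J + s *\<^sub>R axis i 1"
        have z: "dist (?z (t * h $ i)) x < d" if t: "0 \<le> t" "t \<le> 1" for t
        proof -
          have "norm (hJ J + (t * h $ i) *\<^sub>R axis i 1) \<le> norm h"
          proof (rule norm_le_componentwise_cart)
            fix m
            show "norm ((hJ J + (t * h $ i) *\<^sub>R axis i 1) $ m) \<le> norm (h $ m)"
              using insert.hyps(2) t by (auto simp: hJ_nth axis_def abs_mult mult_left_le_one_le)
          qed
          then show ?thesis using y by (simp add: dist_norm h_def add.assoc)
        qed
        define \<phi> where "\<phi> t = f (?z (t * h $ i))" for t
        have der\<phi>: "(\<phi> has_real_derivative g i (?z (t * h $ i)) * h $ i) (at t)" if t: "0 \<le> t" "t \<le> 1" for t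
        proof -
          have "((\<lambda>s. f (?z (t * h $ i) + s *\<^sub>R axis i 1)) has_real_derivative g i (?z (t * h $ i))) (at ((t - t) * h $ i))"
            using der[OF dS[OF z[OF t]]] by simp
          then have "((\<lambda>s. f (?z (t * h $ i) + ((s - t) * h $ i) *\<^sub>R axis i 1)) has_real_derivative g i (?z (t * h $ i)) * h $ i) (at t)"
            by (rule DERIV_chain2) (auto intro!: derivative_eq_intros)
          moreover have "(\<lambda>s. f (?z (t * h $ i) + ((s - t) * h $ i) *\<^sub>R axis i 1)) = \<phi>"
            by (simp add: \<phi>_def fun_eq_iff algebra_simps)
          ultimately show ?thesis by simp
        qed
        obtain t where t: "0 < t" "t < 1" "\<phi> 1 - \<phi> 0 = (1 - 0) * (g i (?z (t * h $ i)) * h $ i)"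
          using MVT2[of 0 1 \<phi> "\<lambda>t. g i (?z (t * h $ i)) * h $ i"] der\<phi> by auto
        have ins: "x + hJ (insert i J) = ?z (1 * h $ i)"
          using insert.hyps by (simp add: hJ_def add_ac)
        have "f (x + hJ (insert i J)) - f (x + hJ J) = g i (?z (t * h $ i)) * h $ i"
          using t(3) unfolding ins by (simp add: \<phi>_def)
        then have "\<bar>f (x + hJ (insert i J)) - f (x + hJ J) - g i x * h $ i\<bar> = \<bar>g i (?z (t * h $ i)) - g i x\<bar> * \<bar>h $ i\<bar>"
          by (simp add: left_diff_distrib flip: abs_mult)
        also have "\<dots> \<le> \<epsilon> * \<bar>h $ i\<bar>"
          using dg[OF z[of t], of i] t by (intro mult_right_mono) (auto simp: dist_real_def)
        finally show ?case
          using insert.IH insert.hyps by (simp add: distrib_left)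
      qed
      from this[of UNIV] have "\<bar>f (x + hJ UNIV) - f x - (\<Sum>i\<in>UNIV. g i x * h $ i)\<bar> \<le> \<epsilon> * (\<Sum>i\<in>UNIV. \<bar>h $ i\<bar>)"
        by simp
      also have "\<dots> \<le> \<epsilon> * (\<Sum>i\<in>(UNIV :: 'n set). norm h)"
        using \<epsilon> by (intro mult_left_mono sum_mono component_le_norm_cart) auto
      also have "\<dots> = e * norm h" by (simp add: \<epsilon>_def)
      also have "x + hJ UNIV = y" by (simp add: vec_eq_iff hJ_nth h_def)
      finally show ?thesis by (simp add: h_def)
    qed
    then show ?thesis using d by blast
  qed
  then show ?thesis using bl by (simp add: has_derivative_at_alt)
qed

text \<open>Schwarz's theorem at a corner. The rectangle extends to one side only, since at \<open>t = 0\<close> derivatives in \<open>t\<close> are left derivatives.\<close>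

lemma mixed_derivatives_commute:
  fixes f fa fb fab fba :: "real \<Rightarrow> real \<Rightarrow> real"
  assumes \<delta>: "\<delta> > 0"
    and da: "\<And>a b. a \<in> {0..\<delta>} \<Longrightarrow> b \<in> {-\<delta>..0} \<Longrightarrow> ((\<lambda>a. f a b) has_real_derivative fa a b) (at a within {0..\<delta>})"
    and db: "\<And>a b. a \<in> {0..\<delta>} \<Longrightarrow> b \<in> {-\<delta>..0} \<Longrightarrow> (f a has_real_derivative fb a b) (at b within {-\<delta>..0})"
    and dab: "\<And>a b. a \<in> {0..\<delta>} \<Longrightarrow> b \<in> {-\<delta>..0} \<Longrightarrow> (fa a has_real_derivative fab a b) (at b within {-\<delta>..0})"
    and dba: "\<And>a b. a \<in> {0..\<delta>} \<Longrightarrow> b \<in> {-\<delta>..0} \<Longrightarrow> ((\<lambda>a. fb a b) has_real_derivative fba a b) (at a within {0..\<delta>})"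
    and cab: "continuous_on ({0..\<delta>} \<times> {-\<delta>..0}) (\<lambda>(a, b). fab a b)"
    and cba: "continuous_on ({0..\<delta>} \<times> {-\<delta>..0}) (\<lambda>(a, b). fba a b)"
  shows "fab 0 0 = fba 0 0"
proof -
  have mvt: "\<exists>\<xi>. a < \<xi> \<and> \<xi> < b \<and> \<phi> b - \<phi> a = \<phi>' \<xi> * (b - a)"
    if "a < b" "\<And>s. a \<le> s \<Longrightarrow> s \<le> b \<Longrightarrow> (\<phi> has_real_derivative \<phi>' s) (at s within {a..b})"
    for a b :: real and \<phi> \<phi>'
    using mvt_simple[of a b \<phi> "\<lambda>s h. \<phi>' s * h"] that
    by (auto simp: has_field_derivative_def mult_commute_abs)
  have "\<bar>fab 0 0 - fba 0 0\<bar> \<le> 0 + e" if e: "e > 0" for e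
  proof -
    let ?R = "{0..\<delta>} \<times> {-\<delta>..0}"
    have "(0, 0) \<in> ?R" using \<delta> by auto
    then obtain d1 d2 where d1: "d1 > 0" "\<And>p. p \<in> ?R \<Longrightarrow> dist p (0, 0) < d1 \<Longrightarrow> dist (case p of (a, b) \<Rightarrow> fab a b) (fab 0 0) < e / 2"
      and d2: "d2 > 0" "\<And>p. p \<in> ?R \<Longrightarrow> dist p (0, 0) < d2 \<Longrightarrow> dist (case p of (a, b) \<Rightarrow> fba a b) (fba 0 0) < e / 2"
      using cab cba e unfolding continuous_on_iff
      by (metis (no_types, lifting) case_prod_conv half_gt_zero_iff)
    define h where "h = min \<delta> (min (d1 / 3) (d2 / 3))"
    have h: "h > 0" "h \<le> \<delta>" using d1 d2 \<delta> by (auto simp: h_def)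
    have near: "dist (a, b) (0, 0 :: real) < min d1 d2" if "0 \<le> a" "a \<le> h" "-h \<le> b" "b \<le> 0" for a b :: real
    proof -
      have "dist (a, b) (0, 0 :: real) \<le> dist a 0 + dist b 0"
        by (simp add: dist_Pair_Pair dist_real_def sqrt_sum_squares_le_sum_abs)
      also have "\<dots> \<le> h + h" using that by (simp add: dist_real_def)
      also have "\<dots> < min d1 d2" using d1(1) d2(1) by (auto simp: h_def min_def)
      finally show ?thesis .
    qed
    have sub: "{0..h} \<subseteq> {0..\<delta>}" "{-h..0} \<subseteq> {-\<delta>..0}" using h by auto
    define \<Delta> where "\<Delta> = f h 0 - f h (-h) - (f 0 0 - f 0 (-h))"
    obtain \<xi> where \<xi>: "0 < \<xi>" "\<xi> < h" "\<Delta> = (fa \<xi> 0 - fa \<xi> (-h)) * h"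
    proof -
      have "((\<lambda>a. f a 0 - f a (-h)) has_real_derivative fa s 0 - fa s (-h)) (at s within {0..h})"
        if "0 \<le> s" "s \<le> h" for s
        using that h sub by (intro DERIV_diff DERIV_subset[OF da]) auto
      from mvt[OF h(1) this] show ?thesis using that unfolding \<Delta>_def by auto
    qed
    obtain \<eta> where \<eta>: "-h < \<eta>" "\<eta> < 0" "fa \<xi> 0 - fa \<xi> (-h) = fab \<xi> \<eta> * h"
    proof -
      have "(fa \<xi> has_real_derivative fab \<xi> s) (at s within {-h..0})" if "-h \<le> s" "s \<le> 0" for s
        using that h sub \<xi> by (intro DERIV_subset[OF dab]) auto
      from mvt[OF _ this] show ?thesis using that h(1) by auto
    qed
    obtain \<eta>' where \<eta>': "-h < \<eta>'" "\<eta>' < 0" "\<Delta> = (fb h \<eta>' - fb 0 \<eta>') * h"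
    proof -
      have "((\<lambda>b. f h b - f 0 b) has_real_derivative fb h s - fb 0 s) (at s within {-h..0})"
        if "-h \<le> s" "s \<le> 0" for s
        using that h sub by (intro DERIV_diff DERIV_subset[OF db]) auto
      from mvt[OF _ this] show ?thesis using that h(1) unfolding \<Delta>_def by auto
    qed
    obtain \<xi>' where \<xi>': "0 < \<xi>'" "\<xi>' < h" "fb h \<eta>' - fb 0 \<eta>' = fba \<xi>' \<eta>' * h"
    proof -
      have "((\<lambda>a. fb a \<eta>') has_real_derivative fba s \<eta>') (at s within {0..h})" if "0 \<le> s" "s \<le> h" for s
        using that h sub \<eta>' by (intro DERIV_subset[OF dba]) auto
      from mvt[OF h(1) this] show ?thesis using that by auto
    qed
    have "\<Delta> = fab \<xi> \<eta> * h * h" unfolding \<xi>(3) \<eta>(3) ..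
    moreover have "\<Delta> = fba \<xi>' \<eta>' * h * h" unfolding \<eta>'(3) \<xi>'(3) ..
    ultimately have eq: "fab \<xi> \<eta> = fba \<xi>' \<eta>'" using h by simp
    have "dist (fab \<xi> \<eta>) (fab 0 0) < e / 2"
      using d1(2)[of "(\<xi>, \<eta>)"] near[of \<xi> \<eta>] \<xi> \<eta> h by auto
    moreover have "dist (fba \<xi>' \<eta>') (fba 0 0) < e / 2"
      using d2(2)[of "(\<xi>', \<eta>')"] near[of \<xi>' \<eta>'] \<xi>' \<eta>' h by auto
    ultimately show ?thesis unfolding eq dist_real_def by linarith
  qed
  then have "\<bar>fab 0 0 - fba 0 0\<bar> \<le> 0" by (rule field_le_epsilon)
  then show ?thesis by simp
qed

section \<open>Parabolic smoothness\<close>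

lemma parabolic_dom_neighbourhood:
  fixes x :: "real ^ 'n"
  assumes "(x, t) \<in> parabolic_dom r"
  obtains \<delta> where "\<delta> > 0" "\<And>y s. norm (y - x) < \<delta> \<Longrightarrow> \<bar>s - t\<bar> < \<delta> \<Longrightarrow> s \<le> 0 \<Longrightarrow> (y, s) \<in> parabolic_dom r"
proof -
  have "open {p :: (real ^ 'n) \<times> real. (norm (fst p))\<^sup>2 - r\<^sup>2 < snd p}"
    by (intro open_Collect_less continuous_intros)
  moreover have "(x, t) \<in> {p :: (real ^ 'n) \<times> real. (norm (fst p))\<^sup>2 - r\<^sup>2 < snd p}"
    using assms by (simp add: parabolic_dom_def)
  ultimately obtain e where e: "e > 0" "ball (x, t) e \<subseteq> {p. (norm (fst p))\<^sup>2 - r\<^sup>2 < snd p}"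
    using open_contains_ball by blast
  have "(y, s) \<in> parabolic_dom r" if "norm (y - x) < e / 2" "\<bar>s - t\<bar> < e / 2" "s \<le> 0" for y s
  proof -
    have "dist (x, t) (y, s) \<le> dist x y + dist t s"
      by (simp add: dist_Pair_Pair sqrt_sum_squares_le_sum)
    also have "\<dots> < e" using that by (simp add: dist_norm norm_minus_commute abs_minus_commute)
    finally have "(y, s) \<in> ball (x, t) e" by simp
    then show ?thesis using e(2) that(3) by (auto simp: parabolic_dom_def)
  qed
  then show ?thesis using that[of "e / 2"] e(1) by simp
qed

lemma C_par_DERIV_x:
  assumes C: "C_par m S u" and w: "par_weight w + 1 \<le> 2 * m" and p: "(x, t) \<in> S"
  shows "((\<lambda>h. foldr pd w u (x + h *\<^sub>R axis i 1, t)) has_real_derivative foldr pd (VarX i # w) u (x, t)) (at 0)"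
proof -
  have "par_weight (VarX i # w) \<le> 2 * m" using w by simp
  then have "pdiff (VarX i) (foldr pd w u) (x, t)"
    using C p unfolding C_par_def by blast
  then show ?thesis
    by (simp add: has_real_derivative_iff_has_vector_derivative vector_derivative_works[symmetric])
qed

lemma C_par_DERIV_t:
  assumes C: "C_par m S u" and w: "par_weight w + 2 \<le> 2 * m" and p: "(x, t) \<in> S"
  shows "((\<lambda>s. foldr pd w u (x, s)) has_real_derivative foldr pd (VarT # w) u (x, t)) (at t within {..0})"
proof -
  have "par_weight (VarT # w) \<le> 2 * m" using w by simp
  then have "pdiff VarT (foldr pd w u) (x, t)"
    using C p unfolding C_par_def by blast
  then show ?thesis
    by (simp add: has_real_derivative_iff_has_vector_derivative vector_derivative_works[symmetric])
qed

lemma C_par_continuous: "C_par m S u \<Longrightarrow> par_weight w \<le> 2 * m \<Longrightarrow> continuous_on S (foldr pd w u)"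
  by (simp add: C_par_def)

lemma open_parabolic_slice: "open {y :: real ^ 'n. (y, t) \<in> parabolic_dom r}"
proof -
  have "{y :: real ^ 'n. (y, t) \<in> parabolic_dom r} = (if t \<le> 0 then {y. (norm y)\<^sup>2 - r\<^sup>2 < t} else {})"
    by (auto simp: parabolic_dom_def)
  moreover have "open {y :: real ^ 'n. (norm y)\<^sup>2 - r\<^sup>2 < t}"
    by (intro open_Collect_less continuous_intros)
  ultimately show ?thesis by simp
qed

lemma C_par_has_derivative_x:
  fixes u :: "(real ^ 'n) \<times> real \<Rightarrow> real"
  assumes C: "C_par m (parabolic_dom r) u" and w: "par_weight w + 1 \<le> 2 * m" and p: "(x, t) \<in> parabolic_dom r"
  shows "((\<lambda>y. foldr pd w u (y, t)) has_derivative (\<lambda>h. \<Sum>i\<in>UNIV. foldr pd (VarX i # w) u (x, t) * h $ i)) (at x)"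
proof (rule has_derivative_if_continuous_partials[OF open_parabolic_slice])
  show "x \<in> {y. (y, t) \<in> parabolic_dom r}" using p by simp
  show "((\<lambda>h. foldr pd w u (y + h *\<^sub>R axis i 1, t)) has_real_derivative foldr pd (VarX i # w) u (y, t)) (at 0)"
    if "y \<in> {y. (y, t) \<in> parabolic_dom r}" for i y
    using that by (intro C_par_DERIV_x[OF C w]) simp
  show "continuous_on {y. (y, t) \<in> parabolic_dom r} (\<lambda>y. foldr pd (VarX i # w) u (y, t))" for i
    by (rule continuous_on_compose2[OF C_par_continuous[OF C, of "VarX i # w"]])
       (use w in \<open>auto intro!: continuous_intros\<close>)
qed

lemma C_par_DERIV_direction:
  fixes u :: "(real ^ 'n) \<times> real \<Rightarrow> real"
  assumes C: "C_par m (parabolic_dom r) u" and w: "par_weight w + 1 \<le> 2 * m"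
    and p: "(x + s *\<^sub>R v, t) \<in> parabolic_dom r"
  shows "((\<lambda>s. foldr pd w u (x + s *\<^sub>R v, t)) has_real_derivative
     (\<Sum>i\<in>UNIV. foldr pd (VarX i # w) u (x + s *\<^sub>R v, t) * v $ i)) (at s)"
proof -
  have "((\<lambda>s. x + s *\<^sub>R v) has_derivative (\<lambda>h. h *\<^sub>R v)) (at s)"
    by (auto intro!: derivative_eq_intros)
  from has_derivative_compose[OF this C_par_has_derivative_x[OF C w p]]
  have "((\<lambda>s. foldr pd w u (x + s *\<^sub>R v, t)) has_derivative
      (\<lambda>h. \<Sum>i\<in>UNIV. foldr pd (VarX i # w) u (x + s *\<^sub>R v, t) * (h *\<^sub>R v) $ i)) (at s)" .
  moreover have "(\<Sum>i\<in>UNIV. G i * (h *\<^sub>R v) $ i) = (\<Sum>i\<in>UNIV. G i * v $ i) * h" for G h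
    by (simp only: sum_distrib_right) (simp add: mult_ac)
  ultimately show ?thesis
    unfolding has_field_derivative_def by (simp only:)
qed

lemma C_par_commute_xx:
  fixes u :: "(real ^ 'n) \<times> real \<Rightarrow> real"
  assumes C: "C_par m (parabolic_dom r) u" and w: "par_weight w + 2 \<le> 2 * m" and p: "(x, t) \<in> parabolic_dom r"
  shows "foldr pd (VarX i # VarX j # w) u (x, t) = foldr pd (VarX j # VarX i # w) u (x, t)"
proof -
  obtain \<delta> where \<delta>: "\<delta> > 0" "\<And>y s. norm (y - x) < \<delta> \<Longrightarrow> \<bar>s - t\<bar> < \<delta> \<Longrightarrow> s \<le> 0 \<Longrightarrow> (y, s) \<in> parabolic_dom r"
    using parabolic_dom_neighbourhood[OF p] by blast
  define z where "z a b = x + a *\<^sub>R axis i (1::real) + b *\<^sub>R axis j 1" for a b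
  let ?\<delta> = "\<delta> / 3"
  have t: "t \<le> 0" using p by (simp add: parabolic_dom_def)
  have z: "(z a b, t) \<in> parabolic_dom r" if "a \<in> {0..?\<delta>}" "b \<in> {-?\<delta>..0}" for a b
  proof (rule \<delta>(2))
    have "norm (z a b - x) \<le> norm (a *\<^sub>R axis i (1::real)) + norm (b *\<^sub>R axis j (1::real))"
      using norm_triangle_ineq[of "a *\<^sub>R axis i (1::real)" "b *\<^sub>R axis j (1::real)"]
      unfolding z_def by (simp add: add.assoc del: norm_scaleR)
    also have "\<dots> < \<delta>" using that \<delta>(1) by (simp add: norm_axis_1)
    finally show "norm (z a b - x) < \<delta>" .
  qed (use \<delta> t in auto)
  have da: "((\<lambda>a. foldr pd w' u (z a b, t)) has_real_derivative foldr pd (VarX i # w') u (z a b, t)) (at a within A)"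
    if "a \<in> {0..?\<delta>}" "b \<in> {-?\<delta>..0}" "par_weight w' + 1 \<le> 2 * m" for a b w' A
  proof -
    have "(x + b *\<^sub>R axis j 1 + a *\<^sub>R axis i 1, t) \<in> parabolic_dom r"
      using z[OF that(1,2)] by (simp add: z_def add_ac)
    from C_par_DERIV_direction[OF C that(3) this]
    have "((\<lambda>a. foldr pd w' u (z a b, t)) has_real_derivative (\<Sum>l\<in>UNIV. foldr pd (VarX l # w') u (z a b, t) * axis i 1 $ l)) (at a)"
      by (simp add: z_def add_ac)
    then show ?thesis
      by (auto simp: axis_def if_distrib[of "\<lambda>a. _ * a"] cong: if_cong intro: has_field_derivative_at_within)
  qed
  have db: "((\<lambda>b. foldr pd w' u (z a b, t)) has_real_derivative foldr pd (VarX j # w') u (z a b, t)) (at b within A)"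
    if "a \<in> {0..?\<delta>}" "b \<in> {-?\<delta>..0}" "par_weight w' + 1 \<le> 2 * m" for a b w' A
  proof -
    have "(x + a *\<^sub>R axis i 1 + b *\<^sub>R axis j 1, t) \<in> parabolic_dom r"
      using z[OF that(1,2)] by (simp add: z_def add_ac)
    from C_par_DERIV_direction[OF C that(3) this]
    have "((\<lambda>b. foldr pd w' u (z a b, t)) has_real_derivative (\<Sum>l\<in>UNIV. foldr pd (VarX l # w') u (z a b, t) * axis j 1 $ l)) (at b)"
      by (simp add: z_def add_ac)
    then show ?thesis
      by (auto simp: axis_def if_distrib[of "\<lambda>a. _ * a"] cong: if_cong intro: has_field_derivative_at_within)
  qed
  have cont: "continuous_on ({0..?\<delta>} \<times> {-?\<delta>..0}) (\<lambda>(a, b). foldr pd w' u (z a b, t))"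
    if "par_weight w' \<le> 2 * m" for w'
    unfolding split_beta
    by (rule continuous_on_compose2[OF C_par_continuous[OF C that]])
       (use z in \<open>auto simp: z_def intro!: continuous_intros\<close>)
  have "foldr pd (VarX j # VarX i # w) u (z 0 0, t) = foldr pd (VarX i # VarX j # w) u (z 0 0, t)"
    by (rule mixed_derivatives_commute[where \<delta> = ?\<delta> and f = "\<lambda>a b. foldr pd w u (z a b, t)"
          and fa = "\<lambda>a b. foldr pd (VarX i # w) u (z a b, t)" and fb = "\<lambda>a b. foldr pd (VarX j # w) u (z a b, t)"])
       (use \<delta> w in \<open>auto intro!: da db cont simp del: foldr.simps\<close>)
  then show ?thesis by (simp add: z_def)
qed

lemma C_par_commute_xt:
  fixes u :: "(real ^ 'n) \<times> real \<Rightarrow> real"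
  assumes C: "C_par m (parabolic_dom r) u" and w: "par_weight w + 3 \<le> 2 * m" and p: "(x, t) \<in> parabolic_dom r"
  shows "foldr pd (VarX i # VarT # w) u (x, t) = foldr pd (VarT # VarX i # w) u (x, t)"
proof -
  obtain \<delta> where \<delta>: "\<delta> > 0" "\<And>y s. norm (y - x) < \<delta> \<Longrightarrow> \<bar>s - t\<bar> < \<delta> \<Longrightarrow> s \<le> 0 \<Longrightarrow> (y, s) \<in> parabolic_dom r"
    using parabolic_dom_neighbourhood[OF p] by blast
  define z where "z a = x + a *\<^sub>R axis i (1::real)" for a
  let ?\<delta> = "\<delta> / 3"
  have t: "t \<le> 0" using p by (simp add: parabolic_dom_def)
  have z: "(z a, t + b) \<in> parabolic_dom r" if "a \<in> {0..?\<delta>}" "b \<in> {-?\<delta>..0}" for a b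
    using that \<delta> t by (intro \<delta>(2)) (auto simp: z_def norm_axis_1)
  have da: "((\<lambda>a. foldr pd w' u (z a, t + b)) has_real_derivative foldr pd (VarX i # w') u (z a, t + b)) (at a within A)"
    if "a \<in> {0..?\<delta>}" "b \<in> {-?\<delta>..0}" "par_weight w' + 1 \<le> 2 * m" for a b w' A
  proof -
    have "(x + a *\<^sub>R axis i 1, t + b) \<in> parabolic_dom r"
      using z[OF that(1,2)] by (simp add: z_def)
    from C_par_DERIV_direction[OF C that(3) this]
    have "((\<lambda>a. foldr pd w' u (z a, t + b)) has_real_derivative (\<Sum>l\<in>UNIV. foldr pd (VarX l # w') u (z a, t + b) * axis i 1 $ l)) (at a)"
      by (simp add: z_def)
    then show ?thesis
      by (auto simp: axis_def if_distrib[of "\<lambda>a. _ * a"] cong: if_cong intro: has_field_derivative_at_within)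
  qed
  have db: "((\<lambda>b. foldr pd w' u (z a, t + b)) has_real_derivative foldr pd (VarT # w') u (z a, t + b)) (at b within {-?\<delta>..0})"
    if "a \<in> {0..?\<delta>}" "b \<in> {-?\<delta>..0}" "par_weight w' + 2 \<le> 2 * m" for a b w'
  proof -
    have "((\<lambda>s. foldr pd w' u (z a, s)) has_real_derivative foldr pd (VarT # w') u (z a, t + b)) (at (t + b) within {..0})"
      using z[OF that(1,2)] by (rule C_par_DERIV_t[OF C that(3)])
    then have "((\<lambda>s. foldr pd w' u (z a, s)) has_real_derivative foldr pd (VarT # w') u (z a, t + b)) (at (t + b) within (+) t ` {-?\<delta>..0})"
      by (rule DERIV_subset) (use t in auto)
    moreover have "((+) t has_real_derivative 1) (at b within {-?\<delta>..0})"
      by (auto intro!: derivative_eq_intros)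
    ultimately have "((\<lambda>s. foldr pd w' u (z a, s)) \<circ> (+) t has_real_derivative
        foldr pd (VarT # w') u (z a, t + b) * 1) (at b within {-?\<delta>..0})"
      by (rule DERIV_image_chain)
    then show ?thesis by (simp only: o_def mult_1_right)
  qed
  have cont: "continuous_on ({0..?\<delta>} \<times> {-?\<delta>..0}) (\<lambda>(a, b). foldr pd w' u (z a, t + b))"
    if "par_weight w' \<le> 2 * m" for w'
    unfolding split_beta
    by (rule continuous_on_compose2[OF C_par_continuous[OF C that]])
       (use z in \<open>auto simp: z_def intro!: continuous_intros\<close>)
  have "foldr pd (VarT # VarX i # w) u (z 0, t + 0) = foldr pd (VarX i # VarT # w) u (z 0, t + 0)"
    by (rule mixed_derivatives_commute[where \<delta> = ?\<delta> and f = "\<lambda>a b. foldr pd w u (z a, t + b)"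
          and fa = "\<lambda>a b. foldr pd (VarX i # w) u (z a, t + b)" and fb = "\<lambda>a b. foldr pd (VarT # w) u (z a, t + b)"])
       (use \<delta> w in \<open>auto intro!: da db cont simp del: foldr.simps\<close>)
  then show ?thesis by (simp add: z_def)
qed

lemma sum_inner_orthonormal_square:
  fixes v :: "'n \<Rightarrow> real ^ 'n"
  assumes orth: "\<And>i j. v i \<bullet> v j = (if i = j then 1 else 0)"
  shows "(\<Sum>i\<in>UNIV. (v i \<bullet> z)\<^sup>2) = (norm z)\<^sup>2"
proof -
  define V where "V = (\<chi> i. v i)"
  have VV: "V ** transpose V = mat 1"
    by (simp add: vec_eq_iff matrix_matrix_mult_def transpose_def V_def mat_def inner_vec_def flip: orth)
  then have "transpose V ** V = mat 1" by (simp add: matrix_left_right_inverse)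
  then have "orthogonal_matrix V" by (simp add: orthogonal_matrix)
  then have "norm (V *v z) = norm z"
    by (simp add: orthogonal_transformation_matrix orthogonal_transformation_norm)
  moreover have "(norm (V *v z))\<^sup>2 = (\<Sum>i\<in>UNIV. (v i \<bullet> z)\<^sup>2)"
    by (simp only: power2_norm_eq_inner) (simp add: inner_vec_def matrix_vector_mult_def V_def power2_eq_square)
  ultimately show ?thesis by simp
qed

lemma hess_x_symmetric:
  assumes C: "C_par 2 (parabolic_dom r) u" and p: "p \<in> parabolic_dom r"
  shows "transpose (hess_x u p) = hess_x u p"
proof -
  obtain x t where xt: "p = (x, t)" by (cases p)
  have "foldr pd [VarX i, VarX j] u p = foldr pd [VarX j, VarX i] u p" for i j
    using C_par_commute_xx[OF C, of "[]" x t i j] p unfolding xt by simp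
  then show ?thesis by (simp add: hess_x_def transpose_def vec_eq_iff xt del: pd.simps)
qed

lemma third_derivatives_symmetric:
  fixes u :: "(real ^ 'n) \<times> real \<Rightarrow> real"
  assumes C: "C_par 2 (parabolic_dom r) u" and p: "(x, t) \<in> parabolic_dom r"
  shows "foldr pd [VarX a, VarX b, VarX c] u (x, t) = foldr pd [VarX c, VarX a, VarX b] u (x, t)"
proof -
  define U where "U w = foldr pd w u" for w
  have w2: "par_weight [VarX b, VarX c] + 1 \<le> 2 * 2" "par_weight [VarX c, VarX b] + 1 \<le> 2 * 2" by auto
  obtain \<delta> where \<delta>: "\<delta> > 0" "\<And>y s. norm (y - x) < \<delta> \<Longrightarrow> \<bar>s - t\<bar> < \<delta> \<Longrightarrow> s \<le> 0 \<Longrightarrow> (y, s) \<in> parabolic_dom r"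
    using parabolic_dom_neighbourhood[OF p] by blast
  have t: "t \<le> 0" using p by (simp add: parabolic_dom_def)
  have near: "U [VarX b, VarX c] (x + h *\<^sub>R axis a 1, t) = U [VarX c, VarX b] (x + h *\<^sub>R axis a 1, t)"
    if "\<bar>h\<bar> < \<delta>" for h
    unfolding U_def
    by (rule C_par_commute_xx[OF C]) (use that \<delta> t in \<open>auto intro!: \<delta>(2) simp: norm_axis_1\<close>)
  have d1: "((\<lambda>h. U [VarX b, VarX c] (x + h *\<^sub>R axis a 1, t)) has_real_derivative U [VarX a, VarX b, VarX c] (x, t)) (at 0)"
    unfolding U_def by (rule C_par_DERIV_x[OF C w2(1) p])
  have d2: "((\<lambda>h. U [VarX c, VarX b] (x + h *\<^sub>R axis a 1, t)) has_real_derivative U [VarX a, VarX c, VarX b] (x, t)) (at 0)"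
    unfolding U_def by (rule C_par_DERIV_x[OF C w2(2) p])
  have "\<forall>\<^sub>F h in nhds 0. U [VarX b, VarX c] (x + h *\<^sub>R axis a 1, t) = U [VarX c, VarX b] (x + h *\<^sub>R axis a 1, t)"
    unfolding eventually_nhds_metric using \<delta>(1) near by (intro exI[of _ \<delta>]) (auto simp: dist_real_def)
  with d1 have "((\<lambda>h. U [VarX c, VarX b] (x + h *\<^sub>R axis a 1, t)) has_real_derivative U [VarX a, VarX b, VarX c] (x, t)) (at 0)"
    by (subst (asm) DERIV_cong_ev) auto
  from DERIV_unique[OF this d2] have "U [VarX a, VarX b, VarX c] (x, t) = U [VarX a, VarX c, VarX b] (x, t)" .
  also have "\<dots> = U [VarX c, VarX a, VarX b] (x, t)"
    unfolding U_def by (rule C_par_commute_xx[OF C _ p]) auto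
  finally show ?thesis by (simp only: U_def)
qed

section \<open>The maximum principle\<close>

lemma second_derivative_at_local_max:
  fixes H H' :: "real \<Rightarrow> real"
  assumes \<delta>: "\<delta> > 0"
    and der: "\<And>s. \<bar>s\<bar> < \<delta> \<Longrightarrow> (H has_real_derivative H' s) (at s)"
    and der2: "(H' has_real_derivative H2) (at 0)"
    and max: "\<And>s. \<bar>s\<bar> < \<delta> \<Longrightarrow> H s \<le> H 0"
  shows "H' 0 = 0" and "H2 \<le> 0"
proof -
  show H0: "H' 0 = 0"
    using der[of 0] max \<delta> by (intro DERIV_local_max[of H "H' 0" 0 \<delta>]) auto
  show "H2 \<le> 0"
  proof (rule ccontr)
    assume "\<not> H2 \<le> 0"
    then obtain d where d: "d > 0" "\<And>h. 0 < h \<Longrightarrow> h < d \<Longrightarrow> H' 0 < H' (0 + h)"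
      using DERIV_pos_inc_right[OF der2] by auto
    define h where "h = min d \<delta> / 2"
    have h: "0 < h" "h < d" "h < \<delta>" using d \<delta> by (auto simp: h_def)
    obtain z where z: "0 < z" "z < h" "H h - H 0 = (h - 0) * H' z"
      using MVT2[of 0 h H H'] der h by auto
    have "H' z > 0" using d(2)[of z] z h H0 by auto
    then have "H h - H 0 > 0" using z h by simp
    then show False using max[of h] h by simp
  qed
qed

lemma derivative_at_max_from_left:
  fixes h :: "real \<Rightarrow> real"
  assumes der: "(h has_real_derivative D) (at t within {..0})" and t: "t \<le> 0" and \<delta>: "\<delta> > 0"
    and max: "\<And>s. t - \<delta> < s \<Longrightarrow> s \<le> t \<Longrightarrow> h s \<le> h t"
  shows "D \<ge> 0"
proof (rule tendsto_lowerbound)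
  have "(h has_real_derivative D) (at t within {..<t})"
    by (rule DERIV_subset[OF der]) (use t in auto)
  then show "((\<lambda>s. (h s - h t) / (s - t)) \<longlongrightarrow> D) (at_left t)"
    by (simp add: has_field_derivative_iff)
  show "\<forall>\<^sub>F s in at_left t. 0 \<le> (h s - h t) / (s - t)"
    unfolding eventually_at using \<delta> max
    by (intro exI[of _ \<delta>]) (auto simp: dist_real_def intro!: divide_nonpos_nonpos)
  show "at_left t \<noteq> bot" by simp
qed

text \<open>The derivatives of \<open>ln a - ln y / 2 + ln w\<close>; it is used with \<open>a = \<rho>\<close> and \<open>w = D\<^sub>e u\<close> on lines through the maximum point.\<close>

lemma log_quotient_at_local_max:
  fixes a a' y y' w w' :: "real \<Rightarrow> real"
  assumes \<delta>: "\<delta> > 0"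
    and da: "\<And>s. \<bar>s\<bar> < \<delta> \<Longrightarrow> (a has_real_derivative a' s) (at s)" "(a' has_real_derivative a2) (at 0)"
    and dy: "\<And>s. \<bar>s\<bar> < \<delta> \<Longrightarrow> (y has_real_derivative y' s) (at s)" "(y' has_real_derivative y2) (at 0)"
    and dw: "\<And>s. \<bar>s\<bar> < \<delta> \<Longrightarrow> (w has_real_derivative w' s) (at s)" "(w' has_real_derivative w2) (at 0)"
    and pos: "\<And>s. \<bar>s\<bar> < \<delta> \<Longrightarrow> a s > 0" "\<And>s. \<bar>s\<bar> < \<delta> \<Longrightarrow> y s > 0" "w 0 > 0"
    and max: "\<And>s. \<bar>s\<bar> < \<delta> \<Longrightarrow> a s * w s / sqrt (y s) \<le> a 0 * w 0 / sqrt (y 0)"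
  shows "a' 0 / a 0 - y' 0 / (2 * y 0) + w' 0 / w 0 = 0"
    and "a2 / a 0 - (a' 0 / a 0)\<^sup>2 - y2 / (2 * y 0) + (y' 0)\<^sup>2 / (2 * (y 0)\<^sup>2) + w2 / w 0 - (w' 0 / w 0)\<^sup>2 \<le> 0"
proof -
  have "isCont w 0" using dw(1)[of 0] \<delta> by (auto intro: DERIV_isCont)
  then have "\<forall>\<^sub>F s in nhds 0. w s > 0"
    using pos(3) by (simp add: isCont_def order_tendstoD(1) tendsto_at_iff_tendsto_nhds)
  then obtain \<delta>' where \<delta>': "\<delta>' > 0" "\<And>s. \<bar>s\<bar> < \<delta>' \<Longrightarrow> w s > 0"
    unfolding eventually_nhds_metric by (auto simp: dist_real_def)
  define \<epsilon> where "\<epsilon> = min \<delta> \<delta>'"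
  have \<epsilon>: "\<epsilon> > 0" using \<delta> \<delta>' by (simp add: \<epsilon>_def)
  have posw: "w s > 0" if "\<bar>s\<bar> < \<epsilon>" for s using \<delta>' that by (simp add: \<epsilon>_def)
  define H where "H s = ln (a s) - ln (y s) / 2 + ln (w s)" for s
  define H' where "H' s = a' s / a s - y' s / (2 * y s) + w' s / w s" for s
  have H_eq: "H s = ln (a s * w s / sqrt (y s))" if "\<bar>s\<bar> < \<epsilon>" for s
    using pos(1,2)[of s] posw[of s] that by (simp add: H_def \<epsilon>_def ln_mult ln_div ln_sqrt)
  have dH: "(H has_real_derivative H' s) (at s)" if s: "\<bar>s\<bar> < \<epsilon>" for s
  proof -
    have s': "\<bar>s\<bar> < \<delta>" using s by (simp add: \<epsilon>_def)
    show ?thesis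
      unfolding H_def H'_def using pos(1,2)[OF s'] posw[OF s]
      by (auto intro!: derivative_eq_intros da(1)[OF s'] dy(1)[OF s'] dw(1)[OF s'] simp: field_simps)
  qed
  let ?H2 = "a2 / a 0 - (a' 0 / a 0)\<^sup>2 - y2 / (2 * y 0) + (y' 0)\<^sup>2 / (2 * (y 0)\<^sup>2) + w2 / w 0 - (w' 0 / w 0)\<^sup>2"
  have d0: "(a has_real_derivative a' 0) (at 0)" "(y has_real_derivative y' 0) (at 0)" "(w has_real_derivative w' 0) (at 0)"
    using da(1) dy(1) dw(1) \<delta> by auto
  have p0: "a 0 > 0" "y 0 > 0" "w 0 > 0" using pos \<delta> by auto
  have "((\<lambda>s. a' s / a s - y' s / (2 * y s) + w' s / w s) has_real_derivative
      (a2 * a 0 - a' 0 * a' 0) / (a 0 * a 0) - (y2 * (2 * y 0) - y' 0 * (2 * y' 0)) / ((2 * y 0) * (2 * y 0))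
       + (w2 * w 0 - w' 0 * w' 0) / (w 0 * w 0)) (at 0)"
    using p0 by (intro DERIV_add DERIV_diff DERIV_divide da(2) dy(2) dw(2) d0 DERIV_cmult) auto
  also have "(a2 * a 0 - a' 0 * a' 0) / (a 0 * a 0) - (y2 * (2 * y 0) - y' 0 * (2 * y' 0)) / ((2 * y 0) * (2 * y 0))
       + (w2 * w 0 - w' 0 * w' 0) / (w 0 * w 0) = ?H2"
    using p0 by (simp add: diff_divide_distrib power2_eq_square)
  finally have dH': "(H' has_real_derivative ?H2) (at 0)"
    by (simp only: H'_def[abs_def])
  have "H s \<le> H 0" if "\<bar>s\<bar> < \<epsilon>" for s
    unfolding H_eq[OF that] H_eq[of 0, simplified, OF \<epsilon>]
    using max[of s] that pos(1,2)[of s] posw[of s] p0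
    by (subst ln_le_cancel_iff) (auto simp: \<epsilon>_def)
  from second_derivative_at_local_max[OF \<epsilon> dH dH' this]
  show "a' 0 / a 0 - y' 0 / (2 * y 0) + w' 0 / w 0 = 0" "?H2 \<le> 0"
    by (simp_all add: H'_def)
qed

lemma log_quotient_max_from_left:
  fixes a y w :: "real \<Rightarrow> real"
  assumes t: "t \<le> 0" and \<delta>: "\<delta> > 0"
    and d: "(a has_real_derivative a') (at t within {..0})" "(y has_real_derivative y') (at t within {..0})"
      "(w has_real_derivative w') (at t within {..0})"
    and pos: "\<And>s. t - \<delta> < s \<Longrightarrow> s \<le> t \<Longrightarrow> a s > 0" "\<And>s. t - \<delta> < s \<Longrightarrow> s \<le> t \<Longrightarrow> y s > 0" "w t > 0"
    and max: "\<And>s. t - \<delta> < s \<Longrightarrow> s \<le> t \<Longrightarrow> a s * w s / sqrt (y s) \<le> a t * w t / sqrt (y t)"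
  shows "a' / a t - y' / (2 * y t) + w' / w t \<ge> 0"
proof -
  have "continuous (at t within {..0}) w" by (rule DERIV_continuous[OF d(3)])
  then have "\<forall>\<^sub>F s in at t within {..0}. w s > 0"
    using pos(3) unfolding continuous_within by (rule order_tendstoD(1))
  then obtain \<delta>' where \<delta>': "\<delta>' > 0" "\<And>s. s \<le> 0 \<Longrightarrow> s \<noteq> t \<Longrightarrow> dist s t < \<delta>' \<Longrightarrow> w s > 0"
    unfolding eventually_at by auto
  define \<epsilon> where "\<epsilon> = min \<delta> \<delta>'"
  have \<epsilon>: "\<epsilon> > 0" using \<delta> \<delta>' by (simp add: \<epsilon>_def)
  have posw: "w s > 0" if "t - \<epsilon> < s" "s \<le> t" for s
    using \<delta>'(2)[of s] pos(3) that t by (cases "s = t") (auto simp: \<epsilon>_def dist_real_def)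
  define H where "H s = ln (a s) - ln (y s) / 2 + ln (w s)" for s
  have H_eq: "H s = ln (a s * w s / sqrt (y s))" if "t - \<epsilon> < s" "s \<le> t" for s
  proof -
    have "a s > 0" "y s > 0" "w s > 0"
      using pos(1,2)[of s] posw[of s] that by (auto simp: \<epsilon>_def)
    then show ?thesis by (simp add: H_def ln_mult ln_div ln_sqrt)
  qed
  have p0: "a t > 0" "y t > 0" "w t > 0" using pos \<delta> by auto
  have "(H has_real_derivative a' / a t - y' / (2 * y t) + w' / w t) (at t within {..0})"
    unfolding H_def using p0
    by (auto intro!: derivative_eq_intros d simp: field_simps)
  then show ?thesis
  proof (rule derivative_at_max_from_left[OF _ t \<epsilon>])
    fix s assume s: "t - \<epsilon> < s" "s \<le> t"
    show "H s \<le> H t"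
      unfolding H_eq[OF s] using H_eq[of t] \<epsilon> max[of s] s pos(1,2)[of s] posw[of s] p0
      by (simp only:) (subst ln_le_cancel_iff; auto simp: \<epsilon>_def)
  qed
qed

text \<open>The algebra at the maximum point, in an eigenbasis of the Hessian: \<open>l\<close> are the eigenvalues, \<open>e\<close> the coordinates of the direction of the
gradient, \<open>d\<rho>\<close> the derivatives of \<open>\<rho>\<close>, \<open>q\<close> the second derivatives of \<open>D\<^sub>e u\<close>, \<open>p = |Du|\<close>, and \<open>uet\<close> the time derivative of
\<open>D\<^sub>e u\<close>. The factor \<open>17 * n\<close> satisfies \<open>288 n \<le> (17 n)\<^sup>2\<close>, which lets the term with \<open>p\<^sup>2\<close> absorb all derivatives
of \<open>\<rho>\<close>.\<close>

lemma maximum_point_inequality: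
  fixes l e d\<rho> q :: "'n::finite \<Rightarrow> real" and \<rho> y p :: real and k :: nat
  defines "f \<equiv> \<lambda>i. esym (UNIV - {i}) (k - 1) l" and "n \<equiv> real CARD('n)"
  assumes k: "1 \<le> k" and l: "(\<chi> i. l i) \<in> closure (Gam k)"
    and e: "(\<Sum>i\<in>UNIV. (e i)\<^sup>2) = 1" and pos: "\<rho> > 0" "y > 0" "p > 0" "r > 0" "m1 > 0"
    and \<rho>: "\<rho> \<le> r\<^sup>2" and d\<rho>: "(\<Sum>i\<in>UNIV. (d\<rho> i)\<^sup>2) \<le> 4 * r\<^sup>2"
    and first: "\<And>i. d\<rho> i / \<rho> + p * e i / (2 * y) + l i * e i / p = 0"
    and second: "\<And>i. - 2 / \<rho> - (d\<rho> i / \<rho>)\<^sup>2 + l i / (2 * y) + (p * e i)\<^sup>2 / (2 * y\<^sup>2) + q i / p - (l i * e i / p)\<^sup>2 \<le> 0"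
    and time: "1 / \<rho> + ut / (2 * y) + uet / p \<ge> 0"
    and eq: "- uet * esym UNIV k l - ut * (\<Sum>i\<in>UNIV. f i * q i) = R"
    and ut: "- ut \<ge> m1"
    and large: "p * \<rho> \<ge> 17 * n * r * y"
  shows "m1 * (p\<^sup>2 / (4 * n * y)) ^ (k - 1) * (p\<^sup>2 / (16 * y\<^sup>2)) \<le> esym UNIV k l / \<rho> - R / p"
proof -
  let ?a = "p\<^sup>2 / (4 * y)" and ?\<sigma> = "esym UNIV k l" and ?s = "esym UNIV (k - 1) l"
  let ?F = "\<Sum>i\<in>UNIV. (e i)\<^sup>2 * f i" and ?T = "\<Sum>i\<in>UNIV. f i"
  have n: "n \<ge> 1" by (simp add: n_def Suc_leI)
  have f: "f i \<ge> 0" for i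
    using closure_Gam_esym_remove_nonneg[OF l, of "k - 1" i] k by (simp add: f_def)
  have \<sigma>: "?\<sigma> \<ge> 0" using closure_Gam_esym_nonneg[OF l, of k] by simp
  have s0: "?s \<ge> 0" using closure_Gam_esym_nonneg[OF l, of "k - 1"] by simp
  \<comment> \<open>The first-order condition, contracted with \<open>e\<close>, gives the quadratic form of the Hessian in the direction of the gradient.\<close>
  have e\<rho>: "\<bar>\<Sum>i\<in>UNIV. d\<rho> i * e i\<bar> \<le> 2 * r"
  proof -
    have "(\<Sum>i\<in>UNIV. d\<rho> i * e i)\<^sup>2 \<le> (\<Sum>i\<in>UNIV. (d\<rho> i)\<^sup>2) * (\<Sum>i\<in>UNIV. (e i)\<^sup>2)"
      by (rule Cauchy_Schwarz_ineq_sum)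
    also have "\<dots> \<le> (2 * r)\<^sup>2" using d\<rho> e by (simp add: power_mult_distrib)
    finally show ?thesis using pos by (subst (asm) power2_le_iff_abs_le) auto
  qed
  have Ae: "(\<Sum>i\<in>UNIV. (e i)\<^sup>2 * l i) \<le> - ?a"
  proof -
    have "(e i)\<^sup>2 * l i = - (p / \<rho>) * (d\<rho> i * e i) - p\<^sup>2 / (2 * y) * (e i)\<^sup>2" for i
    proof -
      have "e i * p * (d\<rho> i / \<rho> + p * e i / (2 * y) + l i * e i / p) = 0" using first[of i] by simp
      then show ?thesis using pos by (simp add: algebra_simps power2_eq_square)
    qed
    then have "(\<Sum>i\<in>UNIV. (e i)\<^sup>2 * l i) = - (p / \<rho>) * (\<Sum>i\<in>UNIV. d\<rho> i * e i) - p\<^sup>2 / (2 * y) * (\<Sum>i\<in>UNIV. (e i)\<^sup>2)"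
      by (simp only: sum_subtractf sum_distrib_left)
    also have "\<dots> \<le> (p / \<rho>) * (2 * r) - p\<^sup>2 / (2 * y)"
    proof -
      have "(p / \<rho>) * (- (\<Sum>i\<in>UNIV. d\<rho> i * e i)) \<le> (p / \<rho>) * (2 * r)"
        using e\<rho> pos by (intro mult_left_mono) auto
      then show ?thesis using e by simp
    qed
    also have "(p / \<rho>) * (2 * r) \<le> ?a"
    proof -
      have "8 * 1 * r * y \<le> 17 * n * r * y" using n pos by (intro mult_right_mono mult_mono) auto
      then have "8 * r * y \<le> p * \<rho>" using large by simp
      then have "p * (8 * r * y) \<le> p * (p * \<rho>)" using pos by (intro mult_left_mono) auto
      then show ?thesis using pos by (simp add: field_simps power2_eq_square)
    qed
    finally show ?thesis by (simp add: field_simps)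
  qed
  have a: "?a > 0" using pos by simp
  have "\<exists>i. l i \<le> - ?a"
  proof (rule ccontr)
    assume "\<not> ?thesis"
    then have lt: "- ?a < l i" for i by (simp add: not_le)
    have "(\<Sum>i\<in>UNIV. (e i)\<^sup>2 * (- ?a)) < (\<Sum>i\<in>UNIV. (e i)\<^sup>2 * l i)"
    proof -
      have "\<exists>i. e i \<noteq> 0"
      proof (rule ccontr)
        assume "\<not> ?thesis"
        then show False using e by simp
      qed
      then obtain i where i: "(e i)\<^sup>2 > 0" by auto
      show ?thesis
      proof (rule sum_strict_mono_ex1)
        show "\<forall>x\<in>UNIV. (e x)\<^sup>2 * (- ?a) \<le> (e x)\<^sup>2 * l x"
          by (intro ballI mult_left_mono less_imp_le lt zero_le_power2)
        show "\<exists>x\<in>UNIV. (e x)\<^sup>2 * (- ?a) < (e x)\<^sup>2 * l x"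
          using i lt by (intro bexI[of _ i] mult_strict_left_mono) auto
      qed simp
    qed
    moreover have "(\<Sum>i\<in>UNIV. (e i)\<^sup>2 * (- ?a)) = - ?a"
      unfolding sum_distrib_right[symmetric] e by simp
    ultimately show False using Ae by linarith
  qed
  then obtain i0 where "l i0 \<le> - ?a" by blast
  then have s: "(?a / n) ^ (k - 1) \<le> ?s"
    using closure_Gam_esym_lower_bound[OF l k less_imp_le[OF a], of i0] by (simp add: n_def)
  have Fs: "?s \<le> ?F"
  proof -
    have "(\<Sum>i\<in>UNIV. (e i)\<^sup>2 * l i) \<le> 0" using Ae a by linarith
    then show ?thesis
      unfolding f_def using k e
      by (intro weighted_esym_remove_ge)
         (use closure_Gam_esym_remove_nonneg[OF l] closure_Gam_esym_nonneg[OF l] in auto)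
  qed
  have T: "?T \<le> n * ?F"
  proof -
    have "?T = (n - real (k - 1)) * ?s" by (simp add: f_def n_def sum_esym_remove)
    also have "\<dots> \<le> n * ?s" using s0 by (intro mult_right_mono) auto
    also have "\<dots> \<le> n * ?F" using Fs n by (intro mult_left_mono) auto
    finally show ?thesis .
  qed
  have F0: "?F \<ge> 0" using f by (intro sum_nonneg) auto
  have fl: "(\<Sum>i\<in>UNIV. f i * l i) \<ge> 0"
    using sum_times_esym_remove[of l "k - 1"] \<sigma> k by (simp add: f_def mult.commute)
  have d\<rho>1: "(d\<rho> i)\<^sup>2 \<le> 4 * r\<^sup>2" for i
    using member_le_sum[of i UNIV "\<lambda>i. (d\<rho> i)\<^sup>2"] d\<rho> by simp
  \<comment> \<open>The first-order condition expresses the negative term \<open>(l i * e i / p)\<^sup>2\<close> by \<open>A\<close> and \<open>B\<close>. Of the positive term \<open>2 B\<^sup>2\<close>,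
    a quarter survives Young's inequality, because \<open>y\<close> enters the auxiliary function with an exponent of modulus less than \<open>1\<close>.\<close>
  have qi: "q i / p \<le> 18 * r\<^sup>2 / \<rho>\<^sup>2 - l i / (2 * y) - p\<^sup>2 / (8 * y\<^sup>2) * (e i)\<^sup>2" for i
  proof -
    define A where "A = d\<rho> i / \<rho>"
    define B where "B = p * e i / (2 * y)"
    have "l i * e i / p = - (A + B)" using first[of i] by (simp add: A_def B_def)
    then have "(l i * e i / p)\<^sup>2 = (A + B)\<^sup>2" by (simp only: power2_minus)
    also have "\<dots> \<le> 3 / 2 * B\<^sup>2 + 3 * A\<^sup>2"
      using zero_le_power2[of "B - 2 * A"] by (simp add: power2_eq_square algebra_simps)
    finally have "(l i * e i / p)\<^sup>2 \<le> 3 / 2 * B\<^sup>2 + 3 * A\<^sup>2" .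
    moreover have "(p * e i)\<^sup>2 / (2 * y\<^sup>2) = 2 * B\<^sup>2"
      using pos by (simp add: B_def power_divide power_mult_distrib)
    ultimately have "q i / p \<le> 2 / \<rho> + 4 * A\<^sup>2 - l i / (2 * y) - 1 / 2 * B\<^sup>2"
      using second[of i] unfolding A_def[symmetric] by linarith
    moreover have "2 / \<rho> \<le> 2 * r\<^sup>2 / \<rho>\<^sup>2"
      using pos \<rho> by (simp add: field_simps power2_eq_square)
    moreover have "4 * A\<^sup>2 \<le> 16 * r\<^sup>2 / \<rho>\<^sup>2"
      using d\<rho>1[of i] pos by (simp add: A_def power_divide divide_right_mono)
    moreover have "1 / 2 * B\<^sup>2 = p\<^sup>2 / (8 * y\<^sup>2) * (e i)\<^sup>2"
      by (simp add: B_def power_divide power_mult_distrib)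
    ultimately show ?thesis by (simp add: add_divide_distrib[symmetric])
  qed
  have "(\<Sum>i\<in>UNIV. f i * (q i / p)) \<le> (\<Sum>i\<in>UNIV. f i * (18 * r\<^sup>2 / \<rho>\<^sup>2 - l i / (2 * y) - p\<^sup>2 / (8 * y\<^sup>2) * (e i)\<^sup>2))"
    by (intro sum_mono mult_left_mono qi f)
  also have "\<dots> = 18 * r\<^sup>2 / \<rho>\<^sup>2 * ?T - 1 / (2 * y) * (\<Sum>i\<in>UNIV. f i * l i) - p\<^sup>2 / (8 * y\<^sup>2) * ?F"
    by (simp only: sum_subtractf right_diff_distrib sum_distrib_left) (simp add: mult_ac)
  also have "\<dots> \<le> 18 * r\<^sup>2 / \<rho>\<^sup>2 * (n * ?F) - p\<^sup>2 / (8 * y\<^sup>2) * ?F"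
  proof -
    have "18 * r\<^sup>2 / \<rho>\<^sup>2 * ?T \<le> 18 * r\<^sup>2 / \<rho>\<^sup>2 * (n * ?F)" by (intro mult_left_mono T) auto
    moreover have "0 \<le> 1 / (2 * y) * (\<Sum>i\<in>UNIV. f i * l i)" using fl pos by (intro mult_nonneg_nonneg) auto
    ultimately show ?thesis by linarith
  qed
  also have "18 * r\<^sup>2 / \<rho>\<^sup>2 * (n * ?F) \<le> p\<^sup>2 / (16 * y\<^sup>2) * ?F"
  proof -
    have "(17 * n * r * y)\<^sup>2 \<le> (p * \<rho>)\<^sup>2" using large n pos by (intro power_mono) auto
    moreover have "288 * n * (r * y)\<^sup>2 \<le> 289 * (n * n) * (r * y)\<^sup>2"
      using n by (intro mult_right_mono) (auto intro: order_trans[of _ "289 * (n * 1)"] mult_left_mono)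
    ultimately have "288 * n * (r * y)\<^sup>2 \<le> (p * \<rho>)\<^sup>2" by (simp add: power2_eq_square mult_ac)
    then have "18 * r\<^sup>2 / \<rho>\<^sup>2 * n \<le> p\<^sup>2 / (16 * y\<^sup>2)"
      using pos by (simp add: field_simps power_mult_distrib)
    then have "(18 * r\<^sup>2 / \<rho>\<^sup>2 * n) * ?F \<le> p\<^sup>2 / (16 * y\<^sup>2) * ?F" by (rule mult_right_mono[OF _ F0])
    then show ?thesis by (simp only: mult.assoc)
  qed
  finally have sumq: "(\<Sum>i\<in>UNIV. f i * (q i / p)) \<le> - (p\<^sup>2 / (16 * y\<^sup>2) * ?F)"
    by (simp add: field_simps)
  have ut0: "- ut > 0" using ut pos by linarith
  have "R / p - ?\<sigma> / \<rho> \<le> - ut * (\<Sum>i\<in>UNIV. f i * (q i / p))"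
  proof -
    have "- ut * (\<Sum>i\<in>UNIV. f i * (q i / p)) = R / p + ?\<sigma> * (uet / p)"
      using pos by (simp add: eq[symmetric] sum_divide_distrib[symmetric] diff_divide_distrib)
    moreover have "?\<sigma> * (- 1 / \<rho>) \<le> ?\<sigma> * (uet / p)"
    proof (rule mult_left_mono[OF _ \<sigma>])
      have "ut / (2 * y) \<le> 0" using ut0 pos by (intro divide_nonpos_pos) auto
      then show "- 1 / \<rho> \<le> uet / p" using time by simp
    qed
    ultimately show ?thesis by simp
  qed
  also have "\<dots> \<le> - ut * (- (p\<^sup>2 / (16 * y\<^sup>2) * ?F))"
    using ut0 by (intro mult_left_mono sumq) auto
  finally have "(- ut) * (p\<^sup>2 / (16 * y\<^sup>2) * ?F) \<le> ?\<sigma> / \<rho> - R / p" by simp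
  moreover have "m1 * (p\<^sup>2 / (4 * n * y)) ^ (k - 1) * (p\<^sup>2 / (16 * y\<^sup>2)) \<le> (- ut) * (p\<^sup>2 / (16 * y\<^sup>2) * ?F)"
  proof -
    have "(p\<^sup>2 / (4 * n * y)) ^ (k - 1) \<le> ?F" using s Fs by (simp add: mult_ac)
    then have "m1 * ((p\<^sup>2 / (16 * y\<^sup>2)) * (p\<^sup>2 / (4 * n * y)) ^ (k - 1)) \<le> (- ut) * ((p\<^sup>2 / (16 * y\<^sup>2)) * ?F)"
      using ut ut0 pos n by (intro mult_mono mult_left_mono) auto
    then show ?thesis by (simp only: mult_ac)
  qed
  ultimately show ?thesis by linarith
qed

text \<open>The differentiated equation. The third derivatives are reordered so that, for the eigenvector \<open>v i\<close>, the sum multiplied by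
\<open>esym (UNIV - {i}) (k - 1)\<close> is the second derivative in direction \<open>v i\<close> of the derivative of \<open>u\<close> in direction \<open>e\<close>.\<close>

lemma DERIV_operator_along_line:
  fixes u :: "(real ^ 'n) \<times> real \<Rightarrow> real" and e x :: "real ^ 'n" and v :: "'n \<Rightarrow> real ^ 'n"
  assumes C: "C_par 2 (parabolic_dom r) u" and k: "1 \<le> k" and p: "(x, t) \<in> parabolic_dom r" and e: "norm e = 1"
    and orth: "\<And>i j. v i \<bullet> v j = (if i = j then 1 else 0)"
    and eig: "\<And>i. hess_x u (x, t) *v v i = (eigenvalue_vec (hess_x u (x, t)) $ i) *\<^sub>R v i"
  shows "((\<lambda>s. - pd VarT u (x + s *\<^sub>R e, t) * sigma_k k (eigenvalue_vec (hess_x u (x + s *\<^sub>R e, t)))) has_real_derivative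
     - (\<Sum>j\<in>UNIV. e $ j * foldr pd [VarT, VarX j] u (x, t)) * sigma_k k (eigenvalue_vec (hess_x u (x, t)))
     - pd VarT u (x, t) * (\<Sum>i\<in>UNIV. esym (UNIV - {i}) (k - 1) (\<lambda>i. eigenvalue_vec (hess_x u (x, t)) $ i) *
         (\<Sum>j\<in>UNIV. e $ j * (\<Sum>a\<in>UNIV. (\<Sum>b\<in>UNIV. foldr pd [VarX b, VarX a, VarX j] u (x, t) * v i $ b) * v i $ a)))) (at 0)"
proof -
  define U where "U w = foldr pd w u" for w
  have Ut: "pd VarT u = U [VarT]" by (simp add: U_def)
  have hess: "hess_x u q $ i $ j = U [VarX i, VarX j] q" for q i j
    by (simp add: hess_x_def U_def)
  define H where "H = hess_x u (x, t)"
  define q where "q i = (\<Sum>j\<in>UNIV. e $ j * (\<Sum>a\<in>UNIV. (\<Sum>b\<in>UNIV. U [VarX b, VarX a, VarX j] (x, t) * v i $ b) * v i $ a))" for i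
  define uet where "uet = (\<Sum>j\<in>UNIV. e $ j * U [VarT, VarX j] (x, t))"
  obtain \<delta> where \<delta>: "\<delta> > 0" "\<And>z s. norm (z - x) < \<delta> \<Longrightarrow> \<bar>s - t\<bar> < \<delta> \<Longrightarrow> s \<le> 0 \<Longrightarrow> (z, s) \<in> parabolic_dom r"
    using parabolic_dom_neighbourhood[OF p] by blast
  have t: "t \<le> 0" using p by (simp add: parabolic_dom_def)
  have line: "(x + s *\<^sub>R e, t) \<in> parabolic_dom r" if "\<bar>s\<bar> < \<delta>" for s
    using that \<delta>(1) t e by (intro \<delta>(2)) auto
  have dU: "((\<lambda>s. U w (x + s *\<^sub>R e, t)) has_real_derivative
      (\<Sum>i\<in>UNIV. U (VarX i # w) (x + 0 *\<^sub>R e, t) * e $ i)) (at 0)" if "par_weight w \<le> 3" for w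
    unfolding U_def by (rule C_par_DERIV_direction[OF C]) (use that p in auto)
  define B where "B = (\<chi> i j. \<Sum>b\<in>UNIV. U [VarX b, VarX i, VarX j] (x, t) * e $ b)"
  have H0: "hess_x u (x + 0 *\<^sub>R e, t) = H" by (simp add: H_def)
  have d1: "((\<lambda>s. - U [VarT] (x + s *\<^sub>R e, t)) has_real_derivative
      - (\<Sum>j\<in>UNIV. U [VarX j, VarT] (x + 0 *\<^sub>R e, t) * e $ j)) (at 0)"
    by (intro DERIV_minus dU) simp
  have d2: "((\<lambda>s. sigma_k k (eigenvalue_vec (hess_x u (x + s *\<^sub>R e, t)))) has_real_derivative
    (\<Sum>i\<in>UNIV. esym (UNIV - {i}) (k - 1) (\<lambda>i. eigenvalue_vec (hess_x u (x + 0 *\<^sub>R e, t)) $ i) * (v i \<bullet> (B *v v i)))) (at 0)"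
  proof (rule DERIV_sigma_k_eigenvalue_vec[OF _ \<delta>(1) k _ orth])
    show "transpose (hess_x u (x + s *\<^sub>R e, t)) = hess_x u (x + s *\<^sub>R e, t)" if "\<bar>s\<bar> < \<delta>" for s
      by (rule hess_x_symmetric[OF C line[OF that]])
    show "((\<lambda>s. hess_x u (x + s *\<^sub>R e, t) $ i $ j) has_real_derivative B $ i $ j) (at 0)" for i j
      using dU[of "[VarX i, VarX j]"] by (simp add: hess B_def)
    show "hess_x u (x + 0 *\<^sub>R e, t) *v v i = eigenvalue_vec (hess_x u (x + 0 *\<^sub>R e, t)) $ i *\<^sub>R v i" for i
      unfolding H0 H_def by (rule eig)
  qed
  have vBv: "v i \<bullet> (B *v v i) = q i" for i
  proof -
    have sym3: "U [VarX b, VarX a, VarX j] (x, t) = U [VarX j, VarX b, VarX a] (x, t)" for a b j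
      unfolding U_def by (rule third_derivatives_symmetric[OF C p])
    have "q i = (\<Sum>j\<in>UNIV. \<Sum>a\<in>UNIV. \<Sum>b\<in>UNIV. e $ j * (U [VarX j, VarX b, VarX a] (x, t) * v i $ b * v i $ a))"
      by (simp only: q_def sym3 sum_distrib_left sum_distrib_right)
    also have "\<dots> = (\<Sum>b\<in>UNIV. \<Sum>a\<in>UNIV. \<Sum>j\<in>UNIV. e $ j * (U [VarX j, VarX b, VarX a] (x, t) * v i $ b * v i $ a))"
      by (subst sum.swap, subst (2) sum.swap, subst sum.swap, rule refl)
    also have "\<dots> = v i \<bullet> (B *v v i)"
      by (simp add: inner_vec_def matrix_vector_mult_def B_def sum_distrib_left sum_distrib_right mult_ac)
    finally show ?thesis by simp
  qed
  have uet': "(\<Sum>j\<in>UNIV. U [VarX j, VarT] (x + 0 *\<^sub>R e, t) * e $ j) = uet"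
  proof -
    have "U [VarX j, VarT] (x, t) = U [VarT, VarX j] (x, t)" for j
      unfolding U_def by (rule C_par_commute_xt[OF C _ p]) auto
    then show ?thesis by (simp add: uet_def mult.commute)
  qed
  have "((\<lambda>s. - pd VarT u (x + s *\<^sub>R e, t) * sigma_k k (eigenvalue_vec (hess_x u (x + s *\<^sub>R e, t)))) has_real_derivative
       - uet * sigma_k k (eigenvalue_vec (hess_x u (x + 0 *\<^sub>R e, t))) +
       (\<Sum>i\<in>UNIV. esym (UNIV - {i}) (k - 1) (\<lambda>i. eigenvalue_vec (hess_x u (x + 0 *\<^sub>R e, t)) $ i) * (v i \<bullet> (B *v v i)))
         * (- U [VarT] (x + 0 *\<^sub>R e, t))) (at 0)"
    using DERIV_mult[OF d1 d2] unfolding uet' Ut .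
  then show ?thesis
    unfolding vBv scaleR_zero_left add_0_right U_def[symmetric] Ut q_def[symmetric] uet_def[symmetric]
    by (simp add: mult.commute)
qed

text \<open>The direction \<open>e\<close> of the gradient at the maximum point is kept fixed: \<open>D\<^sub>e u \<le> |Du|\<close> everywhere with equality at this point, so the smooth
function with \<open>D\<^sub>e u\<close> in place of \<open>|Du|\<close> has its maximum there as well.\<close>

lemma inequality_at_maximum:
  fixes u :: "(real ^ 'n) \<times> real \<Rightarrow> real" and e x :: "real ^ 'n" and t r m1 M g R :: real
  defines "\<rho> \<equiv> r\<^sup>2 - (norm x)\<^sup>2 + t" and "y \<equiv> 2 * M - u (x, t)" and "n \<equiv> real CARD('n)"
  assumes k: "1 \<le> k" and pos: "r > 0" "m1 > 0" "M > 0" "g > 0"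
    and C: "C_par 2 (parabolic_dom r) u" and p: "(x, t) \<in> parabolic_dom r"
    and cl: "eigenvalue_vec (hess_x u (x, t)) \<in> closure (Gam k)"
    and ut: "- pd VarT u (x, t) \<ge> m1"
    and bound: "\<And>q. q \<in> parabolic_dom r \<Longrightarrow> \<bar>u q\<bar> \<le> M"
    and grad: "grad_x u (x, t) = g *\<^sub>R e" and e: "norm e = 1"
    and max: "\<And>z s. (z, s) \<in> parabolic_dom r \<Longrightarrow>
        (r\<^sup>2 - (norm z)\<^sup>2 + s) * (e \<bullet> grad_x u (z, s)) / sqrt (2 * M - u (z, s)) \<le> \<rho> * g / sqrt y"
    and eq: "((\<lambda>s. - pd VarT u (x + s *\<^sub>R e, t) * sigma_k k (eigenvalue_vec (hess_x u (x + s *\<^sub>R e, t))))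
        has_real_derivative R) (at 0)"
    and large: "g * \<rho> \<ge> 17 * n * r * y"
  shows "m1 * (g\<^sup>2 / (4 * n * y)) ^ (k - 1) * (g\<^sup>2 / (16 * y\<^sup>2))
      \<le> sigma_k k (eigenvalue_vec (hess_x u (x, t))) / \<rho> - R / g"
proof -
  let ?D = "parabolic_dom r :: ((real ^ 'n) \<times> real) set"
  define U where "U w = foldr pd w u" for w
  have U0: "U [] = u" by (simp add: U_def)
  have Ux: "pd (VarX i) u = U [VarX i]" for i by (simp add: U_def)
  have Ut: "pd VarT u = U [VarT]" by (simp add: U_def)
  define H where "H = hess_x u (x, t)"
  have hess: "hess_x u q $ i $ j = U [VarX i, VarX j] q" for q i j
    by (simp add: hess_x_def U_def)
  have grad_nth: "grad_x u q $ i = U [VarX i] q" for q i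
    by (simp add: grad_x_def U_def)
  have t: "t \<le> 0" using p by (simp add: parabolic_dom_def)
  have \<rho>: "0 < \<rho>" "\<rho> \<le> r\<^sup>2" using p order_trans[OF t zero_le_power2[of "norm x"]] by (auto simp: \<rho>_def parabolic_dom_def)
  have ypos: "2 * M - u q > 0" if "q \<in> ?D" for q using bound[OF that] pos by (simp add: abs_le_iff)
  have y: "y > 0" unfolding y_def using p by (rule ypos)
  obtain \<delta> where \<delta>: "\<delta> > 0" "\<And>z s. norm (z - x) < \<delta> \<Longrightarrow> \<bar>s - t\<bar> < \<delta> \<Longrightarrow> s \<le> 0 \<Longrightarrow> (z, s) \<in> ?D"
    using parabolic_dom_neighbourhood[OF p] by blast
  have line: "(x + s *\<^sub>R w, t) \<in> ?D" if "\<bar>s\<bar> < \<delta>" "norm w = 1" for s w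
    using that \<delta>(1) t by (intro \<delta>(2)) auto
  have dU: "((\<lambda>s. U w (x + s *\<^sub>R z, t)) has_real_derivative
      (\<Sum>i\<in>UNIV. U (VarX i # w) (x + s *\<^sub>R z, t) * z $ i)) (at s)"
    if "par_weight w \<le> 3" "\<bar>s\<bar> < \<delta>" "norm z = 1" for w s z
    unfolding U_def by (rule C_par_DERIV_direction[OF C _ line]) (use that in auto)
  have symH: "transpose H = H" unfolding H_def by (rule hess_x_symmetric[OF C p])
  obtain v :: "'n \<Rightarrow> real ^ 'n" where orth: "\<And>i j. v i \<bullet> v j = (if i = j then 1 else 0)"
    and eig: "\<And>i. H *v v i = (eigenvalue_vec H $ i) *\<^sub>R v i"
    using eigenvalue_vec_eigenbasis[OF symH] by blast
  have vn: "norm (v i) = 1" for i using orth[of i i] by (simp add: norm_eq_1)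
  define l where "l i = eigenvalue_vec H $ i" for i
  define ei where "ei i = v i \<bullet> e" for i
  define q where "q i = (\<Sum>j\<in>UNIV. e $ j * (\<Sum>a\<in>UNIV. (\<Sum>b\<in>UNIV. U [VarX b, VarX a, VarX j] (x, t) * v i $ b) * v i $ a))" for i
  define uet where "uet = (\<Sum>j\<in>UNIV. e $ j * U [VarT, VarX j] (x, t))"
  have grad_dir: "e \<bullet> grad_x u z = (\<Sum>j\<in>UNIV. e $ j * U [VarX j] z)" for z
    by (simp add: inner_vec_def grad_nth)
  have g0: "(\<Sum>j\<in>UNIV. e $ j * U [VarX j] (x, t)) = g"
    using e by (simp add: grad_dir[symmetric] grad norm_eq_1)
  have space: "- 2 * (x \<bullet> v i) / \<rho> + g * ei i / (2 * y) + l i * ei i / g = 0 \<and>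
      - 2 / \<rho> - (- 2 * (x \<bullet> v i) / \<rho>)\<^sup>2 + l i / (2 * y) + (g * ei i)\<^sup>2 / (2 * y\<^sup>2) + q i / g - (l i * ei i / g)\<^sup>2 \<le> 0" for i
  proof -
    let ?v = "v i"
    define a where "a s = r\<^sup>2 - (norm (x + s *\<^sub>R ?v))\<^sup>2 + t" for s
    define a' where "a' s = - 2 * (x \<bullet> ?v) - 2 * s" for s
    define Y where "Y s = 2 * M - u (x + s *\<^sub>R ?v, t)" for s
    define Y' where "Y' s = - (\<Sum>j\<in>UNIV. U [VarX j] (x + s *\<^sub>R ?v, t) * ?v $ j)" for s
    define w where "w s = (\<Sum>j\<in>UNIV. e $ j * U [VarX j] (x + s *\<^sub>R ?v, t))" for s
    define w' where "w' s = (\<Sum>j\<in>UNIV. e $ j * (\<Sum>a\<in>UNIV. U [VarX a, VarX j] (x + s *\<^sub>R ?v, t) * ?v $ a))" for s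
    have a_eq: "a = (\<lambda>s. r\<^sup>2 - ((norm x)\<^sup>2 + 2 * s * (x \<bullet> ?v) + s\<^sup>2) + t)"
    proof -
      have "(norm (x + s *\<^sub>R ?v))\<^sup>2 = (norm x)\<^sup>2 + 2 * s * (x \<bullet> ?v) + s\<^sup>2" for s
        unfolding power2_norm_eq_inner using orth[of i i]
        by (simp add: inner_add_left inner_add_right inner_commute[of ?v x] power2_eq_square distrib_left)
      then show ?thesis by (simp add: a_def fun_eq_iff)
    qed
    have da: "(a has_real_derivative a' s) (at s)" for s
      unfolding a_eq a'_def by (auto intro!: derivative_eq_intros)
    have da2: "(a' has_real_derivative -2) (at 0)"
      unfolding a'_def by (auto intro!: derivative_eq_intros)
    have dY: "(Y has_real_derivative Y' s) (at s)" if "\<bar>s\<bar> < \<delta>" for s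
      unfolding Y_def Y'_def
      using DERIV_diff[OF DERIV_const dU[of "[]" s ?v]] that vn by (simp add: U0)
    have dY2: "(Y' has_real_derivative - (\<Sum>j\<in>UNIV. (\<Sum>b\<in>UNIV. U [VarX b, VarX j] (x + 0 *\<^sub>R ?v, t) * ?v $ b) * ?v $ j)) (at 0)"
      unfolding Y'_def using \<delta> vn by (intro DERIV_minus DERIV_sum DERIV_cmult_right dU) auto
    have dw: "(w has_real_derivative w' s) (at s)" if "\<bar>s\<bar> < \<delta>" for s
      unfolding w_def w'_def using that vn by (intro DERIV_sum DERIV_cmult dU) auto
    have dw2: "(w' has_real_derivative (\<Sum>j\<in>UNIV. e $ j * (\<Sum>a\<in>UNIV. (\<Sum>b\<in>UNIV. U [VarX b, VarX a, VarX j] (x + 0 *\<^sub>R ?v, t) * ?v $ b) * ?v $ a))) (at 0)"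
      unfolding w'_def using \<delta> vn by (intro DERIV_sum DERIV_cmult DERIV_cmult_right dU) auto
    have apos: "a s > 0" if "\<bar>s\<bar> < \<delta>" for s
      using line[OF that vn, of i] by (simp add: a_def parabolic_dom_def)
    have Ypos: "Y s > 0" if "\<bar>s\<bar> < \<delta>" for s
      unfolding Y_def by (rule ypos[OF line[OF that vn]])
    have a0: "a 0 = \<rho>" and Y0: "Y 0 = y" and w0: "w 0 = g"
      by (simp_all add: a_def \<rho>_def Y_def y_def w_def g0)
    have mx: "a s * w s / sqrt (Y s) \<le> a 0 * w 0 / sqrt (Y 0)" if "\<bar>s\<bar> < \<delta>" for s
      unfolding a0 Y0 w0 using max[OF line[OF that vn, of i]]
      by (simp add: a_def w_def Y_def grad_dir)
    have w0pos: "w 0 > 0" using w0 pos by simp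
    note facts = log_quotient_at_local_max[OF \<delta>(1) da da2 dY dY2 dw dw2 apos Ypos w0pos mx]
    have Y'0: "Y' 0 = - (g * ei i)"
    proof -
      have "(\<Sum>j\<in>UNIV. U [VarX j] (x, t) * ?v $ j) = grad_x u (x, t) \<bullet> ?v"
        by (simp add: inner_vec_def grad_nth)
      then show ?thesis by (simp add: Y'_def grad ei_def inner_commute)
    qed
    have Y2: "(\<Sum>j\<in>UNIV. (\<Sum>b\<in>UNIV. U [VarX b, VarX j] (x, t) * ?v $ b) * ?v $ j) = l i"
    proof -
      have "(\<Sum>j\<in>UNIV. (\<Sum>b\<in>UNIV. U [VarX b, VarX j] (x, t) * ?v $ b) * ?v $ j)
          = (\<Sum>b\<in>UNIV. \<Sum>j\<in>UNIV. ?v $ b * (U [VarX b, VarX j] (x, t) * ?v $ j))"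
        unfolding sum_distrib_right by (subst sum.swap) (simp add: mult_ac)
      also have "\<dots> = ?v \<bullet> (H *v ?v)"
        by (simp add: inner_vec_def matrix_vector_mult_def H_def hess sum_distrib_left)
      finally show ?thesis by (simp add: eig l_def orth)
    qed
    have w'0: "w' 0 = l i * ei i"
    proof -
      have "(\<Sum>j\<in>UNIV. e $ j * (\<Sum>a\<in>UNIV. U [VarX a, VarX j] (x, t) * ?v $ a))
          = (\<Sum>a\<in>UNIV. \<Sum>j\<in>UNIV. ?v $ a * (U [VarX a, VarX j] (x, t) * e $ j))"
        unfolding sum_distrib_left by (subst sum.swap) (simp add: mult_ac)
      also have "\<dots> = ?v \<bullet> (H *v e)"
        by (simp add: inner_vec_def matrix_vector_mult_def H_def hess sum_distrib_left)
      also have "\<dots> = (H *v ?v) \<bullet> e" by (simp add: symmetric_matrix_inner[OF symH])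
      finally show ?thesis by (simp add: w'_def eig l_def ei_def)
    qed
    have a'0: "a' 0 = - 2 * (x \<bullet> ?v)" by (simp add: a'_def)
    show ?thesis
      using facts unfolding a0 Y0 w0 Y'0 w'0 a'0 scaleR_zero_left add_0_right Y2 q_def[symmetric]
      by simp
  qed
  have time: "1 / \<rho> + U [VarT] (x, t) / (2 * y) + uet / g \<ge> 0"
  proof -
    define w where "w s = (\<Sum>j\<in>UNIV. e $ j * U [VarX j] (x, s))" for s
    have near: "(x, s) \<in> ?D" if "t - \<delta> < s" "s \<le> t" for s
      using that \<delta>(1) t by (intro \<delta>(2)) auto
    have "1 / (r\<^sup>2 - (norm x)\<^sup>2 + t) - (- U [VarT] (x, t)) / (2 * (2 * M - u (x, t))) + uet / w t \<ge> 0"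
    proof (rule log_quotient_max_from_left[OF t \<delta>(1), where a = "\<lambda>s. r\<^sup>2 - (norm x)\<^sup>2 + s" and y = "\<lambda>s. 2 * M - u (x, s)"])
      show "((\<lambda>s. r\<^sup>2 - (norm x)\<^sup>2 + s) has_real_derivative 1) (at t within {..0})"
        by (auto intro!: derivative_eq_intros)
      show "((\<lambda>s. 2 * M - u (x, s)) has_real_derivative - U [VarT] (x, t)) (at t within {..0})"
        using DERIV_diff[OF DERIV_const C_par_DERIV_t[OF C _ p, of "[]"]] by (simp add: U_def del: pd.simps)
      show "(w has_real_derivative uet) (at t within {..0})"
        unfolding w_def uet_def U_def
        by (intro DERIV_sum DERIV_cmult C_par_DERIV_t[OF C _ p]) auto
      show "0 < r\<^sup>2 - (norm x)\<^sup>2 + s" if "t - \<delta> < s" "s \<le> t" for s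
        using near[OF that] by (simp add: parabolic_dom_def)
      show "0 < 2 * M - u (x, s)" if "t - \<delta> < s" "s \<le> t" for s
        by (rule ypos[OF near[OF that]])
      show "0 < w t" using g0 pos by (simp add: w_def)
      show "(r\<^sup>2 - (norm x)\<^sup>2 + s) * w s / sqrt (2 * M - u (x, s))
         \<le> (r\<^sup>2 - (norm x)\<^sup>2 + t) * w t / sqrt (2 * M - u (x, t))" if "t - \<delta> < s" "s \<le> t" for s
        using max[OF near[OF that]] by (simp add: w_def g0 grad_dir \<rho>_def y_def)
    qed
    then show ?thesis by (simp add: \<rho>_def y_def w_def g0)
  qed
  have equation: "- uet * esym UNIV k l - U [VarT] (x, t) * (\<Sum>i\<in>UNIV. esym (UNIV - {i}) (k - 1) l * q i) = R"
    using DERIV_unique[OF DERIV_operator_along_line[OF C k p e orth eig[unfolded H_def]] eq]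
    unfolding sigma_k_eq_esym Ut H_def[symmetric] U_def[symmetric] uet_def q_def l_def[abs_def] .
  have leq: "eigenvalue_vec H = (\<chi> i. l i)" by (simp add: vec_eq_iff l_def)
  have main: "m1 * (g\<^sup>2 / (4 * real CARD('n) * y)) ^ (k - 1) * (g\<^sup>2 / (16 * y\<^sup>2)) \<le> esym UNIV k l / \<rho> - R / g"
  proof (rule maximum_point_inequality[where e = ei and d\<rho> = "\<lambda>i. - 2 * (x \<bullet> v i)" and q = q and r = r
        and ut = "U [VarT] (x, t)" and uet = uet])
    show "(\<chi> i. l i) \<in> closure (Gam k)" using cl by (simp add: leq[symmetric] H_def)
    show "(\<Sum>i\<in>UNIV. (ei i)\<^sup>2) = 1"
      unfolding ei_def using sum_inner_orthonormal_square[OF orth, of e] e by simp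
    show "(\<Sum>i\<in>UNIV. (- 2 * (x \<bullet> v i))\<^sup>2) \<le> 4 * r\<^sup>2"
    proof -
      have "(\<Sum>i\<in>UNIV. (- 2 * (x \<bullet> v i))\<^sup>2) = 4 * (\<Sum>i\<in>UNIV. (v i \<bullet> x)\<^sup>2)"
        by (simp add: power_mult_distrib sum_distrib_left inner_commute)
      also have "\<dots> = 4 * (norm x)\<^sup>2" by (simp add: sum_inner_orthonormal_square[OF orth])
      also have "\<dots> \<le> 4 * r\<^sup>2" using p by (auto simp: parabolic_dom_def)
      finally show ?thesis .
    qed
    show "- U [VarT] (x, t) \<ge> m1" using ut by (simp add: Ut)
    show "17 * real CARD('n) * r * y \<le> g * \<rho>" using large by (simp add: n_def)
    show "- uet * esym UNIV k l - U [VarT] (x, t) * (\<Sum>i\<in>UNIV. esym (UNIV - {i}) (k - 1) l * q i) = R"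
      by (rule equation)
  qed (use k pos \<rho> y space time in auto)
  have "esym UNIV k l = sigma_k k (eigenvalue_vec (hess_x u (x, t)))"
    by (simp add: sigma_k_eq_esym l_def[abs_def] H_def)
  then show ?thesis using main by (simp add: n_def)
qed

section \<open>The derivative of the right-hand side along the graph of the solution\<close>

text \<open>Only increments along the coordinate axes are controlled, so the points are joined by a path along the axes, which stays in the
ball.\<close>

lemma coordinatewise_increment_bound:
  fixes f :: "real ^ 'n \<Rightarrow> real"
  assumes step: "\<And>y i h. h \<ge> 0 \<Longrightarrow> norm y < R \<Longrightarrow> norm (y + h *\<^sub>R axis i 1) < R \<Longrightarrow>
      \<bar>f (y + h *\<^sub>R axis i 1) - f y\<bar> \<le> L * h"
    and small: "norm x + norm h < R"
  shows "\<bar>f (x + h) - f x\<bar> \<le> L * (\<Sum>i\<in>UNIV. \<bar>h $ i\<bar>)"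
proof -
  define hJ where "hJ J = (\<Sum>i\<in>J. h $ i *\<^sub>R axis i (1::real))" for J :: "'n set"
  have hJ_nth: "hJ J $ i = (if i \<in> J then h $ i else 0)" for J i
    by (simp add: hJ_def axis_def if_distrib[of "\<lambda>a. _ * a"] cong: if_cong)
  have inR: "norm (x + hJ J) < R" for J
  proof -
    have "norm (hJ J) \<le> norm h" by (rule norm_le_componentwise_cart) (simp add: hJ_nth)
    then show ?thesis using norm_triangle_ineq[of x "hJ J"] small by linarith
  qed
  have "\<bar>f (x + hJ J) - f x\<bar> \<le> L * (\<Sum>i\<in>J. \<bar>h $ i\<bar>)" if "finite J" for J
    using that
  proof (induction J rule: finite_induct)
    case empty
    then show ?case by (simp add: hJ_def)
  next
    case (insert i J)
    have ins: "x + hJ (insert i J) = x + hJ J + h $ i *\<^sub>R axis i 1"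
      using insert.hyps by (simp add: hJ_def add_ac)
    have "\<bar>f (x + hJ (insert i J)) - f (x + hJ J)\<bar> \<le> L * \<bar>h $ i\<bar>"
    proof (cases "h $ i \<ge> 0")
      case True
      then show ?thesis
        using step[of "h $ i" "x + hJ J" i] inR[of J] inR[of "insert i J"] unfolding ins by simp
    next
      case False
      have rev: "x + hJ J = x + hJ (insert i J) + (- h $ i) *\<^sub>R axis i 1" unfolding ins by simp
      show ?thesis
        using step[of "- h $ i" "x + hJ (insert i J)" i, folded rev] inR[of J] inR[of "insert i J"] False
        by (simp add: abs_minus_commute)
    qed
    then show ?case using insert.IH insert.hyps by (simp add: distrib_left)
  qed
  moreover have "hJ UNIV = h" by (simp add: vec_eq_iff hJ_nth)
  ultimately show ?thesis by (metis finite_class.finite_UNIV)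
qed

text \<open>On a closed ball inside the slice of the domain at time \<open>t\<close>, \<open>\<psi>\<close> is extended to a globally Lipschitz function of \<open>(x, z)\<close> by the
nearest-point projection. At the points of the open ball where all its partial derivatives exist, they are bounded by the supremum.\<close>

lemma rhs_increment_bounds:
  fixes \<psi> :: "(real ^ 'n) \<times> real \<Rightarrow> real \<Rightarrow> real" and x :: "real ^ 'n" and r :: real
  defines "L \<equiv> Sup (deriv_values (parabolic_dom r) \<psi>)"
  assumes lx: "lipschitz_x (closure (parabolic_dom r)) \<psi>" and lz: "lipschitz_z (closure (parabolic_dom r)) \<psi>"
    and bdd: "bdd_above (deriv_values (parabolic_dom r) \<psi>)" and p: "(x, t) \<in> parabolic_dom r"
  obtains \<rho> where "norm x < \<rho>"
    "\<And>y h i z. h \<ge> 0 \<Longrightarrow> norm y < \<rho> \<Longrightarrow> norm (y + h *\<^sub>R axis i 1) < \<rho> \<Longrightarrow>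
       \<bar>\<psi> (y + h *\<^sub>R axis i 1, t) z - \<psi> (y, t) z\<bar> \<le> L * h"
    "\<And>y z z'. norm y < \<rho> \<Longrightarrow> \<bar>\<psi> (y, t) z' - \<psi> (y, t) z\<bar> \<le> L * \<bar>z' - z\<bar>"
proof -
  let ?D = "parabolic_dom r :: ((real ^ 'n) \<times> real) set"
  have t: "t \<le> 0" "(norm x)\<^sup>2 < t + r\<^sup>2" using p by (auto simp: parabolic_dom_def)
  then have "norm x < sqrt (t + r\<^sup>2)" by (simp add: real_less_rsqrt)
  then obtain \<rho> where \<rho>: "norm x < \<rho>" "\<rho> < sqrt (t + r\<^sup>2)" using dense by blast
  have \<rho>0: "\<rho> > 0" using \<rho>(1) norm_ge_zero[of x] by linarith
  have slice: "(y, t) \<in> ?D" if "norm y \<le> \<rho>" for y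
  proof -
    have "norm y < sqrt (t + r\<^sup>2)" using that \<rho> by simp
    then have "(norm y)\<^sup>2 < (sqrt (t + r\<^sup>2))\<^sup>2" by (intro power_strict_mono) auto
    moreover have "t + r\<^sup>2 \<ge> 0" using t(2) zero_le_power2[of "norm x"] by linarith
    ultimately show ?thesis using t by (simp add: parabolic_dom_def)
  qed
  have slice': "(y, t) \<in> closure ?D" if "norm y \<le> \<rho>" for y
    using slice[OF that] closure_subset by blast
  obtain Lx where Lx: "\<And>s z. Lx-lipschitz_on {y. (y, s) \<in> closure ?D} (\<lambda>y. \<psi> (y, s) z)"
    using lx unfolding lipschitz_x_def by blast
  obtain Lz where Lz: "\<And>q. q \<in> closure ?D \<Longrightarrow> Lz-lipschitz_on UNIV (\<psi> q)"
    using lz unfolding lipschitz_z_def by blast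
  have Lx0: "Lx \<ge> 0" by (rule lipschitz_on_nonneg[OF Lx])
  have Lz0: "Lz \<ge> 0" by (rule lipschitz_on_nonneg[OF Lz[OF slice'[of x]]]) (use \<rho> in simp)
  define cp where "cp = closest_point (cball (0 :: real ^ 'n) \<rho>)"
  have cp: "norm (cp y) \<le> \<rho>" for y
    using closest_point_in_set[of "cball 0 \<rho>" y] \<rho>0 by (simp add: cp_def)
  have cp_id: "cp y = y" if "norm y \<le> \<rho>" for y
    using closest_point_self[of y "cball 0 \<rho>"] that by (simp add: cp_def)
  have cp_lip: "dist (cp y) (cp y') \<le> dist y y'" for y y'
    unfolding cp_def using \<rho>0 by (intro closest_point_lipschitz) auto
  define F where "F q = \<psi> (cp (fst q), t) (snd q)" for q :: "(real ^ 'n) \<times> real"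
  have lipF: "(Lx + Lz)-lipschitz_on UNIV F"
  proof (rule lipschitz_onI)
    fix q q' :: "(real ^ 'n) \<times> real"
    obtain y z y' z' where q: "q = (y, z)" "q' = (y', z')" by (cases q, cases q')
    have "dist (F q) (F q') \<le> dist (\<psi> (cp y, t) z) (\<psi> (cp y', t) z) + dist (\<psi> (cp y', t) z) (\<psi> (cp y', t) z')"
      by (simp add: F_def q dist_triangle)
    also have "dist (\<psi> (cp y, t) z) (\<psi> (cp y', t) z) \<le> Lx * dist (cp y) (cp y')"
      using cp by (intro lipschitz_onD[OF Lx]) (auto intro: slice')
    also have "\<dots> \<le> Lx * dist q q'"
      using Lx0 cp_lip[of y y'] dist_fst_le[of q q'] by (intro mult_left_mono) (auto simp: q)
    also have "dist (\<psi> (cp y', t) z) (\<psi> (cp y', t) z') \<le> Lz * dist z z'"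
      using cp by (intro lipschitz_onD[OF Lz]) (auto intro: slice')
    also have "\<dots> \<le> Lz * dist q q'"
      using Lz0 dist_snd_le[of q q'] by (intro mult_left_mono) (auto simp: q)
    finally show "dist (F q) (F q') \<le> (Lx + Lz) * dist q q'" by (simp add: distrib_right)
  qed (use Lx0 Lz0 in simp)
  have basis_x: "(axis i (1::real) :: real ^ 'n, 0 :: real) \<in> Basis" for i
    by (auto simp: Basis_prod_def Basis_vec_def)
  define W where "W = ball (0 :: real ^ 'n) \<rho> \<times> (UNIV :: real set)"
  have W: "open W" by (simp add: W_def open_Times)
  have partials: "\<bar>vector_derivative (\<lambda>h. F (q + h *\<^sub>R b0)) (at 0)\<bar> \<le> L"
    if q: "q \<in> W" and diff: "\<And>b. b \<in> Basis \<Longrightarrow> (\<lambda>h. F (q + h *\<^sub>R b)) differentiable (at 0)" and b0: "b0 \<in> Basis" for q b0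
  proof -
    obtain y z where yz: "q = (y, z)" by (cases q)
    have y: "norm y < \<rho>" using q by (simp add: W_def yz)
    define d where "d b = vector_derivative (\<lambda>h. F (q + h *\<^sub>R b)) (at 0)" for b
    have d: "((\<lambda>h. F (q + h *\<^sub>R b)) has_real_derivative d b) (at 0)" if "b \<in> Basis" for b
      using diff[OF that] by (simp add: d_def has_real_derivative_iff_has_vector_derivative vector_derivative_works)
    have dx: "((\<lambda>h. \<psi> (y + h *\<^sub>R axis i 1, t) z) has_real_derivative d (axis i 1, 0)) (at 0)" for i
    proof -
      have "((\<lambda>h. F (q + h *\<^sub>R (axis i 1, 0))) has_real_derivative d (axis i 1, 0)) (at 0)"
        by (rule d) (rule basis_x)
      moreover have "\<forall>\<^sub>F h in nhds 0. F (q + h *\<^sub>R (axis i 1, 0)) = \<psi> (y + h *\<^sub>R axis i 1, t) z"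
      proof -
        have "F (q + h *\<^sub>R (axis i 1, 0)) = \<psi> (y + h *\<^sub>R axis i 1, t) z" if h: "dist h 0 < \<rho> - norm y" for h
        proof -
          have "norm (y + h *\<^sub>R axis i 1) \<le> norm y + \<bar>h\<bar>"
            using norm_triangle_ineq[of y "h *\<^sub>R axis i 1"] by (simp add: norm_axis_1)
          then show ?thesis using h by (simp add: F_def yz cp_id)
        qed
        then show ?thesis
          unfolding eventually_nhds_metric using y by (intro exI[of _ "\<rho> - norm y"]) auto
      qed
      ultimately show ?thesis by (subst (asm) DERIV_cong_ev) auto
    qed
    have dz: "(\<psi> (y, t) has_real_derivative d (0, 1)) (at z)"
    proof -
      have "((\<lambda>h. F (q + h *\<^sub>R (0, 1))) has_real_derivative d (0, 1)) (at 0)"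
        by (rule d) (auto simp: Basis_prod_def)
      then have "((\<lambda>h. \<psi> (y, t) (h + z)) has_real_derivative d (0, 1)) (at 0)"
        using y by (simp add: F_def yz cp_id add.commute)
      then show ?thesis using DERIV_shift[of "\<psi> (y, t)" _ 0 z] by simp
    qed
    have "norm (grad_x (\<lambda>q. \<psi> q z) (y, t)) + \<bar>deriv (\<psi> (y, t)) z\<bar> \<in> deriv_values ?D \<psi>"
      unfolding deriv_values_def
    proof (rule CollectI, intro exI conjI allI)
      show "(y, t) \<in> ?D" using y by (intro slice) simp
      show "pdiff (VarX i) (\<lambda>q. \<psi> q z) (y, t)" for i
        using dx[of i] real_differentiable_def by auto
      show "\<psi> (y, t) differentiable at z" using dz real_differentiable_def by blast
    qed simp
    then have le: "norm (grad_x (\<lambda>q. \<psi> q z) (y, t)) + \<bar>deriv (\<psi> (y, t)) z\<bar> \<le> L"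
      unfolding L_def by (rule cSup_upper[OF _ bdd])
    have gx: "grad_x (\<lambda>q. \<psi> q z) (y, t) $ i = d (axis i 1, 0)" for i
      using dx[of i] by (simp add: grad_x_def has_real_derivative_iff_has_vector_derivative vector_derivative_at)
    have gz: "deriv (\<psi> (y, t)) z = d (0, 1)" using dz by (rule DERIV_imp_deriv)
    have "\<bar>d b0\<bar> \<le> L"
      using b0 unfolding Basis_prod_def
    proof (elim UnE imageE)
      fix b :: "real ^ 'n" assume b: "b \<in> Basis" "b0 = (b, 0)"
      then obtain i where "b = axis i 1" by (auto simp: Basis_vec_def)
      then have "\<bar>d b0\<bar> \<le> norm (grad_x (\<lambda>q. \<psi> q z) (y, t))"
        using component_le_norm_cart[of "grad_x (\<lambda>q. \<psi> q z) (y, t)" i] b by (simp add: gx)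
      then show ?thesis using le by linarith
    next
      fix b :: real assume b: "b \<in> Basis" "b0 = (0, b)"
      then have "\<bar>d b0\<bar> = \<bar>deriv (\<psi> (y, t)) z\<bar>" by (simp add: gz)
      then show ?thesis using le norm_ge_zero[of "grad_x (\<lambda>q. \<psi> q z) (y, t)"] by linarith
    qed
    then show ?thesis by (simp add: d_def)
  qed
  have stepF: "\<bar>F (q + h *\<^sub>R b0) - F q\<bar> \<le> L * h"
    if h: "h \<ge> 0" and q: "q \<in> W" "q + h *\<^sub>R b0 \<in> W" and b0: "b0 \<in> Basis" for h q b0
  proof (rule lipschitz_increment_bound_by_partials[OF lipF W b0 _ _ h])
    show "\<bar>vector_derivative (\<lambda>h. F (x + h *\<^sub>R b0)) (at 0)\<bar> \<le> L"
      if "x \<in> W" "\<And>b. b \<in> Basis \<Longrightarrow> (\<lambda>h. F (x + h *\<^sub>R b)) differentiable (at 0)" for x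
      by (rule partials[OF that b0])
    have "convex W" unfolding W_def by (intro convex_Times) auto
    show "q + s *\<^sub>R b0 \<in> W" if s: "s \<in> {0..h}" for s
    proof (cases "h = 0")
      case False
      have "(1 - s / h) *\<^sub>R q + (s / h) *\<^sub>R (q + h *\<^sub>R b0) \<in> W"
        using s h False by (intro convexD[OF \<open>convex W\<close> q]) (auto simp: divide_le_eq)
      moreover have "(1 - s / h) *\<^sub>R q + (s / h) *\<^sub>R (q + h *\<^sub>R b0) = q + s *\<^sub>R b0"
        using False by (simp add: algebra_simps)
      ultimately show ?thesis by simp
    qed (use s q in auto)
  qed
  have stepx: "\<bar>\<psi> (y + h *\<^sub>R axis i 1, t) z - \<psi> (y, t) z\<bar> \<le> L * h"
    if "h \<ge> 0" "norm y < \<rho>" "norm (y + h *\<^sub>R axis i 1) < \<rho>" for y h i z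
    using stepF[of h "(y, z)" "(axis i 1, 0)"] that
    by (simp add: W_def F_def cp_id basis_x)
  have stepz: "\<bar>\<psi> (y, t) z' - \<psi> (y, t) z\<bar> \<le> L * \<bar>z' - z\<bar>" if "norm y < \<rho>" for y z z'
  proof -
    have up: "\<bar>\<psi> (y, t) (z + h) - \<psi> (y, t) z\<bar> \<le> L * h" if "h \<ge> 0" for h z
      using stepF[of h "(y, z)" "(0, 1)"] \<open>norm y < \<rho>\<close> that
      by (simp add: W_def F_def cp_id Basis_prod_def)
    show ?thesis
      using up[of "z' - z" z] up[of "z - z'" z'] by (cases "z \<le> z'") (auto simp: abs_minus_commute)
  qed
  show ?thesis by (rule that[OF \<rho>(1) stepx stepz])
qed

lemma deriv_values_bound_nonneg:
  fixes \<psi> :: "(real ^ 'n) \<times> real \<Rightarrow> real \<Rightarrow> real" and x :: "real ^ 'n"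
  assumes "lipschitz_x (closure (parabolic_dom r)) \<psi>" "lipschitz_z (closure (parabolic_dom r)) \<psi>"
    "bdd_above (deriv_values (parabolic_dom r) \<psi>)" "(x, t) \<in> parabolic_dom r"
  shows "Sup (deriv_values (parabolic_dom r) \<psi>) \<ge> 0"
proof -
  obtain \<rho> where "norm x < \<rho>" "\<And>y z z'. norm y < \<rho> \<Longrightarrow>
      \<bar>\<psi> (y, t) z' - \<psi> (y, t) z\<bar> \<le> Sup (deriv_values (parabolic_dom r) \<psi>) * \<bar>z' - z\<bar>"
    using rhs_increment_bounds[OF assms] by metis
  from this(2)[OF this(1), of 1 0] show ?thesis by simp
qed

text \<open>The function \<open>\<psi>\<close> need not be differentiable at points of the graph, so the derivative of the composition cannot come from the
chain rule; it is bounded through increments. In the application it exists because the left-hand side of the equation is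
differentiable.\<close>

lemma bound_along_graph:
  fixes \<psi> :: "(real ^ 'n) \<times> real \<Rightarrow> real \<Rightarrow> real" and x e :: "real ^ 'n" and g R :: real
  assumes lip: "lipschitz_x (closure (parabolic_dom r)) \<psi>" "lipschitz_z (closure (parabolic_dom r)) \<psi>"
    "bdd_above (deriv_values (parabolic_dom r) \<psi>)"
    and p: "(x, t) \<in> parabolic_dom r" and e: "norm e = 1"
    and du: "((\<lambda>s. u (x + s *\<^sub>R e, t)) has_real_derivative g) (at 0)"
    and d\<psi>: "((\<lambda>s. \<psi> (x + s *\<^sub>R e, t) (u (x + s *\<^sub>R e, t))) has_real_derivative R) (at 0)"
  shows "\<bar>R\<bar> \<le> Sup (deriv_values (parabolic_dom r) \<psi>) * (CARD('n) + \<bar>g\<bar>)"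
proof -
  define L where "L = Sup (deriv_values (parabolic_dom r) \<psi>)"
  have L0: "L \<ge> 0" unfolding L_def by (rule deriv_values_bound_nonneg[OF lip p])
  obtain \<rho> where \<rho>: "norm x < \<rho>"
    and stepx: "\<And>y h i z. h \<ge> 0 \<Longrightarrow> norm y < \<rho> \<Longrightarrow> norm (y + h *\<^sub>R axis i 1) < \<rho> \<Longrightarrow>
       \<bar>\<psi> (y + h *\<^sub>R axis i 1, t) z - \<psi> (y, t) z\<bar> \<le> L * h"
    and stepz: "\<And>y z z'. norm y < \<rho> \<Longrightarrow> \<bar>\<psi> (y, t) z' - \<psi> (y, t) z\<bar> \<le> L * \<bar>z' - z\<bar>"
    unfolding L_def by (rule rhs_increment_bounds[OF lip p]) blast
  define \<Psi> where "\<Psi> s = \<psi> (x + s *\<^sub>R e, t) (u (x + s *\<^sub>R e, t))" for s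
  define v where "v s = u (x + s *\<^sub>R e, t)" for s
  have bound: "\<bar>\<Psi> s - \<Psi> 0\<bar> \<le> L * (CARD('n) * \<bar>s\<bar> + \<bar>v s - v 0\<bar>)" if s: "\<bar>s\<bar> < \<rho> - norm x" for s :: real
  proof -
    have small: "norm x + norm (s *\<^sub>R e) < \<rho>" using s e by simp
    have "\<bar>\<psi> (x + s *\<^sub>R e, t) (v s) - \<psi> (x, t) (v s)\<bar> \<le> L * (\<Sum>i\<in>UNIV. \<bar>(s *\<^sub>R e) $ i\<bar>)"
      by (rule coordinatewise_increment_bound[where f = "\<lambda>y. \<psi> (y, t) (v s)", OF stepx small])
    also have "\<dots> \<le> L * (\<Sum>i\<in>(UNIV :: 'n set). \<bar>s\<bar>)"
    proof -
      have "\<bar>(s *\<^sub>R e) $ i\<bar> \<le> \<bar>s\<bar>" for i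
        using component_le_norm_cart[of "s *\<^sub>R e" i] e by simp
      then show ?thesis using L0 by (intro mult_left_mono sum_mono)
    qed
    finally have "\<bar>\<psi> (x + s *\<^sub>R e, t) (v s) - \<psi> (x, t) (v s)\<bar> \<le> L * (CARD('n) * \<bar>s\<bar>)" by simp
    moreover have "\<bar>\<psi> (x, t) (v s) - \<psi> (x, t) (v 0)\<bar> \<le> L * \<bar>v s - v 0\<bar>" using \<rho> by (rule stepz)
    ultimately show ?thesis by (simp add: \<Psi>_def v_def distrib_left)
  qed
  have "((\<lambda>s. (\<Psi> s - \<Psi> 0) / s) \<longlongrightarrow> R) (at 0)"
    using d\<psi> by (simp add: \<Psi>_def has_field_derivative_iff)
  then have lim1: "((\<lambda>s. \<bar>(\<Psi> s - \<Psi> 0) / s\<bar>) \<longlongrightarrow> \<bar>R\<bar>) (at 0)" by (rule tendsto_rabs)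
  have "((\<lambda>s. (v s - v 0) / s) \<longlongrightarrow> g) (at 0)"
    using du by (simp add: v_def has_field_derivative_iff)
  then have lim2: "((\<lambda>s. L * (CARD('n) + \<bar>(v s - v 0) / s\<bar>)) \<longlongrightarrow> L * (CARD('n) + \<bar>g\<bar>)) (at 0)"
    by (intro tendsto_intros tendsto_rabs)
  have "\<forall>\<^sub>F s in at 0. \<bar>(\<Psi> s - \<Psi> 0) / s\<bar> \<le> L * (CARD('n) + \<bar>(v s - v 0) / s\<bar>)"
    unfolding eventually_at
  proof (intro exI[of _ "\<rho> - norm x"] conjI ballI impI)
    show "0 < \<rho> - norm x" using \<rho> by simp
    fix s :: real assume s: "s \<noteq> 0 \<and> dist s 0 < \<rho> - norm x"
    then have "\<bar>\<Psi> s - \<Psi> 0\<bar> / \<bar>s\<bar> \<le> L * (CARD('n) * \<bar>s\<bar> + \<bar>v s - v 0\<bar>) / \<bar>s\<bar>"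
      using bound[of s] by (intro divide_right_mono) (auto simp: dist_real_def)
    also have "\<dots> = L * (CARD('n) + \<bar>v s - v 0\<bar> / \<bar>s\<bar>)"
      using s by (simp add: field_simps)
    finally show "\<bar>(\<Psi> s - \<Psi> 0) / s\<bar> \<le> L * (CARD('n) + \<bar>(v s - v 0) / s\<bar>)"
      by (simp add: abs_divide)
  qed
  then show "\<bar>R\<bar> \<le> Sup (deriv_values (parabolic_dom r) \<psi>) * (CARD('n) + \<bar>g\<bar>)"
    unfolding L_def[symmetric] using lim1 lim2 by (intro tendsto_le[OF _ lim2 lim1]) auto
qed

section \<open>The gradient estimate\<close>

text \<open>Depending on which term on the right dominates, \<open>g\<^bsup>2k\<^esup>\<close> is bounded by the term with \<open>P\<close> or by the one with \<open>E\<close>. In the first case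
multiplication by \<open>\<rho>\<^bsup>2k-1\<^esup> \<le> r\<^bsup>2(2k-1)\<^esup>\<close> and \<open>m1 * r\<^sup>2 \<le> 2 * M\<close> bring the bound into the homogeneous form \<open>(M r)\<^bsup>2k\<^esup>\<close>. The constant
\<open>B\<close> collects the numerical factors of the hypothesis, those from \<open>y \<le> 3 * M\<close>, and a factor \<open>2\<close> for the two cases.\<close>

lemma gradient_alternative:
  fixes n :: real
  defines "B \<equiv> \<lambda>k. 32 * (4 * n) ^ (k - 1) * 3 ^ (k + 1)"
  assumes k: "k \<ge> 1" and n: "n \<ge> 1" and pos: "m1 > 0" "M > 0" "r > 0" "\<rho> > 0" "g > 0" "y > 0"
    and y: "y \<le> 3 * M" and \<rho>: "\<rho> \<le> r\<^sup>2" and M: "m1 * r\<^sup>2 \<le> 2 * M" and P: "P \<ge> 0"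
    and ineq: "m1 * (g\<^sup>2 / (4 * n * y)) ^ (k - 1) * (g\<^sup>2 / (16 * y\<^sup>2)) \<le> P / (m1 * \<rho>) + E"
  shows "g * \<rho> \<le> (B k * P * (2 / m1) ^ (k - 1) / m1\<^sup>2 + 1) * (M * r) \<or> m1 * g ^ (2 * k) \<le> B k * M ^ (k + 1) * E"
proof -
  have B: "B k > 0" using n by (simp add: B_def)
  obtain j where j: "k = Suc j" using k by (cases k) auto
  define S where "S = m1 * g ^ (2 * k) / (B k * M ^ (k + 1))"
  have "2 * S = m1 * g ^ (2 * k) / (16 * (4 * n) ^ (k - 1) * (3 * M) ^ (k + 1))"
    by (simp add: S_def B_def power_mult_distrib)
  also have "\<dots> \<le> m1 * g ^ (2 * k) / (16 * (4 * n) ^ (k - 1) * y ^ (k + 1))"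
    using pos n y by (intro divide_left_mono mult_left_mono power_mono mult_pos_pos) auto
  also have "\<dots> = m1 * (g\<^sup>2 / (4 * n * y)) ^ (k - 1) * (g\<^sup>2 / (16 * y\<^sup>2))"
    by (simp add: j power_divide power_mult_distrib power_mult[symmetric] power_add[symmetric] power2_eq_square mult_ac mult_2 mult_2_right)
  finally have S: "2 * S \<le> P / (m1 * \<rho>) + E" using ineq by simp
  show ?thesis
  proof (cases "S \<le> E")
    case True
    have "m1 * g ^ (2 * k) = S * (B k * M ^ (k + 1))" using B pos by (simp add: S_def)
    also have "\<dots> \<le> E * (B k * M ^ (k + 1))" using True B pos by (intro mult_right_mono) auto
    finally show ?thesis by (simp add: mult_ac)
  next
    case False
    define K where "K = B k * P * (2 / m1) ^ (k - 1) / m1\<^sup>2"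
    have K: "K \<ge> 0" using B P pos by (simp add: K_def)
    have "S \<le> P / (m1 * \<rho>)" using S False by simp
    then have gr: "g ^ (2 * k) * \<rho> \<le> B k * P * M ^ (k + 1) / m1\<^sup>2"
      using pos B by (simp add: S_def field_simps power2_eq_square)
    have "(g * \<rho>) ^ (2 * k) = (g ^ (2 * k) * \<rho>) * \<rho> ^ (2 * k - 1)"
      using k by (simp add: power_mult_distrib mult.assoc flip: power_Suc)
    also have "\<dots> \<le> (B k * P * M ^ (k + 1) / m1\<^sup>2) * (r\<^sup>2) ^ (2 * k - 1)"
      using gr pos \<rho> B P by (intro mult_mono power_mono) auto
    also have "(r\<^sup>2) ^ (2 * k - 1) = r ^ (2 * k) * (r\<^sup>2) ^ (k - 1)"
      by (simp add: j power_mult[symmetric] power_add[symmetric])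
    also have "(B k * P * M ^ (k + 1) / m1\<^sup>2) * (r ^ (2 * k) * (r\<^sup>2) ^ (k - 1))
        \<le> (B k * P * M ^ (k + 1) / m1\<^sup>2) * (r ^ (2 * k) * (2 * M / m1) ^ (k - 1))"
      using pos B P M by (intro mult_left_mono power_mono) (auto simp: field_simps)
    also have "\<dots> = K * (M * r) ^ (2 * k)"
    proof -
      have "M ^ (k + 1) * M ^ (k - 1) = M ^ (2 * k)" by (simp add: j mult_2 flip: power_add)
      then show ?thesis
        by (simp add: K_def power_mult_distrib power_divide mult_ac)
    qed
    also have "\<dots> \<le> (K + 1) ^ (2 * k) * (M * r) ^ (2 * k)"
    proof (intro mult_right_mono)
      have "K + 1 \<le> (K + 1) ^ (2 * k)" using K k by (intro self_le_power) auto
      then show "K \<le> (K + 1) ^ (2 * k)" by simp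
    qed (use pos in simp)
    also have "\<dots> = ((K + 1) * (M * r)) ^ (2 * k)" by (simp only: power_mult_distrib)
    finally have "(g * \<rho>) ^ (2 * k) \<le> ((K + 1) * (M * r)) ^ (2 * k)" .
    then have "g * \<rho> \<le> (K + 1) * (M * r)"
      using power_mono_iff[of "g * \<rho>" "(K + 1) * (M * r)" "2 * k"] pos K k by simp
    then show ?thesis by (simp add: K_def)
  qed
qed

text \<open>The mean value theorem on the time axis through the origin, which has length \<open>r\<^sup>2\<close> inside the domain.\<close>

lemma oscillation_lower_bound:
  fixes u :: "(real ^ 'n) \<times> real \<Rightarrow> real"
  assumes r: "r > 0" and m1: "m1 > 0" and C: "C_par 2 (parabolic_dom r) u"
    and ut: "\<And>p. p \<in> parabolic_dom r \<Longrightarrow> - pd VarT u p \<ge> m1"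
    and bound: "\<And>p. p \<in> parabolic_dom r \<Longrightarrow> \<bar>u p\<bar> \<le> M"
  shows "m1 * r\<^sup>2 \<le> 2 * M"
proof (rule ccontr)
  assume "\<not> ?thesis"
  then have "2 * M / m1 < r\<^sup>2" using m1 by (simp add: field_simps)
  moreover have "M \<ge> 0" using bound[of "(0, 0)"] r by (force simp: parabolic_dom_def)
  ultimately obtain s where s: "max 0 (2 * M / m1) < s" "s < r\<^sup>2"
    using dense[of "max 0 (2 * M / m1)" "r\<^sup>2"] r by auto
  have D: "(0, \<tau>) \<in> (parabolic_dom r :: ((real ^ 'n) \<times> real) set)" if "\<tau> \<in> {-s..0}" for \<tau>
    using that s by (simp add: parabolic_dom_def)
  have "\<exists>\<tau>\<in>{-s<..<0}. u (0, 0) - u (0, -s) = pd VarT u (0, \<tau>) * (0 - (- s))"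
  proof (rule mvt_simple)
    show "((\<lambda>\<tau>. u (0, \<tau>)) has_derivative (*) (pd VarT u (0, \<tau>))) (at \<tau> within {-s..0})" if "-s \<le> \<tau>" "\<tau> \<le> 0" for \<tau>
    proof -
      have "((\<lambda>\<tau>. foldr pd [] u (0, \<tau>)) has_real_derivative foldr pd [VarT] u (0, \<tau>)) (at \<tau> within {..0})"
        using that by (intro C_par_DERIV_t[OF C _ D]) auto
      then have "((\<lambda>\<tau>. u (0, \<tau>)) has_real_derivative pd VarT u (0, \<tau>)) (at \<tau> within {-s..0})"
        unfolding foldr.simps id_apply o_apply by (rule DERIV_subset) auto
      then show ?thesis by (simp add: has_field_derivative_def del: pd.simps)
    qed
  qed (use s in simp)
  then obtain \<tau> where \<tau>: "\<tau> \<in> {-s<..<0}" "u (0, 0) - u (0, -s) = pd VarT u (0, \<tau>) * s" by auto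
  have "m1 * s \<le> - pd VarT u (0, \<tau>) * s"
    using ut[OF D[of \<tau>]] \<tau>(1) s by (intro mult_right_mono) auto
  also have "\<dots> = u (0, -s) - u (0, 0)" using \<tau>(2) by (simp del: pd.simps)
  also have "\<dots> \<le> 2 * M"
  proof -
    have "\<bar>u (0, 0)\<bar> \<le> M" by (rule bound[OF D]) (use s in simp)
    moreover have "\<bar>u (0, -s)\<bar> \<le> M" by (rule bound[OF D]) (use s in simp)
    ultimately show ?thesis by linarith
  qed
  finally show False using s m1 by (simp add: field_simps)
qed

text \<open>The gradient extends continuously to the compact closure of the domain, and the weight vanishes on the part of the closure outside
the domain, so a maximum point of positive value lies inside.\<close>

lemma weighted_gradient_attains_max:
  fixes u :: "(real ^ 'n) \<times> real \<Rightarrow> real"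
  defines "W \<equiv> \<lambda>r M q. (r\<^sup>2 - (norm (fst q))\<^sup>2 + snd q) * norm (grad_x u q) / sqrt (2 * M - u q)"
  assumes r: "r > 0" and M: "M > 0" and C: "C_par_closure 1 (parabolic_dom r) u"
    and bound: "\<And>p. p \<in> parabolic_dom r \<Longrightarrow> \<bar>u p\<bar> \<le> M" and ne: "grad_x u (0, 0) \<noteq> 0"
  obtains p where "p \<in> parabolic_dom r" "grad_x u p \<noteq> 0"
    "\<And>q. q \<in> parabolic_dom r \<Longrightarrow> W r M q \<le> W r M p"
proof -
  let ?D = "parabolic_dom r :: ((real ^ 'n) \<times> real) set"
  have cont_u: "continuous_on (closure ?D) u" using C by (simp add: C_par_closure_def)
  have ext: "\<forall>i. \<exists>g. continuous_on (closure ?D) g \<and> (\<forall>p\<in>?D. g p = pd (VarX i) u p)"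
  proof
    fix i :: 'n
    have "par_weight [VarX i] \<le> 2 * 1" by simp
    then have "\<exists>g. continuous_on (closure ?D) g \<and> (\<forall>p\<in>?D. g p = foldr pd [VarX i] u p)"
      using C unfolding C_par_closure_def by blast
    then show "\<exists>g. continuous_on (closure ?D) g \<and> (\<forall>p\<in>?D. g p = pd (VarX i) u p)" by simp
  qed
  then obtain G where G: "\<And>i. continuous_on (closure ?D) (G i)" "\<And>i p. p \<in> ?D \<Longrightarrow> G i p = pd (VarX i) u p"
    by metis
  define grad where "grad p = (\<chi> i. G i p)" for p
  have grad_eq: "grad p = grad_x u p" if "p \<in> ?D" for p
    using G(2)[OF that] by (simp add: grad_def grad_x_def)
  have cont_grad: "continuous_on (closure ?D) grad"
    unfolding grad_def by (intro continuous_on_vec_lambda G)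
  have uM: "u p \<le> M" if "p \<in> closure ?D" for p
    by (rule continuous_le_on_closure[OF cont_u that]) (use bound in \<open>force simp: abs_le_iff\<close>)
  have nz: "sqrt (2 * M - u q) \<noteq> 0" if "q \<in> closure ?D" for q
    using uM[OF that] M by simp
  define V where "V q = (r\<^sup>2 - (norm (fst q))\<^sup>2 + snd q) * norm (grad q) / sqrt (2 * M - u q)" for q
  have VW: "V q = W r M q" if "q \<in> ?D" for q
    using grad_eq[OF that] by (simp add: V_def W_def)
  have sub: "?D \<subseteq> {p. snd p \<le> 0 \<and> (norm (fst p))\<^sup>2 - r\<^sup>2 \<le> snd p}"
    by (auto simp: parabolic_dom_def)
  have "closed {p :: (real ^ 'n) \<times> real. snd p \<le> 0 \<and> (norm (fst p))\<^sup>2 - r\<^sup>2 \<le> snd p}"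
    by (intro closed_Collect_conj closed_Collect_le continuous_intros)
  then have clo: "closure ?D \<subseteq> {p. snd p \<le> 0 \<and> (norm (fst p))\<^sup>2 - r\<^sup>2 \<le> snd p}"
    using sub by (rule closure_minimal[rotated])
  have "bounded ?D"
  proof (rule bounded_subset)
    show "bounded (cball (0 :: real ^ 'n) r \<times> {- r\<^sup>2..0})" by (intro bounded_Times) auto
    show "?D \<subseteq> cball 0 r \<times> {- r\<^sup>2..0}"
    proof
      fix p assume p: "p \<in> ?D"
      obtain x t where xt: "p = (x, t)" by (cases p)
      have t: "t \<le> 0" and x: "(norm x)\<^sup>2 - r\<^sup>2 < t" using p by (auto simp: xt parabolic_dom_def)
      have "(norm x)\<^sup>2 \<le> r\<^sup>2" using t x by simp
      then have "norm x \<le> r" by (rule power2_le_imp_le) (use r in simp)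
      moreover have "- r\<^sup>2 \<le> t"
        using order_trans[OF _ less_imp_le[OF x], of "- r\<^sup>2"] by simp
      ultimately show "p \<in> cball 0 r \<times> {- r\<^sup>2..0}" using t by (simp add: xt)
    qed
  qed
  then have "compact (closure ?D)" by (simp add: compact_closure)
  moreover have "(0, 0) \<in> ?D" using r by (simp add: parabolic_dom_def)
  then have 0: "(0, 0) \<in> closure ?D" using closure_subset by blast
  moreover have "continuous_on (closure ?D) V"
  proof -
    have 1: "continuous_on (closure ?D) (\<lambda>q. r\<^sup>2 - (norm (fst q))\<^sup>2 + snd q)"
      by (intro continuous_intros)
    have 2: "continuous_on (closure ?D) (\<lambda>q. sqrt (2 * M - u q))"
      by (intro continuous_on_real_sqrt continuous_on_diff continuous_on_const cont_u)
    show ?thesis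
      unfolding V_def[abs_def]
      by (rule continuous_on_divide[OF continuous_on_mult[OF 1 continuous_on_norm[OF cont_grad]] 2]) (use nz in blast)
  qed
  ultimately have "\<exists>p\<in>closure ?D. \<forall>q\<in>closure ?D. V q \<le> V p"
    by (intro continuous_attains_sup) auto
  then obtain p where p: "p \<in> closure ?D" "\<And>q. q \<in> closure ?D \<Longrightarrow> V q \<le> V p" by blast
  have "V (0, 0) > 0"
    using ne r uM[OF 0] M grad_eq[OF \<open>(0, 0) \<in> ?D\<close>] by (simp add: V_def)
  then have Vp: "V p > 0" using p(2)[OF 0] by linarith
  have "r\<^sup>2 - (norm (fst p))\<^sup>2 + snd p \<noteq> 0" using Vp by (auto simp: V_def)
  then have pD: "p \<in> ?D"
    using clo p(1) by (cases p) (force simp: parabolic_dom_def)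
  show ?thesis
  proof (rule that[OF pD])
    show "grad_x u p \<noteq> 0" using Vp grad_eq[OF pD] by (auto simp: V_def)
    show "W r M q \<le> W r M p" if "q \<in> ?D" for q
      using p(2)[of q] that closure_subset VW[OF that] VW[OF pD] by auto
  qed
qed

text \<open>The number \<open>L\<close> stands for the bound on the derivatives of \<open>\<psi>\<close>; \<open>L = 0\<close> covers constant \<open>\<psi>\<close>, and then the second
alternative of \<open>gradient_alternative\<close> cannot occur. The term \<open>51 * n\<close> is the threshold \<open>17 * n\<close> of
\<open>inequality_at_maximum\<close> with \<open>y \<le> 3 * M\<close>.\<close>

lemma gradient_estimate:
  fixes u :: "(real ^ 'n) \<times> real \<Rightarrow> real" and \<psi> :: "(real ^ 'n) \<times> real \<Rightarrow> real \<Rightarrow> real" and k :: nat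
  defines "n \<equiv> real CARD('n)"
  defines "B \<equiv> 32 * (4 * n) ^ (k - 1) * 3 ^ (k + 1)"
  assumes k: "1 \<le> k" and r: "r > 0" and m1: "m1 > 0"
    and \<psi>0: "\<And>p z. p \<in> parabolic_dom r \<Longrightarrow> \<psi> p z \<ge> 0" and \<psi>P: "\<And>p z. p \<in> parabolic_dom r \<Longrightarrow> \<psi> p z \<le> P"
    and C: "C_par 2 (parabolic_dom r) u" "C_par_closure 1 (parabolic_dom r) u"
    and conv: "\<And>p. p \<in> parabolic_dom r \<Longrightarrow> eigenvalue_vec (hess_x u p) \<in> closure (Gam k)"
    and eq: "\<And>p. p \<in> parabolic_dom r \<Longrightarrow> - pd VarT u p * sigma_k k (eigenvalue_vec (hess_x u p)) = \<psi> p (u p)"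
    and ut: "\<And>p. p \<in> parabolic_dom r \<Longrightarrow> - pd VarT u p \<ge> m1"
    and bound: "\<And>p. p \<in> parabolic_dom r \<Longrightarrow> \<bar>u p\<bar> \<le> M"
    and L: "L \<ge> 0"
    and deriv_bound: "\<And>x t e g R. (x, t) \<in> parabolic_dom r \<Longrightarrow> norm e = 1 \<Longrightarrow>
       ((\<lambda>s. u (x + s *\<^sub>R e, t)) has_real_derivative g) (at 0) \<Longrightarrow>
       ((\<lambda>s. \<psi> (x + s *\<^sub>R e, t) (u (x + s *\<^sub>R e, t))) has_real_derivative R) (at 0) \<Longrightarrow>
       \<bar>R\<bar> \<le> L * (n + \<bar>g\<bar>)"
  shows "norm (grad_x u (0, 0)) \<le> 2 * (if L = 0 then 0 else 1 + L * (n + 1) * B * M ^ (k + 1) / m1)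
     + 2 * (51 * n + B * P * (2 / m1) ^ (k - 1) / m1\<^sup>2 + 1) * (M / r)"
proof (cases "grad_x u (0, 0) = 0")
  case True
  have D0: "(0, 0) \<in> (parabolic_dom r :: ((real ^ 'n) \<times> real) set)" using r by (simp add: parabolic_dom_def)
  have "P \<ge> 0" using \<psi>0[OF D0] \<psi>P[OF D0] order_trans by blast
  moreover have "M \<ge> 0" using bound[OF D0] by linarith
  moreover have "B \<ge> 0" "n \<ge> 0" by (simp_all add: B_def n_def)
  ultimately show ?thesis unfolding True using L m1 r by simp
next
  case False
  let ?D = "parabolic_dom r :: ((real ^ 'n) \<times> real) set"
  have D0: "(0, 0) \<in> ?D" using r by (simp add: parabolic_dom_def)
  have P: "P \<ge> 0" using \<psi>0[OF D0] \<psi>P[OF D0] order_trans by blast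
  have n: "n \<ge> 1" by (simp add: n_def Suc_leI)
  have B: "B > 0" using n by (simp add: B_def)
  have osc: "m1 * r\<^sup>2 \<le> 2 * M" by (rule oscillation_lower_bound[OF r m1 C(1) ut bound])
  then have M: "M > 0" using m1 r by (smt (verit) mult_pos_pos zero_less_power)
  obtain p where p: "p \<in> ?D" "grad_x u p \<noteq> 0"
    and pmax: "\<And>q. q \<in> ?D \<Longrightarrow> (r\<^sup>2 - (norm (fst q))\<^sup>2 + snd q) * norm (grad_x u q) / sqrt (2 * M - u q)
        \<le> (r\<^sup>2 - (norm (fst p))\<^sup>2 + snd p) * norm (grad_x u p) / sqrt (2 * M - u p)"
    using weighted_gradient_attains_max[OF r M C(2) bound False] by blast
  obtain x t where xt: "p = (x, t)" by (cases p)
  have pD: "(x, t) \<in> ?D" using p(1) by (simp add: xt)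
  define g where "g = norm (grad_x u (x, t))"
  define e where "e = (1 / g) *\<^sub>R grad_x u (x, t)"
  define \<rho> where "\<rho> = r\<^sup>2 - (norm x)\<^sup>2 + t"
  define y where "y = 2 * M - u (x, t)"
  have g: "g > 0" using p(2) by (simp add: g_def xt)
  have e: "norm e = 1" using g by (simp add: e_def g_def)
  have grad: "grad_x u (x, t) = g *\<^sub>R e" using g by (simp add: e_def)
  have \<rho>: "\<rho> > 0" "\<rho> \<le> r\<^sup>2"
    using pD order_trans[of t 0 "(norm x)\<^sup>2"] by (auto simp: \<rho>_def parabolic_dom_def)
  have y: "M \<le> y" "y \<le> 3 * M" using bound[OF pD] by (auto simp: y_def abs_le_iff)
  have y0: "y > 0" using y M by linarith
  have max: "(r\<^sup>2 - (norm z)\<^sup>2 + s) * (e \<bullet> grad_x u (z, s)) / sqrt (2 * M - u (z, s)) \<le> \<rho> * g / sqrt y"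
    if q: "(z, s) \<in> ?D" for z s
  proof -
    have "e \<bullet> grad_x u (z, s) \<le> norm (grad_x u (z, s))"
      using norm_cauchy_schwarz[of e "grad_x u (z, s)"] e by simp
    moreover have "r\<^sup>2 - (norm z)\<^sup>2 + s \<ge> 0" using q by (simp add: parabolic_dom_def)
    moreover have "2 * M - u (z, s) > 0" using bound[OF q] M by (simp add: abs_le_iff)
    ultimately have "(r\<^sup>2 - (norm z)\<^sup>2 + s) * (e \<bullet> grad_x u (z, s)) / sqrt (2 * M - u (z, s))
        \<le> (r\<^sup>2 - (norm z)\<^sup>2 + s) * norm (grad_x u (z, s)) / sqrt (2 * M - u (z, s))"
      by (intro divide_right_mono mult_left_mono) auto
    also have "\<dots> \<le> \<rho> * g / sqrt y"
      using pmax[OF q] by (simp add: xt \<rho>_def g_def y_def)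
    finally show ?thesis .
  qed
  have g\<rho>: "g * \<rho> \<le> (if L = 0 then 0 else 1 + L * (n + 1) * B * M ^ (k + 1) / m1) * r\<^sup>2
     + (51 * n + B * P * (2 / m1) ^ (k - 1) / m1\<^sup>2 + 1) * (M * r)" (is "_ \<le> ?c1 * r\<^sup>2 + (51 * n + ?K + 1) * (M * r)")
  proof -
    have c1: "?c1 \<ge> 0" using L n B M m1 by simp
    have K: "?K \<ge> 0" using B P m1 by simp
    show ?thesis
    proof (cases "17 * n * r * y \<le> g * \<rho>")
      case small: False
      then have "g * \<rho> \<le> 17 * n * r * y" by simp
      also have "\<dots> \<le> 17 * n * r * (3 * M)" using n r y by (intro mult_left_mono) auto
      also have "\<dots> \<le> ?c1 * r\<^sup>2 + (51 * n + ?K + 1) * (M * r)"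
      proof -
        have "0 \<le> ?c1 * r\<^sup>2" using c1 by (intro mult_nonneg_nonneg) auto
        moreover have "0 \<le> (?K + 1) * (M * r)" using K M r by (intro mult_nonneg_nonneg) auto
        ultimately show ?thesis by (simp add: algebra_simps)
      qed
      finally show ?thesis .
    next
      case large: True
      obtain \<delta> where \<delta>: "\<delta> > 0" "\<And>z s. norm (z - x) < \<delta> \<Longrightarrow> \<bar>s - t\<bar> < \<delta> \<Longrightarrow> s \<le> 0 \<Longrightarrow> (z, s) \<in> ?D"
        using parabolic_dom_neighbourhood[OF pD] by blast
      have t: "t \<le> 0" using pD by (simp add: parabolic_dom_def)
      have line: "(x + s *\<^sub>R e, t) \<in> ?D" if "\<bar>s\<bar> < \<delta>" for s
        using that \<delta>(1) t e by (intro \<delta>(2)) auto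
      let ?lhs = "\<lambda>s. - pd VarT u (x + s *\<^sub>R e, t) * sigma_k k (eigenvalue_vec (hess_x u (x + s *\<^sub>R e, t)))"
      let ?rhs = "\<lambda>s. \<psi> (x + s *\<^sub>R e, t) (u (x + s *\<^sub>R e, t))"
      obtain v :: "'n \<Rightarrow> real ^ 'n" where v: "\<And>i j. v i \<bullet> v j = (if i = j then 1 else 0)"
          "\<And>i. hess_x u (x, t) *v v i = (eigenvalue_vec (hess_x u (x, t)) $ i) *\<^sub>R v i"
        using eigenvalue_vec_eigenbasis[OF hess_x_symmetric[OF C(1) pD]] by blast
      obtain R where R: "(?lhs has_real_derivative R) (at 0)"
        using DERIV_operator_along_line[OF C(1) k pD e v] by blast
      have "\<forall>\<^sub>F s in nhds 0. ?lhs s = ?rhs s"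
        unfolding eventually_nhds_metric using \<delta>(1) eq[OF line]
        by (intro exI[of _ \<delta>]) (auto simp: dist_real_def)
      then have R': "(?rhs has_real_derivative R) (at 0)"
        using R by (subst (asm) DERIV_cong_ev) auto
      have "((\<lambda>s. foldr pd [] u (x + s *\<^sub>R e, t)) has_real_derivative
         (\<Sum>i\<in>UNIV. foldr pd [VarX i] u (x + 0 *\<^sub>R e, t) * e $ i)) (at 0)"
        using pD by (intro C_par_DERIV_direction[OF C(1)]) auto
      moreover have "(\<Sum>i\<in>UNIV. foldr pd [VarX i] u (x + 0 *\<^sub>R e, t) * e $ i) = grad_x u (x, t) \<bullet> e"
        by (simp add: inner_vec_def grad_x_def del: pd.simps)
      moreover have "grad_x u (x, t) \<bullet> e = g" using e by (simp add: grad norm_eq_1)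
      ultimately have "((\<lambda>s. u (x + s *\<^sub>R e, t)) has_real_derivative g) (at 0)" by simp
      then have Rb: "\<bar>R\<bar> \<le> L * (n + g)" using deriv_bound[OF pD e _ R'] g by fastforce
      have "m1 * (g\<^sup>2 / (4 * n * y)) ^ (k - 1) * (g\<^sup>2 / (16 * y\<^sup>2))
          \<le> sigma_k k (eigenvalue_vec (hess_x u (x, t))) / \<rho> - R / g"
        unfolding n_def y_def \<rho>_def
        by (rule inequality_at_maximum[OF k r m1 M g C(1) pD conv[OF pD] ut[OF pD] bound grad e _ R])
           (use max large in \<open>simp_all add: \<rho>_def y_def n_def\<close>)
      also have "\<dots> \<le> P / (m1 * \<rho>) + L * (n + g) / g"
      proof (rule order_trans[OF _ add_mono])
        let ?\<sigma> = "sigma_k k (eigenvalue_vec (hess_x u (x, t)))"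
        show "?\<sigma> / \<rho> - R / g \<le> ?\<sigma> / \<rho> + \<bar>R\<bar> / g"
          using divide_right_mono[of "- R" "\<bar>R\<bar>" g] g by simp
        have "?\<sigma> \<ge> 0"
          using closure_Gam_esym_nonneg[OF conv[OF pD], of k] by (simp add: sigma_k_eq_esym)
        then have "m1 * ?\<sigma> \<le> - pd VarT u (x, t) * ?\<sigma>" using ut[OF pD] by (intro mult_right_mono)
        also have "\<dots> \<le> P" using eq[OF pD] \<psi>P[OF pD] by simp
        finally have "?\<sigma> \<le> P / m1" using m1 by (simp add: field_simps)
        then have "?\<sigma> / \<rho> \<le> P / m1 / \<rho>" using \<rho> by (intro divide_right_mono) auto
        then show "?\<sigma> / \<rho> \<le> P / (m1 * \<rho>)" by simp
        show "\<bar>R\<bar> / g \<le> L * (n + g) / g" using Rb g by (intro divide_right_mono) auto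
      qed
      finally have alt: "g * \<rho> \<le> (?K + 1) * (M * r) \<or> m1 * g ^ (2 * k) \<le> B * M ^ (k + 1) * (L * (n + g) / g)"
        unfolding B_def by (rule gradient_alternative[OF k n m1 M r \<rho>(1) g y0 y(2) \<rho>(2) osc P])
      have nn: "0 \<le> 51 * n * (M * r)" "0 \<le> ?c1 * r\<^sup>2" "0 \<le> (?K + 1) * (M * r)"
        using n M r c1 K by auto
      from alt show ?thesis
      proof
        assume "g * \<rho> \<le> (?K + 1) * (M * r)"
        then show ?thesis using nn by (simp add: algebra_simps)
      next
        assume a: "m1 * g ^ (2 * k) \<le> B * M ^ (k + 1) * (L * (n + g) / g)"
        have "L \<noteq> 0"
        proof
          assume "L = 0"
          then have "m1 * g ^ (2 * k) \<le> 0" using a by simp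
          moreover have "m1 * g ^ (2 * k) > 0" using m1 g by simp
          ultimately show False by linarith
        qed
        have "g \<le> ?c1"
        proof (cases "g \<le> 1")
          case True
          then show ?thesis using \<open>L \<noteq> 0\<close> L n B M m1 by (simp add: add_increasing2)
        next
          case False
          have "m1 * g \<le> m1 * g ^ (2 * k)" using False m1 k by (intro mult_left_mono self_le_power) auto
          also note a
          also have "B * M ^ (k + 1) * (L * (n + g) / g) \<le> B * M ^ (k + 1) * (L * (n + 1))"
          proof -
            have "(n + g) / g \<le> n + 1" using False n by (simp add: field_simps)
            then have "L * ((n + g) / g) \<le> L * (n + 1)" using L by (rule mult_left_mono)
            then show ?thesis using B M by (intro mult_left_mono) auto
          qed
          finally have "g \<le> L * (n + 1) * B * M ^ (k + 1) / m1" using m1 by (simp add: field_simps)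
          then show ?thesis using \<open>L \<noteq> 0\<close> by simp
        qed
        then have "g * \<rho> \<le> ?c1 * r\<^sup>2" using \<rho> g c1 by (intro mult_mono) auto
        then show ?thesis using nn by (simp add: algebra_simps)
      qed
    qed
  qed
  have "r\<^sup>2 * norm (grad_x u (0, 0)) / sqrt (2 * M - u (0, 0)) \<le> \<rho> * g / sqrt y"
    using pmax[OF D0] by (simp add: xt \<rho>_def g_def y_def)
  moreover have y00: "0 < 2 * M - u (0, 0)" "2 * M - u (0, 0) \<le> 4 * y"
    using bound[OF D0] y M by (auto simp: abs_le_iff)
  moreover have "sqrt (2 * M - u (0, 0)) \<le> 2 * sqrt y"
    using y00(2) real_sqrt_le_mono[of "2 * M - u (0, 0)" "4 * y"] by (simp add: real_sqrt_mult)
  ultimately have "r\<^sup>2 * norm (grad_x u (0, 0)) \<le> \<rho> * g / sqrt y * (2 * sqrt y)"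
    using y0 \<rho> g by (smt (verit) divide_nonneg_nonneg mult_left_mono mult_nonneg_nonneg pos_divide_le_eq real_sqrt_gt_zero)
  then have "r\<^sup>2 * norm (grad_x u (0, 0)) \<le> 2 * (g * \<rho>)" using y0 by (simp add: mult_ac)
  also have "\<dots> \<le> 2 * (?c1 * r\<^sup>2 + (51 * n + ?K + 1) * (M * r))" using g\<rho> by simp
  also have "\<dots> = r\<^sup>2 * (2 * ?c1 + 2 * (51 * n + ?K + 1) * (M / r))"
    using r by (simp add: field_simps power2_eq_square)
  finally show ?thesis using r by (simp add: mult_le_cancel_left)
qed

theorem theorem1p1:
  fixes k :: nat
  assumes "1 \<le> k" and "k \<le> CARD('n::finite)"
  shows "\<exists>(C1 :: real \<Rightarrow> real \<Rightarrow> real \<Rightarrow> real \<Rightarrow> real) (C2 :: real \<Rightarrow> real \<Rightarrow> real).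
    (\<forall>r m1 M L. C1 r m1 M L > 0) \<and> (\<forall>m1 P. C2 m1 P > 0) \<and>
    (\<forall>(r :: real) (m1 :: real) (\<psi> :: (real ^ 'n) \<times> real \<Rightarrow> real \<Rightarrow> real) (u :: (real ^ 'n) \<times> real \<Rightarrow> real).
      let D = (parabolic_dom r :: ((real ^ 'n) \<times> real) set);
          M = (SUP p\<in>D. \<bar>u p\<bar>);
          L = Sup (deriv_values D \<psi>);
          P = (SUP (p, z)\<in>D \<times> UNIV. \<psi> p z)
      in
        r > 0 \<and> m1 > 0 \<and>
        (\<forall>p\<in>closure D. \<forall>z. \<psi> p z \<ge> 0) \<and>
        lipschitz_x (closure D) \<psi> \<and> lipschitz_z (closure D) \<psi> \<and>
        C_par 2 D u \<and> C_par_closure 1 D u \<and>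
        k_convex_monotone k D u \<and>
        (\<forall>p\<in>D. - pd VarT u p * sigma_k k (eigenvalue_vec (hess_x u p)) = \<psi> p (u p)) \<and>
        (\<forall>p\<in>D. - pd VarT u p \<ge> m1) \<and>
        bdd_above ((\<lambda>p. \<bar>u p\<bar>) ` D) \<and>
        bdd_above (deriv_values D \<psi>) \<and>
        bdd_above ((\<lambda>(p, z). \<psi> p z) ` (D \<times> UNIV))
        \<longrightarrow>
        norm (grad_x u (0, 0)) \<le> C1 r m1 M L + C2 m1 P * (M / r) \<and>
        ((\<exists>c. \<forall>p\<in>closure D. \<forall>z. \<psi> p z = c) \<longrightarrow>
           norm (grad_x u (0, 0)) \<le> C2 m1 P * (M / r)))"
proof -
  define n where "n = real CARD('n)"
  define B where "B = 32 * (4 * n) ^ (k - 1) * 3 ^ (k + 1)"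
  \<comment> \<open>The constants are required to be positive for all arguments, also for those that do not occur; hence the absolute values.\<close>
  define C1 :: "real \<Rightarrow> real \<Rightarrow> real \<Rightarrow> real \<Rightarrow> real"
    where "C1 r m1 M L = 2 * (1 + \<bar>L\<bar> * (n + 1) * B * \<bar>M\<bar> ^ (k + 1) / \<bar>m1\<bar>)" for r m1 M L
  define C2 :: "real \<Rightarrow> real \<Rightarrow> real"
    where "C2 m1 P = 2 * (51 * n + B * \<bar>P\<bar> * (2 / \<bar>m1\<bar>) ^ (k - 1) / m1\<^sup>2 + 1)" for m1 P
  have n: "n \<ge> 0" by (simp add: n_def)
  then have B: "B \<ge> 0" by (simp add: B_def)
  have C1: "C1 r m1 M L > 0" for r m1 M L
    unfolding C1_def using n B by (intro mult_pos_pos add_pos_nonneg) auto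
  have C2: "C2 m1 P > 0" for m1 P
    unfolding C2_def using n B by (intro mult_pos_pos add_nonneg_pos add_nonneg_nonneg) auto
  show ?thesis
  proof (rule exI[of _ C1], rule exI[of _ C2], unfold Let_def, intro conjI[of "\<forall>r m1 M L. C1 r m1 M L > 0"]
      conjI[of "\<forall>m1 P. C2 m1 P > 0"] allI impI C1 C2)
    fix r m1 :: real and \<psi> :: "(real ^ 'n) \<times> real \<Rightarrow> real \<Rightarrow> real" and u :: "(real ^ 'n) \<times> real \<Rightarrow> real"
    let ?D = "parabolic_dom r :: ((real ^ 'n) \<times> real) set"
    let ?M = "SUP p\<in>?D. \<bar>u p\<bar>" and ?L = "Sup (deriv_values ?D \<psi>)" and ?P = "SUP (p, z)\<in>?D \<times> UNIV. \<psi> p z"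
    assume H: "r > 0 \<and> m1 > 0 \<and>
        (\<forall>p\<in>closure ?D. \<forall>z. \<psi> p z \<ge> 0) \<and>
        lipschitz_x (closure ?D) \<psi> \<and> lipschitz_z (closure ?D) \<psi> \<and>
        C_par 2 ?D u \<and> C_par_closure 1 ?D u \<and>
        k_convex_monotone k ?D u \<and>
        (\<forall>p\<in>?D. - pd VarT u p * sigma_k k (eigenvalue_vec (hess_x u p)) = \<psi> p (u p)) \<and>
        (\<forall>p\<in>?D. - pd VarT u p \<ge> m1) \<and>
        bdd_above ((\<lambda>p. \<bar>u p\<bar>) ` ?D) \<and>
        bdd_above (deriv_values ?D \<psi>) \<and>
        bdd_above ((\<lambda>(p, z). \<psi> p z) ` (?D \<times> UNIV))"
    note r = H[THEN conjunct1] and H2 = H[THEN conjunct2]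
    note m1 = H2[THEN conjunct1] and H3 = H2[THEN conjunct2]
    note nonneg = H3[THEN conjunct1] and H4 = H3[THEN conjunct2]
    note lipx = H4[THEN conjunct1] and H5 = H4[THEN conjunct2]
    note lipz = H5[THEN conjunct1] and H6 = H5[THEN conjunct2]
    note C1u = H6[THEN conjunct1] and H7 = H6[THEN conjunct2]
    note C2u = H7[THEN conjunct1] and H8 = H7[THEN conjunct2]
    note conv = H8[THEN conjunct1] and H9 = H8[THEN conjunct2]
    note eq = H9[THEN conjunct1] and H10 = H9[THEN conjunct2]
    note ut = H10[THEN conjunct1] and H11 = H10[THEN conjunct2]
    note bM = H11[THEN conjunct1] and H12 = H11[THEN conjunct2]
    note bL = H12[THEN conjunct1] and bP = H12[THEN conjunct2]
    note lip = lipx lipz and C = C1u C2u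
    have inD: "(0, 0) \<in> ?D" using r by (simp add: parabolic_dom_def)
    have M: "\<bar>u p\<bar> \<le> ?M" if "p \<in> ?D" for p
      by (rule cSUP_upper[OF that bM])
    have P: "\<psi> p z \<le> ?P" if "p \<in> ?D" for p z
      using cSUP_upper[OF _ bP, of "(p, z)"] that by simp
    have \<psi>0: "\<psi> p z \<ge> 0" if "p \<in> ?D" for p z
      using nonneg that closure_subset by blast
    have M0: "?M \<ge> 0" using M[OF inD] by (rule order_trans[OF abs_ge_zero])
    have P0: "?P \<ge> 0" using \<psi>0[OF inD, of 0] P[OF inD, of 0] by (rule order_trans)
    have conv': "eigenvalue_vec (hess_x u p) \<in> closure (Gam k)" if "p \<in> ?D" for p
      using conv that by (simp add: k_convex_monotone_def)
    have estimate: "norm (grad_x u (0, 0)) \<le> 2 * (if L = 0 then 0 else 1 + L * (n + 1) * B * ?M ^ (k + 1) / m1)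
        + C2 m1 ?P * (?M / r)"
      if "L \<ge> 0" and "\<And>x t e g R. (x, t) \<in> ?D \<Longrightarrow> norm e = 1 \<Longrightarrow>
         ((\<lambda>s. u (x + s *\<^sub>R e, t)) has_real_derivative g) (at 0) \<Longrightarrow>
         ((\<lambda>s. \<psi> (x + s *\<^sub>R e, t) (u (x + s *\<^sub>R e, t))) has_real_derivative R) (at 0) \<Longrightarrow>
         \<bar>R\<bar> \<le> L * (n + \<bar>g\<bar>)" for L
    proof -
      have "norm (grad_x u (0, 0)) \<le> 2 * (if L = 0 then 0 else 1 + L * (n + 1) * B * ?M ^ (k + 1) / m1)
        + 2 * (51 * n + B * ?P * (2 / m1) ^ (k - 1) / m1\<^sup>2 + 1) * (?M / r)"
        unfolding n_def B_def
        by (rule gradient_estimate[OF assms(1) r m1 \<psi>0 P C conv' _ _ M that[unfolded n_def]])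
           (use eq ut in \<open>simp_all del: pd.simps\<close>)
      then show ?thesis using P0 m1 by (simp add: C2_def)
    qed
    show "norm (grad_x u (0, 0)) \<le> C1 r m1 ?M ?L + C2 m1 ?P * (?M / r) \<and>
        ((\<exists>c. \<forall>p\<in>closure ?D. \<forall>z. \<psi> p z = c) \<longrightarrow> norm (grad_x u (0, 0)) \<le> C2 m1 ?P * (?M / r))"
    proof (intro conjI impI)
      have L: "?L \<ge> 0"
        and graph: "\<And>x t e g R. (x, t) \<in> ?D \<Longrightarrow> norm e = 1 \<Longrightarrow>
         ((\<lambda>s. u (x + s *\<^sub>R e, t)) has_real_derivative g) (at 0) \<Longrightarrow>
         ((\<lambda>s. \<psi> (x + s *\<^sub>R e, t) (u (x + s *\<^sub>R e, t))) has_real_derivative R) (at 0) \<Longrightarrow>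
         \<bar>R\<bar> \<le> ?L * (n + \<bar>g\<bar>)"
        using deriv_values_bound_nonneg[OF lip bL inD] bound_along_graph[OF lip bL] by (simp_all add: n_def)
      have "norm (grad_x u (0, 0)) \<le> 2 * (if ?L = 0 then 0 else 1 + ?L * (n + 1) * B * ?M ^ (k + 1) / m1)
        + C2 m1 ?P * (?M / r)"
        by (rule estimate[OF L graph])
      also have "2 * (if ?L = 0 then 0 else 1 + ?L * (n + 1) * B * ?M ^ (k + 1) / m1) \<le> C1 r m1 ?M ?L"
        using L M0 m1 by (simp add: C1_def)
      finally show "norm (grad_x u (0, 0)) \<le> C1 r m1 ?M ?L + C2 m1 ?P * (?M / r)" by simp
    next
      assume "\<exists>c. \<forall>p\<in>closure ?D. \<forall>z. \<psi> p z = c"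
      then obtain c where c: "\<And>p z. p \<in> ?D \<Longrightarrow> \<psi> p z = c" using closure_subset by blast
      have "\<bar>R\<bar> \<le> 0 * (n + \<bar>g\<bar>)"
        if D: "(x, t) \<in> ?D" and e: "norm e = 1"
          and R: "((\<lambda>s. \<psi> (x + s *\<^sub>R e, t) (u (x + s *\<^sub>R e, t))) has_real_derivative R) (at 0)"
        for x e :: "real ^ 'n" and t g R :: real
      proof -
        obtain \<delta> where \<delta>: "\<delta> > 0" "\<And>y s. norm (y - x) < \<delta> \<Longrightarrow> \<bar>s - t\<bar> < \<delta> \<Longrightarrow> s \<le> 0 \<Longrightarrow> (y, s) \<in> ?D"
          using parabolic_dom_neighbourhood[OF D] by blast
        have t: "t \<le> 0" using D by (simp add: parabolic_dom_def)
        have "\<psi> (x + s *\<^sub>R e, t) (u (x + s *\<^sub>R e, t)) = c" if "\<bar>s\<bar> < \<delta>" for s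
          using that \<delta>(1) t e by (intro c \<delta>(2)) auto
        then have "\<forall>\<^sub>F s in nhds 0. \<psi> (x + s *\<^sub>R e, t) (u (x + s *\<^sub>R e, t)) = c"
          unfolding eventually_nhds_metric using \<delta>(1) by (intro exI[of _ \<delta>]) (auto simp: dist_real_def)
        then have "((\<lambda>s. c) has_real_derivative R) (at 0)"
          using R by (subst (asm) DERIV_cong_ev) auto
        then have "R = 0" by (rule DERIV_unique) (rule DERIV_const)
        then show ?thesis by simp
      qed
      from estimate[OF order_refl this] show "norm (grad_x u (0, 0)) \<le> C2 m1 ?P * (?M / r)" by simp
    qed
  qed
qed

end
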